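(* Let $k\ge 1$ be an integer, let $N$ be a perfect square (a positive integer), and let $f(z)=\sum_{n=1}^{\infty}a_{f}(n)e^{2\pi i n z}\in S_{k+\frac12}(\Gamma_0(4N))$ be nonzero and such that $f|W_{4N}=f$ or $f|W_{4N}=-f$. Assume that the Fourier coefficients $a_f(n)$ are either all real or all purely imaginary. Let $N_0(T)$ denote the number of zeros of odd order of $L(s,f)$ of the form $s=\frac k2+\frac14+it$ with $0\le t\le T$. Then $N_0(T)=\Omega(T^{1/2})$ as $T\to\infty$; equivalently, there exists $d>0$ such that $$\limsup_{T\to\infty}\frac{N_0(T)}{T^{1/2}}>d.$$
   Context: $\mathbb{H}=\{w\in\mathbb{C}:\mathrm{Im}(w)>0\}$. The square root $z^{1/2}$ is chosen with $-\frac{\pi}{2}<\arg(z^{1/2})\le\frac{\pi}{2}$, and half-integral powers are $z^{k+1/2}=(z^{1/2})^{2k+1}$. $S_{k+\frac12}(\Gamma_0(4N))$ is the space of cusp forms of weight $k+\frac12$ on $\Gamma_0(4N)$: holomorphic functions $f$ on $\mathbb{H}$, vanishing at all cusps, satisfying $$f\left(\frac{az+b}{cz+d}\right)=\left(\frac{c}{d}\right)^{2k+1}\epsilon_d^{-2k-1}(cz+d)^{k+\frac12}f(z)\quad\text{for all }\begin{pmatrix}a&b\\c&d\end{pmatrix}\in\Gamma_0(4N),$$ where $\left(\frac{c}{d}\right)$ is Shimura's extension of the Jacobi symbol (for odd $d$: the Jacobi symbol $\left(\frac{c}{d}\right)$ if $d>0$; for $d<0$ and $c\neq0$, it is $\left(\frac{c}{|d|}\right)$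 if $c>0$ and $-\left(\frac{c}{|d|}\right)$ if $c<0$; and $\left(\frac{0}{\pm1}\right)=1$), and $\epsilon_d=1$ if $d\equiv1\bmod 4$, $\epsilon_d=i$ if $d\equiv 3\bmod 4$. Such $f$ has a Fourier expansion $f(z)=\sum_{n\ge1}a_f(n)e^{2\pi i n z}$. The Fricke involution on $S_{k+\frac12}(\Gamma_0(4N))$ is $$(f|W_{4N})(z)=i^{k+\frac12}(4N)^{-\frac k2-\frac14}z^{-k-\frac12}f\left(-\frac{1}{4Nz}\right).$$ $L(s,f)=\sum_{n\ge1}a_f(n)n^{-s}$ for $\mathrm{Re}(s)$ large, and $L(s,f)$ also denotes its continuation to an entire function of $s$. *)

theory Defs
  imports "HOL-Complex_Analysis.Complex_Analysis" "HOL-Number_Theory.Number_Theory"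
begin

definition upper_half_plane :: "complex set" where
  "upper_half_plane = {z. Im z > 0}"

text \<open>
  \<open>half_power z m\<close> is \<open>z\<close> to the power \<open>m + 1/2\<close>. The branch of \<^const>\<open>csqrt\<close> satisfies
  \<open>- pi / 2 < Arg (csqrt z) \<le> pi / 2\<close> for \<open>z \<noteq> 0\<close>.
\<close>
definition half_power :: "complex \<Rightarrow> int \<Rightarrow> complex" where
  "half_power z m = csqrt z powi (2 * m + 1)"

text \<open>Only meaningful for odd \<open>d > 0\<close>.\<close>
definition jacobi_symbol :: "int \<Rightarrow> int \<Rightarrow> int" where
  "jacobi_symbol c d = (\<Prod>p\<in>prime_factors d. Legendre c p ^ multiplicity p d)"

text \<open>
  Shimura's extension to odd \<open>d\<close> of either sign. For \<open>c = 0\<close> and \<open>d = 1\<close> or \<open>d = -1\<close> the product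
  is empty, so the value is \<open>1\<close>.
\<close>
definition shimura_symbol :: "int \<Rightarrow> int \<Rightarrow> int" where
  "shimura_symbol c d =
     (if c < 0 \<and> d < 0 then - jacobi_symbol c \<bar>d\<bar> else jacobi_symbol c \<bar>d\<bar>)"

text \<open>Only used for odd \<open>d\<close>.\<close>
definition theta_eps :: "int \<Rightarrow> complex" where
  "theta_eps d = (if d mod 4 = 1 then 1 else \<i>)"

text \<open>
  Vanishing at the cusp \<open>a / c\<close> (at infinity if \<open>c = 0\<close>) says that the weight \<open>k + 1/2\<close>
  transform of \<open>f\<close> by the matrix \<open>((a, b), (c, d))\<close> in \<open>SL\<^sub>2(\<int>)\<close> tends to \<open>0\<close> as \<open>Im z\<close> tends to
  infinity, uniformly in \<open>Re z\<close>. The choice of the branch changes the transform only by a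
  constant of modulus one, so it does not matter here.
\<close>
definition vanishes_at_cusps :: "nat \<Rightarrow> (complex \<Rightarrow> complex) \<Rightarrow> bool" where
  "vanishes_at_cusps k f \<longleftrightarrow>
     (\<forall>a b c d :: int. a * d - b * c = 1 \<longrightarrow>
        ((\<lambda>z. half_power (of_int c * z + of_int d) (- int k - 1) *
               f ((of_int a * z + of_int b) / (of_int c * z + of_int d)))
           \<longlongrightarrow> 0) (filtercomap Im at_top))"

text \<open>
  \<open>half_cusp_forms k M\<close> is \<open>S\<^bsub>k+1/2\<^esub>(\<Gamma>\<^sub>0(M))\<close> for \<open>4 dvd M\<close>. A form is a function on all of
  \<^typ>\<open>complex\<close>; its values outside the upper half plane are irrelevant.
\<close>
definition half_cusp_forms :: "nat \<Rightarrow> nat \<Rightarrow> (complex \<Rightarrow> complex) set" where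
  "half_cusp_forms k M =
     {f. f holomorphic_on upper_half_plane \<and>
         (\<forall>a b c d :: int. a * d - b * c = 1 \<longrightarrow> int M dvd c \<longrightarrow>
            (\<forall>z\<in>upper_half_plane.
               f ((of_int a * z + of_int b) / (of_int c * z + of_int d)) =
                 of_int (shimura_symbol c d) ^ (2 * k + 1) *
                 theta_eps d powi (- 2 * int k - 1) *
                 half_power (of_int c * z + of_int d) (int k) * f z)) \<and>
         vanishes_at_cusps k f}"

definition fricke :: "nat \<Rightarrow> nat \<Rightarrow> (complex \<Rightarrow> complex) \<Rightarrow> complex \<Rightarrow> complex" where
  "fricke k M f z =
     half_power \<i> (int k) * of_real (real M powr (- real k / 2 - 1 / 4)) *
     half_power z (- int k - 1) * f (- 1 / (of_nat M * z))"

text \<open>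
  \<open>entire_L a\<close> is the entire continuation of the Dirichlet series with coefficients
  \<open>a 1, a 2, \<dots>\<close>. If it exists, it is unique by the identity theorem. The value \<open>a 0\<close> is not used.
\<close>
definition is_entire_L :: "(nat \<Rightarrow> complex) \<Rightarrow> (complex \<Rightarrow> complex) \<Rightarrow> bool" where
  "is_entire_L a L \<longleftrightarrow>
     L holomorphic_on UNIV \<and>
     (\<exists>\<sigma>::real. \<forall>s. Re s > \<sigma> \<longrightarrow>
        (\<lambda>n. a (Suc n) * of_nat (Suc n) powr (- s)) sums L s)"

definition entire_L :: "(nat \<Rightarrow> complex) \<Rightarrow> complex \<Rightarrow> complex" where
  "entire_L a = (THE L. is_entire_L a L)"

lemma is_entire_L_unique:
  assumes "is_entire_L a L" "is_entire_L a L'"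
  shows "L = L'"
proof
  fix w
  obtain \<sigma> where \<sigma>: "\<And>s. Re s > \<sigma> \<Longrightarrow> (\<lambda>n. a (Suc n) * of_nat (Suc n) powr (- s)) sums L s"
    using assms(1) unfolding is_entire_L_def by blast
  obtain \<sigma>' where \<sigma>': "\<And>s. Re s > \<sigma>' \<Longrightarrow> (\<lambda>n. a (Suc n) * of_nat (Suc n) powr (- s)) sums L' s"
    using assms(2) unfolding is_entire_L_def by blast
  let ?S = "{s. Re s > max \<sigma> \<sigma>'}"
  have "of_real (max \<sigma> \<sigma>' + 1) \<in> ?S" by (auto simp: max_def)
  then have ne: "?S \<noteq> {}" by (metis empty_iff)
  have op: "open ?S" by (rule open_halfspace_Re_gt)
  have eq: "L z = L' z" if "z \<in> ?S" for z
    using that \<sigma>[of z] \<sigma>'[of z] by (intro sums_unique2) auto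
  show "L w = L' w"
  proof (rule analytic_continuation_open[where f = L and g = L' and z = w, OF op open_UNIV ne])
    show "L holomorphic_on UNIV" "L' holomorphic_on UNIV"
      using assms by (simp_all add: is_entire_L_def)
  qed (use eq in auto)
qed

text \<open>Zeros are counted without multiplicity.\<close>
definition odd_zero_count :: "(complex \<Rightarrow> complex) \<Rightarrow> real \<Rightarrow> real \<Rightarrow> nat" where
  "odd_zero_count L c T =
     card {s. Re s = c \<and> 0 \<le> Im s \<and> Im s \<le> T \<and> L s = 0 \<and> odd (zorder L s)}"

end

theory Submission
  imports Defs "HOL-Real_Asymp.Real_Asymp"
begin

text \<open>
  With \<open>N = m\<^sup>2\<close> and \<open>\<kappa> = k / 2 + 1 / 4\<close> put \<open>h u = f (i e\<^sup>u / (2 m)) e\<^bsup>\<kappa> u\<^esup>\<close> for \<open>\<bar>Im u\<bar> < pi / 2\<close>.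
  Up to a factor without zeros, \<open>L (\<kappa> + i t)\<close> is \<open>H t = \<integral> h x e\<^bsup>i t x\<^esup> dx\<close>; by the Fricke symmetry \<open>H\<close> is,
  up to a constant, real and even or odd, and Fourier inversion gives
  \<open>\<integral> H t e\<^bsup>t w\<^esup> dt = 2 pi h (i w)\<close> for \<open>\<bar>Re w\<bar> < pi / 2\<close>. At \<open>w = pi / 2\<close> the argument of \<open>f\<close> is the cusp
  \<open>- 1 / (2 m)\<close>, so \<open>h (i w)\<close> is at most a constant times \<open>e\<^bsup>- c / \<delta>\<^esup>\<close> near \<open>w = pi / 2 - \<delta>\<close>.

  Suppose that \<open>H\<close> had at most \<open>\<epsilon> \<surd>T\<close> zeros of odd order up to every large height \<open>T\<close>. Multiplied by
  \<open>P t = \<Prod> (1 - t\<^sup>2 / \<tau>\<^sup>2)\<close>, the product over these zeros \<open>\<tau>\<close>, \<open>H\<close> has constant sign, and the \<open>2 n\<close>-th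
  coefficient of \<open>P\<close> is of size \<open>(C \<epsilon>)\<^bsup>4 n\<^esup> / n\<^bsup>4 n\<^esup>\<close>. Cauchy's estimate for the derivatives of \<open>h\<close> then bounds
  \<open>\<integral> H t P t e\<^bsup>t (pi / 2 - \<delta>)\<^esup> dt\<close> by a constant times \<open>e\<^bsup>C \<epsilon>\<^sup>2 / \<delta> - c / \<delta>\<^esup>\<close>, which tends to \<open>0\<close> with \<open>\<delta>\<close> if
  \<open>\<epsilon>\<close> is small. This is impossible for an integrand of constant sign.
\<close>

section \<open>Power series and exponential integrals\<close>

text \<open>The exponent 1/2 comes from a balance. If, beyond a fixed height, the
  \<open>j\<close>-th zero is at least \<open>(j / \<epsilon>)^2\<close>, comparison with Euler's
  sine product bounds \<open>P t\<close> by a constant times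
  \<open>e^(2 pi \<epsilon> sqrt |t|)\<close>. Against \<open>e^(- \<delta> |t|)\<close> such growth
  gains at most a factor \<open>e^(const \<epsilon>^2 / \<delta>)\<close>, of the same order in
  \<open>1 / \<delta>\<close> as the decay at the cusp; a small \<open>\<epsilon>\<close> then
  decides.

  Growth of \<open>P\<close> alone cannot make the integral small: that comes from cancellation,
  which is visible only in the moments of \<open>H\<close>, that is, in derivatives of
  \<open>h\<close> taken where \<open>h\<close> itself is tiny. Hence the detour through the
  coefficients of \<open>P\<close>.

  There may be infinitely many zeros, so \<open>P\<close> is truncated at a height \<open>A\<close>.
  The sign is then controlled only for \<open>|t| < A\<close>, and every constant has to be uniform
  in \<open>A\<close>: first \<open>A\<close> tends to infinity at fixed \<open>\<delta>\<close>,
  which removes the rest of the integral, and only then \<open>\<delta>\<close> tends to 0. If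
  \<open>H\<close> is odd, the sign flips at the origin; a symmetrised kernel repairs this.

  On the modular side the theta multiplier is removed by passing to \<open>f^8\<close>, at the price
  of a constant factor in exponents.\<close>

lemma power_series_Cauchy_bound:
  fixes a :: "nat \<Rightarrow> complex"
  assumes sums: "\<And>w. norm w < R \<Longrightarrow> (\<lambda>n. a n * w ^ n) sums f w"
    and r: "0 < r" "r < R" and B: "\<And>w. norm w = r \<Longrightarrow> norm (f w) \<le> B"
  shows "norm (a n) \<le> B / r ^ n"
proof -
  have conv: "fps_conv_radius (Abs_fps a) \<ge> ereal R"
    unfolding fps_conv_radius_def
  proof (rule conv_radius_geI_ex')
    fix s assume "0 < s" "ereal s < ereal R"
    then show "summable (\<lambda>n. fps_nth (Abs_fps a) n * of_real s ^ n)"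
      using sums[of "of_real s"] by (auto simp: sums_iff)
  qed
  have ev: "eval_fps (Abs_fps a) w = f w" if "norm w < R" for w
    using sums[OF that] by (simp add: eval_fps_def sums_iff)
  have "f holomorphic_on ball 0 R \<longleftrightarrow> eval_fps (Abs_fps a) holomorphic_on ball 0 R"
    by (rule holomorphic_cong) (auto simp: ev)
  moreover have "eval_fps (Abs_fps a) holomorphic_on ball 0 R"
    by (rule holomorphic_on_eval_fps)
      (use conv in \<open>auto simp: eball_def intro: less_le_trans[of _ "ereal R"]\<close>)
  ultimately have hol: "f holomorphic_on ball 0 R" by simp
  have "f has_fps_expansion Abs_fps a"
    unfolding has_fps_expansion_def
  proof
    show "fps_conv_radius (Abs_fps a) > 0"
      using conv r by (metis ereal_less(2) less_le_trans order_less_trans)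
    have "eventually (\<lambda>w. w \<in> ball (0::complex) R) (nhds 0)"
      using r by (intro eventually_nhds_in_open) auto
    then show "\<forall>\<^sub>F z in nhds 0. eval_fps (Abs_fps a) z = f z"
      by eventually_elim (simp add: ev)
  qed
  then have "a n = (deriv ^^ n) f 0 / fact n"
    by (metis fps_nth_Abs_fps fps_nth_fps_expansion)
  moreover have "norm ((deriv ^^ n) f 0) \<le> fact n * B / r ^ n"
    by (rule Cauchy_inequality)
      (use r B in \<open>auto intro!: holomorphic_on_imp_continuous_on intro: holomorphic_on_subset[OF hol]\<close>)
  ultimately have "norm (a n) \<le> (fact n * B / r ^ n) / fact n"
    using divide_right_mono[of "norm ((deriv ^^ n) f 0)" "fact n * B / r ^ n" "fact n"]
    by (simp add: norm_divide)
  then show ?thesis by simp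
qed

lemma power_series_holomorphic_UNIV:
  fixes a :: "nat \<Rightarrow> complex"
  assumes sums: "\<And>w. (\<lambda>n. a n * w ^ n) sums f w"
  shows "f holomorphic_on UNIV"
proof -
  have conv: "fps_conv_radius (Abs_fps a) = \<infinity>"
    unfolding fps_conv_radius_def
    using sums by (intro conv_radius_inftyI'') (auto simp: sums_iff)
  have "eval_fps (Abs_fps a) = f"
    using sums by (auto simp: eval_fps_def sums_iff fun_eq_iff)
  with holomorphic_on_eval_fps[of UNIV "Abs_fps a"] conv show ?thesis by simp
qed

text \<open>The weight \<open>exp (r * \<bar>t\<bar>)\<close> dominates all partial sums of the
  exponential series, so sum and integral may be exchanged. This serves twice: with \<open>h\<close>
  it makes the transform entire, and with \<open>H\<close> times an exponential it identifies
  moments with Taylor coefficients.\<close>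

lemma laplace_power_series:
  fixes g :: "real \<Rightarrow> complex"
  assumes g: "g \<in> borel_measurable lborel"
    and int: "integrable lborel (\<lambda>t. norm (g t) * exp (r * \<bar>t\<bar>))"
    and w: "norm w \<le> r"
  shows "(\<lambda>n. (LBINT t. g t * of_real t ^ n) / fact n * w ^ n) sums (LBINT t. g t * exp (of_real t * w))"
    and "integrable lborel (\<lambda>t. g t * exp (of_real t * w))"
    and "0 < r \<Longrightarrow> integrable lborel (\<lambda>t. g t * of_real t ^ n)"
proof -
  note [measurable] = g
  have r: "0 \<le> r" using w norm_ge_zero order_trans by blast
  have pw: "r ^ n * \<bar>t\<bar> ^ n / fact n \<le> exp (r * \<bar>t\<bar>)" for n and t :: real
  proof -
    have s: "(\<lambda>n. (r * \<bar>t\<bar>) ^ n /\<^sub>R fact n) sums exp (r * \<bar>t\<bar>)" by (rule exp_converges)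
    have "sum (\<lambda>n. (r * \<bar>t\<bar>) ^ n /\<^sub>R fact n) {n} \<le> exp (r * \<bar>t\<bar>)"
      using s sum_le_suminf[of "\<lambda>n. (r * \<bar>t\<bar>) ^ n /\<^sub>R fact n" "{n}"] r by (auto simp: sums_iff)
    then show ?thesis by (simp add: power_mult_distrib divide_inverse mult_ac)
  qed
  define F where "F = (\<lambda>n t. g t * (of_real t * w) ^ n / fact n)"
  have Fm [measurable]: "F n \<in> borel_measurable lborel" for n
    unfolding F_def by measurable
  have nF: "norm (F n t) \<le> norm (g t) * (r ^ n * \<bar>t\<bar> ^ n / fact n)" for n t
    unfolding F_def using w
    by (auto simp: norm_mult norm_divide norm_power power_mult_distrib mult.commute[of "\<bar>t\<bar> ^ n"]
          intro!: mult_left_mono divide_right_mono power_mono mult_right_mono)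
  have intF: "integrable lborel (F n)" for n
  proof (rule Bochner_Integration.integrable_bound[OF int])
    show "AE x in lborel. norm (F n x) \<le> norm (norm (g x) * exp (r * \<bar>x\<bar>))"
      using nF pw by (intro AE_I2) (smt (verit, best) exp_ge_zero mult_left_mono mult_nonneg_nonneg norm_ge_zero real_norm_def)
  qed simp
  have sF: "(\<lambda>n. F n t) sums (g t * exp (of_real t * w))" for t
  proof -
    have "(\<lambda>n. g t * ((of_real t * w) ^ n /\<^sub>R fact n)) sums (g t * exp (of_real t * w))"
      by (intro sums_mult exp_converges)
    then show ?thesis by (simp add: F_def scaleR_conv_of_real divide_inverse mult_ac)
  qed
  have nFeq: "(\<lambda>n. norm (F n t)) sums (norm (g t) * exp (\<bar>t\<bar> * norm w))" for t
  proof -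
    have "(\<lambda>n. norm (g t) * ((\<bar>t\<bar> * norm w) ^ n /\<^sub>R fact n)) sums (norm (g t) * exp (\<bar>t\<bar> * norm w))"
      by (intro sums_mult exp_converges)
    then show ?thesis by (simp add: F_def norm_mult norm_divide norm_power norm_inverse divide_inverse mult_ac)
  qed
  have summ: "summable (\<lambda>n. LBINT t. norm (F n t))"
  proof (rule summableI_nonneg_bounded)
    fix n
    have "(\<Sum>i<n. LBINT t. norm (F i t)) = (LBINT t. (\<Sum>i<n. norm (F i t)))"
      by (intro Bochner_Integration.integral_sum[symmetric] integrable_norm intF)
    also have "\<dots> \<le> (LBINT t. norm (g t) * exp (r * \<bar>t\<bar>))"
    proof (rule integral_mono[OF _ int])
      show "integrable lborel (\<lambda>t. \<Sum>i<n. norm (F i t))"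
        by (intro Bochner_Integration.integrable_sum integrable_norm intF)
      fix t
      have "(\<Sum>i<n. norm (F i t)) \<le> norm (g t) * exp (\<bar>t\<bar> * norm w)"
        using nFeq[of t] by (metis sum_le_suminf sums_iff finite_lessThan norm_ge_zero)
      also have "\<dots> \<le> norm (g t) * exp (r * \<bar>t\<bar>)"
        using w by (intro mult_left_mono) (auto simp: mult.commute[of r] intro: mult_left_mono)
      finally show "(\<Sum>i<n. norm (F i t)) \<le> norm (g t) * exp (r * \<bar>t\<bar>)" .
    qed
    finally show "(\<Sum>i<n. LBINT t. norm (F i t)) \<le> (LBINT t. norm (g t) * exp (r * \<bar>t\<bar>))" .
  qed auto
  have ae: "AE t in lborel. summable (\<lambda>n. norm (F n t))"
    using nFeq by (auto simp: sums_iff)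
  have su: "(\<Sum>n. F n t) = g t * exp (of_real t * w)" for t
    using sF[of t] by (simp add: sums_iff)
  have "(\<lambda>n. integral\<^sup>L lborel (F n)) sums (LBINT t. g t * exp (of_real t * w))"
    using sums_integral[OF intF ae summ] by (simp add: su)
  moreover have "integral\<^sup>L lborel (F n) = (LBINT t. g t * of_real t ^ n) / fact n * w ^ n" for n
  proof -
    have "integral\<^sup>L lborel (F n) = (LBINT t. (g t * of_real t ^ n) * (w ^ n / fact n))"
      by (intro Bochner_Integration.integral_cong) (auto simp: F_def power_mult_distrib)
    also have "\<dots> = (LBINT t. g t * of_real t ^ n) * (w ^ n / fact n)"
      by simp
    finally show ?thesis by simp
  qed
  ultimately show "(\<lambda>n. (LBINT t. g t * of_real t ^ n) / fact n * w ^ n) sums (LBINT t. g t * exp (of_real t * w))"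
    by simp
  show "integrable lborel (\<lambda>t. g t * exp (of_real t * w))"
    using integrable_suminf[OF intF ae summ] by (simp add: su)
  show "integrable lborel (\<lambda>t. g t * of_real t ^ n)" if "0 < r"
  proof (rule Bochner_Integration.integrable_bound[OF integrable_mult_right[OF int, of "fact n / r ^ n"]])
    show "AE t in lborel. norm (g t * of_real t ^ n) \<le> norm (fact n / r ^ n * (norm (g t) * exp (r * \<bar>t\<bar>)))"
    proof (rule AE_I2)
      fix t :: real
      have "\<bar>t\<bar> ^ n \<le> fact n / r ^ n * exp (r * \<bar>t\<bar>)"
        using pw[of n t] that by (simp add: field_simps)
      then have "norm (g t) * \<bar>t\<bar> ^ n \<le> norm (g t) * (fact n / r ^ n * exp (r * \<bar>t\<bar>))"
        by (intro mult_left_mono) auto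
      then show "norm (g t * of_real t ^ n) \<le> norm (fact n / r ^ n * (norm (g t) * exp (r * \<bar>t\<bar>)))"
        using that by (simp add: norm_mult norm_power abs_mult mult_ac)
    qed
  qed simp
qed

section \<open>Functions on a strip\<close>

lemma integrable_exp_minus_abs:
  assumes that: "c > 0"
  shows "integrable lborel (\<lambda>x::real. exp (- c * \<bar>x\<bar>))"
proof -
  have "(\<lambda>x. exp (- c * x)) absolutely_integrable_on {0..}"
    using that by (intro nonnegative_absolutely_integrable_1 integrable_on_exp_minus_to_infinity) auto
  then have 1: "integrable lborel (\<lambda>x. indicator {0..} x * exp (- c * x))"
    by (simp add: set_integrable_def integrable_completion)
  from lborel_integrable_real_affine[OF this, of "-1" 0]
  have 2: "integrable lborel (\<lambda>x. indicator {0..} (- x) * exp (c * x))" by simp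
  show ?thesis
    by (rule Bochner_Integration.integrable_bound[OF Bochner_Integration.integrable_add[OF 1 2]])
      (auto simp: indicator_def)
qed

lemma integral_exp_halfline:
  assumes "Re z > 0"
  shows "(LBINT t. indicator {0..} t *\<^sub>R exp (- (z * of_real t))) = 1 / z"
    and "integrable lborel (\<lambda>t. indicator {0..} t *\<^sub>R exp (- (z * of_real t)))"
proof -
  let ?e = "\<lambda>x. exp (- (z * of_real x))"
  have z: "z \<noteq> 0" using assms by auto
  show int: "integrable lborel (\<lambda>t. indicator {0..} t *\<^sub>R exp (- (z * of_real t)))"
    by (rule Bochner_Integration.integrable_bound[OF integrable_exp_minus_abs[OF assms]])
      (auto simp: indicator_def)
  have "(\<lambda>n. LBINT x. indicator {0..real n} x *\<^sub>R ?e x)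
      \<longlonglongrightarrow> (LBINT t. indicator {0..} t *\<^sub>R exp (- (z * of_real t)))"
  proof (rule integral_dominated_convergence[where w = "\<lambda>t. exp (- Re z * \<bar>t\<bar>)"])
    show "AE x in lborel. (\<lambda>n. indicator {0..real n} x *\<^sub>R ?e x)
        \<longlonglongrightarrow> indicator {0..} x *\<^sub>R ?e x"
    proof (rule AE_I2)
      fix x :: real
      obtain k :: nat where k: "\<bar>x\<bar> \<le> real k" using real_arch_simple by blast
      have "eventually (\<lambda>n. indicator {0..real n} x *\<^sub>R ?e x = indicator {0..} x *\<^sub>R ?e x) sequentially"
        using eventually_ge_at_top[of k]
      proof eventually_elim
        case (elim n)
        then have "real k \<le> real n" by simp
        with k show ?case by (auto simp: indicator_def)
      qed
      then show "(\<lambda>n. indicator {0..real n} x *\<^sub>R ?e x)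
        \<longlonglongrightarrow> indicator {0..} x *\<^sub>R ?e x"
        by (rule tendsto_eventually)
    qed
  qed (use integrable_exp_minus_abs[OF assms] in \<open>auto simp: indicator_def\<close>)
  moreover have "(LBINT x. indicator {0..real n} x *\<^sub>R ?e x) = (1 - exp (- z * of_real n)) / z" for n
  proof -
    have "(LBINT x. indicator {0..real n} x *\<^sub>R ?e x) = - exp (- (z * of_real (real n))) / z - - exp (- (z * of_real 0)) / z"
    proof (rule integral_FTC_Icc)
      fix x :: real
      show "((\<lambda>x. - ?e x / z) has_vector_derivative ?e x) (at x within {0..real n})"
        using z by (auto intro!: derivative_eq_intros has_vector_derivative_real_field simp: field_simps)
    qed (auto intro!: continuous_intros)
    then show ?thesis using z by (simp add: field_simps)
  qed
  ultimately have "(\<lambda>n. (1 - exp (- z * of_real (real n))) / z) \<longlonglongrightarrow> (LBINT t. indicator {0..} t *\<^sub>R exp (- (z * of_real t)))"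
    by simp
  moreover have "(\<lambda>n. exp (- z * of_real (real n))) \<longlonglongrightarrow> 0"
  proof (rule tendsto_norm_zero_cancel)
    have "(\<lambda>n. exp (- Re z * real n)) \<longlonglongrightarrow> 0" using assms by real_asymp
    then show "(\<lambda>n. norm (exp (- z * of_real (real n)))) \<longlonglongrightarrow> 0" by simp
  qed
  then have "(\<lambda>n. (1 - exp (- z * of_real (real n))) / z) \<longlonglongrightarrow> (1 - 0) / z"
    by (intro tendsto_intros z)
  ultimately show "(LBINT t. indicator {0..} t *\<^sub>R exp (- (z * of_real t))) = 1 / z"
    using LIMSEQ_unique by fastforce
qed

section \<open>Cauchy's theorem and Cauchy's formula for horizontal lines\<close>

lemma integral_lborel_interval_limit:
  fixes g :: "real \<Rightarrow> complex"
  assumes int: "integrable lborel g" and cont: "continuous_on UNIV g"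
  shows "(\<lambda>n. integral {- real n..real n} g) \<longlonglongrightarrow> (LBINT x. g x)"
proof -
  have "(\<lambda>n. LBINT x. indicator {- real n..real n} x *\<^sub>R g x) \<longlonglongrightarrow> (LBINT x. g x)"
  proof (rule integral_dominated_convergence[where w = "\<lambda>x. norm (g x)"])
    show "AE x in lborel. (\<lambda>n. indicator {- real n..real n} x *\<^sub>R g x) \<longlonglongrightarrow> g x"
    proof (rule AE_I2)
      fix x :: real
      obtain k :: nat where k: "\<bar>x\<bar> \<le> real k" using real_arch_simple by blast
      have "eventually (\<lambda>n. indicator {- real n..real n} x *\<^sub>R g x = g x) sequentially"
        using eventually_ge_at_top[of k]
      proof eventually_elim
        case (elim n)
        then have "real k \<le> real n" by simp
        with k have "x \<in> {- real n..real n}" by auto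
        then show ?case by simp
      qed
      then show "(\<lambda>n. indicator {- real n..real n} x *\<^sub>R g x) \<longlonglongrightarrow> g x"
        by (rule tendsto_eventually)
    qed
  qed (use int in \<open>auto simp: indicator_def\<close>)
  moreover have "(LBINT x. indicator {- real n..real n} x *\<^sub>R g x) = integral {- real n..real n} g" for n
  proof -
    have "set_integrable lborel {- real n..real n} g"
      by (rule borel_integrable_atLeastAtMost') (use cont continuous_on_subset in blast)
    from set_borel_integral_eq_integral(2)[OF this] show ?thesis
      by (simp add: set_lebesgue_integral_def)
  qed
  ultimately show ?thesis by simp
qed

lemma contour_integral_horizontal:
  assumes "p < q"
  shows "contour_integral (linepath (Complex p b) (Complex q b)) f = integral {p..q} (\<lambda>x. f (Complex x b))"
proof -
  have "linepath (Complex p b) (Complex q b) x = linepath (of_real p) (of_real q) x + Complex 0 b" for x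
    by (simp add: linepath_def complex_eq_iff algebra_simps)
  then have "contour_integral (linepath (Complex p b) (Complex q b)) f =
      contour_integral (linepath (of_real p) (of_real q)) (\<lambda>w. f (w + Complex 0 b))"
    by (simp add: contour_integral_integral complex_diff complex_of_real_def)
  also have "\<dots> = integral {p..q} (\<lambda>x. f (of_real x + Complex 0 b))"
    using contour_integral_linepath_Reals_eq[of "of_real p" "of_real q"] assms by simp
  finally show ?thesis by (simp add: complex_of_real_def complex_add)
qed

text \<open>The vertical sides have fixed length and integrand of size \<open>exp (- R)\<close>, so
  only the horizontal lines survive. The point \<open>u\<close> is a possible singularity and
  \<open>v\<close> the common value on all large rectangles, which covers Cauchy's theorem and
  Cauchy's formula at once.\<close>

lemma rectangle_integral_limit:
  fixes \<phi> :: "complex \<Rightarrow> complex"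
  assumes b: "b1 < Im u" "Im u < b2"
    and cont: "continuous_on ({w. b1 \<le> Im w \<and> Im w \<le> b2} - {u}) \<phi>"
    and \<rho>: "\<bar>Re u\<bar> < \<rho>"
    and bound: "\<And>w. b1 \<le> Im w \<Longrightarrow> Im w \<le> b2 \<Longrightarrow> \<bar>Re w\<bar> \<ge> \<rho> \<Longrightarrow> norm (\<phi> w) \<le> C * exp (- \<bar>Re w\<bar>)"
    and int: "\<And>R. R \<ge> \<rho> \<Longrightarrow> (\<phi> has_contour_integral v) (rectpath (Complex (- R) b1) (Complex R b2))"
    and int1: "integrable lborel (\<lambda>x. \<phi> (Complex x b1))"
    and int2: "integrable lborel (\<lambda>x. \<phi> (Complex x b2))"
  shows "(LBINT x. \<phi> (Complex x b1)) - (LBINT x. \<phi> (Complex x b2)) = v"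
proof -
  define V where "V = (\<lambda>R. contour_integral (linepath (Complex R b1) (Complex R b2)) \<phi>)"
  define W where "W = (\<lambda>R. contour_integral (linepath (Complex (-R) b2) (Complex (-R) b1)) \<phi>)"
  have eq: "v = integral {-R..R} (\<lambda>x. \<phi> (Complex x b1)) + V R
                - integral {-R..R} (\<lambda>x. \<phi> (Complex x b2)) + W R" if R: "R \<ge> \<rho>" for R
  proof -
    have R': "0 < R" "\<bar>Re u\<bar> < R" using R \<rho> by auto
    have seg: "\<phi> contour_integrable_on linepath p q"
      if "closed_segment p q \<subseteq> {w. b1 \<le> Im w \<and> Im w \<le> b2} - {u}" for p q
      using contour_integrable_continuous_linepath continuous_on_subset[OF cont that] by blast
    have s1: "\<phi> contour_integrable_on linepath (Complex (-R) b1) (Complex R b1)"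
      by (rule seg) (use R' b in \<open>auto simp: closed_segment_same_Im closed_segment_eq_real_ivl\<close>)
    have s2: "\<phi> contour_integrable_on linepath (Complex R b1) (Complex R b2)"
      by (rule seg) (use R' b in \<open>auto simp: closed_segment_same_Re closed_segment_eq_real_ivl\<close>)
    have s3: "\<phi> contour_integrable_on linepath (Complex R b2) (Complex (-R) b2)"
      by (rule seg) (use R' b in \<open>auto simp: closed_segment_same_Im closed_segment_eq_real_ivl\<close>)
    have s4: "\<phi> contour_integrable_on linepath (Complex (-R) b2) (Complex (-R) b1)"
      by (rule seg) (use R' b in \<open>auto simp: closed_segment_same_Re closed_segment_eq_real_ivl\<close>)
    have "v = contour_integral (rectpath (Complex (- R) b1) (Complex R b2)) \<phi>"
      using contour_integral_unique[OF int[OF R]] by simp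
    also have "\<dots> = contour_integral (linepath (Complex (-R) b1) (Complex R b1)) \<phi> + V R +
        contour_integral (linepath (Complex R b2) (Complex (-R) b2)) \<phi> + W R"
      using s1 s2 s3 s4
      by (simp add: rectpath_def Let_def V_def W_def)
    also have "contour_integral (linepath (Complex (-R) b1) (Complex R b1)) \<phi> =
        integral {-R..R} (\<lambda>x. \<phi> (Complex x b1))"
      by (rule contour_integral_horizontal) (use R' in auto)
    also have "contour_integral (linepath (Complex R b2) (Complex (-R) b2)) \<phi> =
        - contour_integral (linepath (Complex (-R) b2) (Complex R b2)) \<phi>"
      by (metis contour_integral_reversepath reversepath_linepath valid_path_linepath)
    also have "contour_integral (linepath (Complex (-R) b2) (Complex R b2)) \<phi> =
        integral {-R..R} (\<lambda>x. \<phi> (Complex x b2))"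
      by (rule contour_integral_horizontal) (use R' in auto)
    finally show ?thesis by simp
  qed
  have C0: "0 \<le> C"
    using order_trans[OF norm_ge_zero bound[of "Complex \<rho> b1"]] b \<rho> by (auto simp: zero_le_mult_iff)
  have bd: "norm (V R) \<le> C * exp (-R) * (b2 - b1) \<and> norm (W R) \<le> C * exp (-R) * (b2 - b1)"
    if R: "R \<ge> \<rho>" for R
  proof -
    have R': "0 < R" "\<bar>Re u\<bar> < R" using R \<rho> by auto
    have "norm (V R) \<le> C * exp (-R) * norm (Complex R b2 - Complex R b1)"
      unfolding V_def
    proof (rule contour_integral_bound_linepath)
      show "\<phi> contour_integrable_on linepath (Complex R b1) (Complex R b2)"
        by (intro contour_integrable_continuous_linepath continuous_on_subset[OF cont])
          (use R' b in \<open>auto simp: closed_segment_same_Re closed_segment_eq_real_ivl\<close>)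
      show "norm (\<phi> x) \<le> C * exp (-R)" if "x \<in> closed_segment (Complex R b1) (Complex R b2)" for x
        using bound[of x] that R' R b by (auto simp: closed_segment_same_Re closed_segment_eq_real_ivl)
    qed (use C0 in auto)
    moreover have "norm (Complex R b2 - Complex R b1) = b2 - b1"
      using b by (simp add: cmod_def)
    moreover have "norm (W R) \<le> C * exp (-R) * norm (Complex (-R) b1 - Complex (-R) b2)"
      unfolding W_def
    proof (rule contour_integral_bound_linepath)
      show "\<phi> contour_integrable_on linepath (Complex (-R) b2) (Complex (-R) b1)"
        by (intro contour_integrable_continuous_linepath continuous_on_subset[OF cont])
          (use R' b in \<open>auto simp: closed_segment_same_Re closed_segment_eq_real_ivl\<close>)
      show "norm (\<phi> x) \<le> C * exp (-R)" if "x \<in> closed_segment (Complex (-R) b2) (Complex (-R) b1)" for x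
        using bound[of x] that R' R b by (auto simp: closed_segment_same_Re closed_segment_eq_real_ivl)
    qed (use C0 in auto)
    moreover have "norm (Complex (-R) b1 - Complex (-R) b2) = b2 - b1"
      using b by (simp add: cmod_def)
    ultimately show ?thesis by simp
  qed
  have evR: "eventually (\<lambda>n. real n \<ge> \<rho>) sequentially"
    by real_asymp
  have lim0: "(\<lambda>n. C * exp (- real n) * (b2 - b1)) \<longlonglongrightarrow> 0"
    by real_asymp
  have V0: "(\<lambda>n. V (real n)) \<longlonglongrightarrow> 0"
    using evR by (intro Lim_null_comparison[OF _ lim0]) (auto elim!: eventually_mono simp: bd)
  have W0: "(\<lambda>n. W (real n)) \<longlonglongrightarrow> 0"
    using evR by (intro Lim_null_comparison[OF _ lim0]) (auto elim!: eventually_mono simp: bd)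
  have c1: "continuous_on UNIV (\<lambda>x. \<phi> (Complex x b1))"
    by (rule continuous_on_compose2[OF cont])
      (use b in \<open>auto intro!: continuous_intros simp: Complex_eq\<close>)
  have c2: "continuous_on UNIV (\<lambda>x. \<phi> (Complex x b2))"
    by (rule continuous_on_compose2[OF cont])
      (use b in \<open>auto intro!: continuous_intros simp: Complex_eq\<close>)
  have "(\<lambda>n. integral {- real n..real n} (\<lambda>x. \<phi> (Complex x b1)) + V (real n)
                - integral {- real n..real n} (\<lambda>x. \<phi> (Complex x b2)) + W (real n)) \<longlonglongrightarrow>
      (LBINT x. \<phi> (Complex x b1)) + 0 - (LBINT x. \<phi> (Complex x b2)) + 0"
    by (intro tendsto_intros V0 W0 integral_lborel_interval_limit int1 int2 c1 c2)
  moreover have "eventually (\<lambda>n. integral {- real n..real n} (\<lambda>x. \<phi> (Complex x b1)) + V (real n)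
                - integral {- real n..real n} (\<lambda>x. \<phi> (Complex x b2)) + W (real n) = v) sequentially"
    using evR by eventually_elim (use eq in auto)
  then have "(\<lambda>n. integral {- real n..real n} (\<lambda>x. \<phi> (Complex x b1)) + V (real n)
                - integral {- real n..real n} (\<lambda>x. \<phi> (Complex x b2)) + W (real n)) \<longlonglongrightarrow> v"
    by (rule tendsto_eventually)
  ultimately show ?thesis using LIMSEQ_unique by fastforce
qed

lemma horizontal_line_integrable:
  fixes g :: "complex \<Rightarrow> complex"
  assumes "continuous_on {w. Im w = b} g" "c > 0" "\<And>w. Im w = b \<Longrightarrow> norm (g w) \<le> C * exp (- c * \<bar>Re w\<bar>)"
  shows "integrable lborel (\<lambda>x. g (Complex x b))"
proof -
  have "continuous_on UNIV (\<lambda>x. g (Complex x b))"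
    by (rule continuous_on_compose2[OF assms(1)]) (auto intro!: continuous_intros simp: Complex_eq)
  then have [measurable]: "(\<lambda>x. g (Complex x b)) \<in> borel_measurable lborel"
    by (simp add: borel_measurable_continuous_onI)
  show ?thesis
  proof (rule Bochner_Integration.integrable_bound[OF integrable_mult_right[OF integrable_exp_minus_abs[OF assms(2)], of C]])
    show "AE x in lborel. norm (g (Complex x b)) \<le> norm (C * exp (- c * \<bar>x\<bar>))"
      using assms(3)[of "Complex x b" for x] by (auto intro: order_trans abs_ge_self)
  qed simp
qed

lemma convex_strip: "convex {w. b1 \<le> Im w \<and> Im w \<le> b2}" "convex {w. b1 < Im w \<and> Im w < b2}"
proof -
  have "{w. b1 \<le> Im w \<and> Im w \<le> b2} = {w. Im w \<ge> b1} \<inter> {w. Im w \<le> b2}"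
    "{w. b1 < Im w \<and> Im w < b2} = {w. Im w > b1} \<inter> {w. Im w < b2}" by auto
  then show "convex {w. b1 \<le> Im w \<and> Im w \<le> b2}" "convex {w. b1 < Im w \<and> Im w < b2}"
    by (simp_all add: convex_Int convex_halfspace_Im_ge convex_halfspace_Im_le convex_halfspace_Im_gt convex_halfspace_Im_lt)
qed

lemma strip_integral_shift:
  fixes g :: "complex \<Rightarrow> complex"
  assumes hol: "g holomorphic_on {w. b1 \<le> Im w \<and> Im w \<le> b2}" and b: "b1 \<le> b2"
    and bound: "\<And>w. b1 \<le> Im w \<Longrightarrow> Im w \<le> b2 \<Longrightarrow> norm (g w) \<le> C * exp (- \<bar>Re w\<bar>)"
  shows "(LBINT x. g (Complex x b1)) = (LBINT x. g (Complex x b2))"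
proof (cases "b1 = b2")
  case False
  with b have b: "b1 < b2" by simp
  \<comment> \<open>A dummy point: \<open>g\<close> is regular throughout, but the limit lemma is
    stated with some interior point removed.\<close>
  define u where "u = Complex 0 ((b1 + b2) / 2)"
  have cont: "continuous_on {w. b1 \<le> Im w \<and> Im w \<le> b2} g"
    using hol holomorphic_on_imp_continuous_on by blast
  have "(LBINT x. g (Complex x b1)) - (LBINT x. g (Complex x b2)) = 0"
  proof (rule rectangle_integral_limit[where u = u and \<rho> = 1 and C = C])
    show "(g has_contour_integral 0) (rectpath (Complex (- R) b1) (Complex R b2))" if "R \<ge> 1" for R
    proof (rule Cauchy_theorem_convex_simple[OF hol convex_strip(1)])
      show "path_image (rectpath (Complex (- R) b1) (Complex R b2)) \<subseteq> {w. b1 \<le> Im w \<and> Im w \<le> b2}"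
        using b that by (auto simp: path_image_rectpath)
    qed auto
    show "integrable lborel (\<lambda>x. g (Complex x b1))" "integrable lborel (\<lambda>x. g (Complex x b2))"
      by (rule horizontal_line_integrable[where c = 1 and C = C]; use b bound in \<open>auto intro: continuous_on_subset[OF cont]\<close>)+
  qed (use b bound in \<open>auto simp: u_def intro: continuous_on_subset[OF cont]\<close>)
  then show ?thesis by simp
qed simp

lemma strip_Cauchy_formula:
  fixes g :: "complex \<Rightarrow> complex"
  assumes hol: "g holomorphic_on {w. b1 \<le> Im w \<and> Im w \<le> b2}" and u: "b1 < Im u" "Im u < b2"
    and bound: "\<And>w. b1 \<le> Im w \<Longrightarrow> Im w \<le> b2 \<Longrightarrow> norm (g w) \<le> C * exp (- \<bar>Re w\<bar>)"
  shows "(LBINT x. g (Complex x b1) / (Complex x b1 - u)) - (LBINT x. g (Complex x b2) / (Complex x b2 - u))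
           = 2 * pi * \<i> * g u"
proof -
  let ?S = "{w. b1 \<le> Im w \<and> Im w \<le> b2}"
  have cont: "continuous_on ?S g"
    using hol holomorphic_on_imp_continuous_on by blast
  have contq: "continuous_on (?S - {u}) (\<lambda>w. g w / (w - u))"
    by (intro continuous_intros continuous_on_subset[OF cont]) auto
  have lin: "integrable lborel (\<lambda>x. g (Complex x b) / (Complex x b - u))"
    if b: "b = b1 \<or> b = b2" for b
  proof (rule horizontal_line_integrable[where g = "\<lambda>w. g w / (w - u)" and c = 1 and C = "C / \<bar>b - Im u\<bar>"])
    show "continuous_on {w. Im w = b} (\<lambda>w. g w / (w - u))"
      by (rule continuous_on_subset[OF contq]) (use b u in auto)
    fix w assume w: "Im w = b"
    have d: "0 < \<bar>b - Im u\<bar>" using b u by auto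
    have "\<bar>b - Im u\<bar> \<le> norm (w - u)" using abs_Im_le_cmod[of "w - u"] w by simp
    then have "norm (g w) / norm (w - u) \<le> (C * exp (- \<bar>Re w\<bar>)) / \<bar>b - Im u\<bar>"
      using bound[of w] w b u d by (intro frac_le) (auto intro: order_trans[OF norm_ge_zero])
    then show "norm (g w / (w - u)) \<le> C / \<bar>b - Im u\<bar> * exp (- 1 * \<bar>Re w\<bar>)"
      by (simp add: norm_divide)
  qed auto
  show ?thesis
  proof (rule rectangle_integral_limit[where u = u and \<rho> = "\<bar>Re u\<bar> + 1" and C = C and \<phi> = "\<lambda>w. g w / (w - u)"])
    show "norm (g w / (w - u)) \<le> C * exp (- \<bar>Re w\<bar>)" if "b1 \<le> Im w" "Im w \<le> b2" "\<bar>Re u\<bar> + 1 \<le> \<bar>Re w\<bar>" for w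
    proof -
      have "1 \<le> norm (w - u)" using abs_Re_le_cmod[of "w - u"] that(3) by simp
      then have "norm (g w) / norm (w - u) \<le> norm (g w) / 1" by (intro frac_le) auto
      with bound[OF that(1,2)] show ?thesis by (simp add: norm_divide)
    qed
    fix R assume R: "\<bar>Re u\<bar> + 1 \<le> R"
    let ?r = "rectpath (Complex (- R) b1) (Complex R b2)"
    have ub: "u \<in> box (Complex (- R) b1) (Complex R b2)"
      using R u by (auto simp: in_box_complex_iff)
    have "((\<lambda>w. g w / (w - u)) has_contour_integral (2 * pi * \<i> * winding_number ?r u * g u)) ?r"
    proof (rule Cauchy_integral_formula_convex_simple[OF convex_strip(1) hol])
      have "{w. b1 < Im w \<and> Im w < b2} = {w. Im w > b1} \<inter> {w. Im w < b2}" by auto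
      then have "open {w. b1 < Im w \<and> Im w < b2}"
        by (simp add: open_Int open_halfspace_Im_gt open_halfspace_Im_lt)
      then show "u \<in> interior ?S"
        using u by (intro interiorI[of "{w. b1 < Im w \<and> Im w < b2}"]) auto
      show "path_image ?r \<subseteq> ?S - {u}"
        using R u by (auto simp: path_image_rectpath)
    qed auto
    then show "((\<lambda>w. g w / (w - u)) has_contour_integral (2 * pi * \<i> * g u)) ?r"
      using winding_number_rectpath[OF ub] by simp
  qed (use u contq lin in auto)
qed

text \<open>The lower bound \<open>c\<close> on \<open>Re (z x)\<close> makes the double integral
  absolutely convergent. With \<open>z x\<close> a multiple of \<open>x - u\<close> by a unit, the
  inner integral over \<open>t\<close> produces the Cauchy kernel.\<close>

lemma Fubini_exp_halfline:
  fixes g z :: "real \<Rightarrow> complex"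
  assumes g: "integrable lborel g" and [measurable]: "z \<in> borel_measurable lborel"
    and z: "\<And>x. Re (z x) \<ge> c" and c: "c > 0"
  shows "(LBINT t. indicator {0..} t *\<^sub>R (LBINT x. g x * exp (- (z x * of_real t))))
       = (LBINT x. g x / z x)"
proof -
  note [measurable] = borel_measurable_integrable[OF g]
  define f where "f = (\<lambda>(x, t). g x * (indicator {0..} t *\<^sub>R exp (- (z x * complex_of_real t))))"
  have fm [measurable]: "f \<in> borel_measurable (lborel \<Otimes>\<^sub>M lborel)"
    unfolding f_def by measurable
  define e where "e = (\<lambda>t. exp (- c * \<bar>t\<bar>))"
  have e: "integrable lborel e" unfolding e_def by (rule integrable_exp_minus_abs[OF c])
  have ind_le: "norm (f (x, t)) \<le> norm (g x) * e t" for x t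
    using z[of x] by (auto simp: f_def e_def norm_mult indicator_def intro!: mult_left_mono mult_right_mono)
  have in1: "integrable lborel (\<lambda>t. f (x, t))" for x
    by (rule Bochner_Integration.integrable_bound[OF integrable_mult_right[OF e, of "norm (g x)"]])
      (use ind_le in \<open>auto simp: e_def intro: order_trans\<close>)
  have "integrable (lborel \<Otimes>\<^sub>M lborel) f"
  proof (rule lborel_pair.Fubini_integrable)
    show "integrable lborel (\<lambda>x. LBINT t. norm (f (x, t)))"
    proof (rule Bochner_Integration.integrable_bound[OF integrable_mult_left[OF integrable_norm[OF g], of "integral\<^sup>L lborel e"]])
      show "AE x in lborel. norm (LBINT t. norm (f (x, t))) \<le> norm (norm (g x) * integral\<^sup>L lborel e)"
      proof (rule AE_I2)
        fix x
        have "(LBINT t. norm (f (x, t))) \<le> (LBINT t. norm (g x) * e t)"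
          by (intro integral_mono integrable_norm in1 integrable_mult_right e ind_le)
        also have "\<dots> = norm (g x) * integral\<^sup>L lborel e" by simp
        finally show "norm (LBINT t. norm (f (x, t))) \<le> norm (norm (g x) * integral\<^sup>L lborel e)"
          by (auto simp: integral_nonneg_AE)
      qed
    qed measurable
  qed (use in1 in auto)
  then have "integrable (lborel \<Otimes>\<^sub>M lborel) (\<lambda>(x, t). f (x, t))" by simp
  from lborel_pair.Fubini_integral[OF this]
  have "(LBINT t. (LBINT x. f (x, t))) = (LBINT x. (LBINT t. f (x, t)))" .
  moreover have "(LBINT x. f (x, t)) = indicator {0..} t *\<^sub>R (LBINT x. g x * exp (- (z x * of_real t)))" for t
    by (auto simp: f_def indicator_def)
  moreover have "(LBINT t. f (x, t)) = g x / z x" for x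
    using integral_exp_halfline[of "z x"] z[of x] c by (simp add: f_def del: mult_scaleR_right)
  ultimately show ?thesis by simp
qed

section \<open>The Laplace transform of a function on a strip and its inversion\<close>

locale strip_function =
  fixes h :: "complex \<Rightarrow> complex"
  assumes hol: "h holomorphic_on {u. \<bar>Im u\<bar> < pi / 2}"
    and decay: "0 \<le> \<beta> \<Longrightarrow> \<beta> < pi / 2 \<Longrightarrow>
        \<exists>C. \<forall>u. \<bar>Im u\<bar> \<le> \<beta> \<longrightarrow> norm (h u) \<le> C * exp (- (\<mu> * \<bar>Re u\<bar>))"
begin

text \<open>The two-sided Laplace transform. As \<open>\<mu>\<close> in \<open>decay\<close> is
  arbitrary, \<open>h\<close> decays faster than any exponential and the integral converges for
  every \<open>s\<close>. In the application this is the completed L-function, with the centre of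
  its functional equation moved to 0.\<close>

definition \<Lambda> :: "complex \<Rightarrow> complex" where
  "\<Lambda> s = (LBINT x. h (of_real x) * exp (of_real x * s))"

abbreviation H :: "real \<Rightarrow> complex" where "H t \<equiv> \<Lambda> (\<i> * of_real t)"

lemma line_measurable: "\<bar>b\<bar> < pi / 2 \<Longrightarrow> (\<lambda>x. h (Complex x b)) \<in> borel_measurable lborel"
proof -
  assume b: "\<bar>b\<bar> < pi / 2"
  have "continuous_on UNIV (\<lambda>x. h (Complex x b))"
    by (rule continuous_on_compose2[OF holomorphic_on_imp_continuous_on[OF hol]])
      (use b in \<open>auto intro!: continuous_intros simp: Complex_eq\<close>)
  then show ?thesis by (simp add: borel_measurable_continuous_onI)
qed

lemma line_integrable:
  assumes "\<bar>b\<bar> < pi / 2"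
  shows "integrable lborel (\<lambda>x. norm (h (Complex x b)) * exp (r * \<bar>x\<bar>))"
proof -
  obtain C where C: "\<And>u. \<bar>Im u\<bar> \<le> \<bar>b\<bar> \<Longrightarrow> norm (h u) \<le> C * exp (- ((r + 1) * \<bar>Re u\<bar>))"
    using decay[of "\<bar>b\<bar>" "r + 1"] assms by auto
  note [measurable] = line_measurable[OF assms]
  show ?thesis
  proof (rule Bochner_Integration.integrable_bound[OF integrable_mult_right[OF integrable_exp_minus_abs[of 1], of C]])
    show "AE x in lborel. norm (norm (h (Complex x b)) * exp (r * \<bar>x\<bar>)) \<le> norm (C * exp (- 1 * \<bar>x\<bar>))"
    proof (rule AE_I2)
      fix x
      have "norm (h (Complex x b)) * exp (r * \<bar>x\<bar>) \<le> C * exp (- ((r + 1) * \<bar>x\<bar>)) * exp (r * \<bar>x\<bar>)"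
        using C[of "Complex x b"] by (intro mult_right_mono) auto
      also have "\<dots> = C * exp (- \<bar>x\<bar>)"
        by (simp add: mult.assoc exp_add[symmetric] algebra_simps)
      finally show "norm (norm (h (Complex x b)) * exp (r * \<bar>x\<bar>)) \<le> norm (C * exp (- 1 * \<bar>x\<bar>))"
        by simp
    qed
  qed auto
qed

lemma real_line: "(\<lambda>x. h (of_real x)) \<in> borel_measurable lborel"
  "integrable lborel (\<lambda>x. norm (h (of_real x)) * exp (r * \<bar>x\<bar>))"
  using line_measurable[of 0] line_integrable[of 0 r] by (auto simp: complex_of_real_def)

lemma \<Lambda>_holomorphic: "\<Lambda> holomorphic_on UNIV"
  unfolding \<Lambda>_def
  by (rule power_series_holomorphic_UNIV, rule laplace_power_series(1)[OF real_line order_refl])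

lemma \<Lambda>_measurable: "(\<lambda>t. H t) \<in> borel_measurable lborel"
proof -
  have "continuous_on UNIV (\<lambda>t. H t)"
    by (rule continuous_on_compose2[OF holomorphic_on_imp_continuous_on[OF \<Lambda>_holomorphic]])
      (auto intro!: continuous_intros)
  then show ?thesis by (simp add: borel_measurable_continuous_onI)
qed

lemma shifted_decay:
  assumes "0 \<le> \<beta>" "\<beta> < pi / 2"
  obtains C where "\<And>w. \<bar>Im w\<bar> \<le> \<beta> \<Longrightarrow> norm (h w * exp (w * s)) \<le> C * exp (- \<bar>Re w\<bar>)"
proof -
  obtain C where C: "\<And>u. \<bar>Im u\<bar> \<le> \<beta> \<Longrightarrow> norm (h u) \<le> C * exp (- ((norm s + 1) * \<bar>Re u\<bar>))"
    using decay[OF assms, of "norm s + 1"] by auto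
  have "norm (h w * exp (w * s)) \<le> C * exp (norm s * \<beta>) * exp (- \<bar>Re w\<bar>)" if w: "\<bar>Im w\<bar> \<le> \<beta>" for w
  proof -
    have "0 \<le> C * exp (- ((norm s + 1) * \<bar>Re w\<bar>))"
      using C[OF w] norm_ge_zero order_trans by blast
    then have C0: "0 \<le> C" by (simp add: zero_le_mult_iff)
    have "Re (w * s) \<le> norm s * norm w" by (metis complex_Re_le_cmod mult.commute norm_mult)
    also have "\<dots> \<le> norm s * (\<bar>Re w\<bar> + \<beta>)"
      using w cmod_le[of w] by (intro mult_left_mono) auto
    finally have "norm (exp (w * s)) \<le> exp (norm s * (\<bar>Re w\<bar> + \<beta>))" by simp
    then have "norm (h w * exp (w * s)) \<le> (C * exp (- ((norm s + 1) * \<bar>Re w\<bar>))) * exp (norm s * (\<bar>Re w\<bar> + \<beta>))"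
      unfolding norm_mult using C[OF w] by (intro mult_mono) (auto intro: order_trans[OF norm_ge_zero])
    also have "\<dots> = C * exp (norm s * \<beta>) * exp (- \<bar>Re w\<bar>)"
      by (simp add: mult.assoc exp_add[symmetric] algebra_simps)
    finally show ?thesis .
  qed
  then show ?thesis using that by blast
qed

text \<open>The decay of \<open>h\<close> permits moving the line of integration. For
  \<open>s = \<i> * t\<close> the height \<open>b\<close> contributes a factor of modulus
  \<open>exp (- b * t)\<close>; this is where the exponential decay of \<open>H\<close> comes
  from.\<close>

lemma \<Lambda>_shift:
  assumes "\<bar>b\<bar> < pi / 2"
  shows "\<Lambda> s = (LBINT x. h (Complex x b) * exp (Complex x b * s))"
proof -
  define \<beta> where "\<beta> = \<bar>b\<bar>"
  have \<beta>: "0 \<le> \<beta>" "\<beta> < pi / 2" using assms by (auto simp: \<beta>_def)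
  define G where "G = (\<lambda>w. h w * exp (w * s))"
  obtain C where C: "\<And>w. \<bar>Im w\<bar> \<le> \<beta> \<Longrightarrow> norm (G w) \<le> C * exp (- \<bar>Re w\<bar>)"
    using shifted_decay[OF \<beta>, of s] unfolding G_def by auto
  have hG: "G holomorphic_on {w. b1 \<le> Im w \<and> Im w \<le> b2}" if "- \<beta> \<le> b1" "b2 \<le> \<beta>" for b1 b2
    unfolding G_def using that \<beta>
    by (intro holomorphic_intros holomorphic_on_subset[OF hol]) auto
  have "(LBINT x. G (Complex x 0)) = (LBINT x. G (Complex x b))"
  proof (cases "b \<ge> 0")
    case True
    then show ?thesis
      by (intro strip_integral_shift[where C = C] hG C) (auto simp: \<beta>_def)
  next
    case False
    then show ?thesis
      by (intro strip_integral_shift[symmetric, where C = C] hG C) (auto simp: \<beta>_def)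
  qed
  then show ?thesis by (simp add: \<Lambda>_def G_def complex_of_real_def)
qed

lemma \<Lambda>_decay:
  assumes "0 \<le> \<beta>" "\<beta> < pi / 2"
  shows "\<exists>C. \<forall>t. norm (H t) \<le> C * exp (- (\<beta> * \<bar>t\<bar>))"
proof -
  define D where "D = (\<lambda>b. LBINT x. norm (h (Complex x b)))"
  have bd: "norm (H t) \<le> D b * exp (- (b * t))" if b: "\<bar>b\<bar> < pi / 2" for b t
  proof -
    have "norm (H t) \<le> (LBINT x. norm (h (Complex x b) * exp (Complex x b * (\<i> * of_real t))))"
      unfolding \<Lambda>_shift[OF b] by (rule integral_norm_bound)
    also have "\<dots> = (LBINT x. norm (h (Complex x b)) * exp (- (b * t)))"
      by (intro Bochner_Integration.integral_cong) (auto simp: norm_mult)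
    also have "\<dots> = D b * exp (- (b * t))" by (simp add: D_def)
    finally show ?thesis .
  qed
  have D0: "0 \<le> D b" for b unfolding D_def by (simp add: integral_nonneg_AE)
  have "norm (H t) \<le> (D \<beta> + D (- \<beta>)) * exp (- (\<beta> * \<bar>t\<bar>))" for t
  proof (cases "t \<ge> 0")
    case True
    then have "norm (H t) \<le> D \<beta> * exp (- (\<beta> * \<bar>t\<bar>))" using bd[of \<beta> t] assms by simp
    also have "\<dots> \<le> (D \<beta> + D (- \<beta>)) * exp (- (\<beta> * \<bar>t\<bar>))" using D0 by (intro mult_right_mono) auto
    finally show ?thesis .
  next
    case False
    then have "norm (H t) \<le> D (-\<beta>) * exp (- (\<beta> * \<bar>t\<bar>))" using bd[of "-\<beta>" t] assms by simp
    also have "\<dots> \<le> (D \<beta> + D (- \<beta>)) * exp (- (\<beta> * \<bar>t\<bar>))" using D0 by (intro mult_right_mono) auto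
    finally show ?thesis .
  qed
  then show ?thesis by blast
qed

lemma \<Lambda>_exp_integrable:
  assumes "\<bar>\<theta>\<bar> + r < pi / 2" "0 \<le> r"
  shows "integrable lborel (\<lambda>t. norm (H t * exp (of_real t * of_real \<theta>)) * exp (r * \<bar>t\<bar>))"
proof -
  define \<beta> where "\<beta> = (\<bar>\<theta>\<bar> + r + pi / 2) / 2"
  have \<beta>: "0 \<le> \<beta>" "\<beta> < pi / 2" "\<bar>\<theta>\<bar> + r < \<beta>" using assms by (auto simp: \<beta>_def)
  obtain C where C: "\<And>t. norm (H t) \<le> C * exp (- (\<beta> * \<bar>t\<bar>))"
    using \<Lambda>_decay[OF \<beta>(1,2)] by blast
  have C0: "0 \<le> C" using order_trans[OF norm_ge_zero C[of 0]] by simp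
  note [measurable] = \<Lambda>_measurable
  have pos: "\<beta> - \<bar>\<theta>\<bar> - r > 0" using \<beta> by simp
  show ?thesis
  proof (rule Bochner_Integration.integrable_bound[OF integrable_mult_right[OF integrable_exp_minus_abs[OF pos], of C]])
    show "AE t in lborel. norm (norm (H t * exp (of_real t * of_real \<theta>)) * exp (r * \<bar>t\<bar>))
        \<le> norm (C * exp (- (\<beta> - \<bar>\<theta>\<bar> - r) * \<bar>t\<bar>))"
    proof (rule AE_I2)
      fix t :: real
      have "t * \<theta> \<le> \<bar>\<theta>\<bar> * \<bar>t\<bar>" by (metis abs_ge_self abs_mult mult.commute)
      then have "norm (H t) * (exp (t * \<theta>) * exp (r * \<bar>t\<bar>)) \<le>
          (C * exp (- (\<beta> * \<bar>t\<bar>))) * (exp (\<bar>\<theta>\<bar> * \<bar>t\<bar>) * exp (r * \<bar>t\<bar>))"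
        using C[of t] C0 by (intro mult_mono) auto
      also have "\<dots> = C * exp (- (\<beta> - \<bar>\<theta>\<bar> - r) * \<bar>t\<bar>)"
        by (simp add: exp_add[symmetric] algebra_simps)
      finally show "norm (norm (H t * exp (of_real t * of_real \<theta>)) * exp (r * \<bar>t\<bar>))
        \<le> norm (C * exp (- (\<beta> - \<bar>\<theta>\<bar> - r) * \<bar>t\<bar>))"
        using C0 by (simp add: norm_mult mult_ac)
    qed
  qed measurable
qed

text \<open>Each half-line of the \<open>t\<close>-integral is treated with the transform written on
  its own line, at height \<open>\<beta>\<close> or \<open>- \<beta>\<close>. Integrating over
  \<open>t\<close> first leaves two Cauchy integrals whose difference is evaluated by Cauchy's
  formula at \<open>\<i> * w\<close>. No Fourier inversion theorem enters.\<close>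

lemma \<Lambda>_inversion:
  assumes "\<bar>Re w\<bar> < pi / 2"
  shows "(LBINT t. H t * exp (of_real t * w)) = 2 * pi * h (\<i> * w)"
proof -
  define \<beta> where "\<beta> = (\<bar>Re w\<bar> + pi / 2) / 2"
  have \<beta>: "0 \<le> \<beta>" "\<beta> < pi / 2" "\<bar>Re w\<bar> < \<beta>" using assms by (auto simp: \<beta>_def)
  obtain C where C: "\<And>w. \<bar>Im w\<bar> \<le> \<beta> \<Longrightarrow> norm (h w) \<le> C * exp (- \<bar>Re w\<bar>)"
    using decay[OF \<beta>(1,2), of 1] by auto
  define u where "u = \<i> * w"
  define \<Phi> where "\<Phi> = (\<lambda>t. H t * exp (of_real t * w))"
  have int: "integrable lborel \<Phi>"
  proof -
    have "integrable lborel (\<lambda>t. norm (H t * exp (of_real t * of_real (Re w))))"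
      using \<Lambda>_exp_integrable[of "Re w" 0] assms by simp
    then show ?thesis unfolding \<Phi>_def
      by (rule Bochner_Integration.integrable_bound)
        (use \<Lambda>_measurable in \<open>auto simp: norm_mult\<close>)
  qed
  have li: "integrable lborel (\<lambda>x. h (Complex x b))" if "\<bar>b\<bar> < pi / 2" for b
    using line_integrable[OF that, of 0] line_measurable[OF that] by (simp add: integrable_norm_iff)
  \<comment> \<open>At height \<open>\<beta>\<close> the exponent has real part
    \<open>- (\<beta> - Re w) * t\<close>, so the integral over \<open>t \<ge> 0\<close> converges
    absolutely. For negative \<open>t\<close> the height \<open>- \<beta>\<close> plays the same
    role, with rate \<open>\<beta> + Re w\<close>.\<close>
  have up: "(LBINT t. indicator {0..} t *\<^sub>R \<Phi> t) = (LBINT x. h (Complex x \<beta>) / (- \<i> * (Complex x \<beta> - u)))"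
  proof -
    have "\<Phi> t = (LBINT x. h (Complex x \<beta>) * exp (- (- \<i> * (Complex x \<beta> - u) * of_real t)))" for t
      unfolding \<Phi>_def u_def using \<beta>
      by (subst \<Lambda>_shift[of \<beta>], simp, subst integral_mult_left_zero[symmetric])
        (intro Bochner_Integration.integral_cong refl, simp add: mult.assoc exp_add[symmetric] algebra_simps)
    then show ?thesis
      by (simp only:, intro Fubini_exp_halfline[where c = "\<beta> - Re w"] li)
        (use \<beta> in \<open>auto simp: u_def Complex_eq\<close>)
  qed
  have down: "(LBINT t. indicator {0..} t *\<^sub>R \<Phi> (- t)) = (LBINT x. h (Complex x (- \<beta>)) / (\<i> * (Complex x (- \<beta>) - u)))"
  proof -
    have "\<Phi> (- t) = (LBINT x. h (Complex x (- \<beta>)) * exp (- (\<i> * (Complex x (- \<beta>) - u) * of_real t)))" for t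
      unfolding \<Phi>_def u_def using \<beta>
      by (subst \<Lambda>_shift[of "- \<beta>"], simp, subst integral_mult_left_zero[symmetric])
        (intro Bochner_Integration.integral_cong refl, simp add: mult.assoc exp_add[symmetric] algebra_simps)
    then show ?thesis
      by (simp only:, intro Fubini_exp_halfline[where c = "\<beta> + Re w"] li)
        (use \<beta> in \<open>auto simp: u_def Complex_eq\<close>)
  qed
  \<comment> \<open>The two half-lines overlap in the point 0, which is a null set.\<close>
  have "(LBINT t. \<Phi> t) = (LBINT t. indicator {0..} t *\<^sub>R \<Phi> t + indicator {..0} t *\<^sub>R \<Phi> t)"
    by (rule integral_cong_AE)
      (use int AE_lborel_singleton[of 0] in \<open>auto elim!: eventually_mono simp: indicator_def\<close>)
  also have "\<dots> = (LBINT t. indicator {0..} t *\<^sub>R \<Phi> t) + (LBINT t. indicator {..0} t *\<^sub>R \<Phi> t)"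
    by (intro Bochner_Integration.integral_add integrable_mult_indicator int) auto
  finally have split: "(LBINT t. \<Phi> t) = \<dots>" .
  have neg: "(LBINT t. indicator {..0} t *\<^sub>R \<Phi> t) = (LBINT t. indicator {0..} t *\<^sub>R \<Phi> (- t))"
    by (subst lborel_integral_real_affine[of "-1" _ 0]) (auto simp: indicator_def)
  define U D where "U = (LBINT x. h (Complex x \<beta>) / (Complex x \<beta> - u))"
    and "D = (LBINT x. h (Complex x (- \<beta>)) / (Complex x (- \<beta>) - u))"
  have "h (Complex x \<beta>) / (- \<i> * (Complex x \<beta> - u)) = \<i> * (h (Complex x \<beta>) / (Complex x \<beta> - u))"
    "h (Complex x (- \<beta>)) / (\<i> * (Complex x (- \<beta>) - u)) = - \<i> * (h (Complex x (- \<beta>)) / (Complex x (- \<beta>) - u))" for x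
    by (simp_all add: divide_divide_eq_left[symmetric])
  then have "(LBINT t. \<Phi> t) = \<i> * U - \<i> * D"
    unfolding split neg up down U_def D_def by (simp only: integral_mult_right_zero) simp
  moreover have "D - U = 2 * pi * \<i> * h u"
    unfolding D_def U_def
  proof (rule strip_Cauchy_formula[where C = C])
    show "h holomorphic_on {w. - \<beta> \<le> Im w \<and> Im w \<le> \<beta>}"
      by (rule holomorphic_on_subset[OF hol]) (use \<beta> in auto)
    show "- \<beta> < Im u" "Im u < \<beta>" using \<beta>(3) by (auto simp: u_def)
    show "norm (h w) \<le> C * exp (- \<bar>Re w\<bar>)" if "- \<beta> \<le> Im w" "Im w \<le> \<beta>" for w
      using C[of w] that by simp
  qed
  ultimately have "(LBINT t. \<Phi> t) = - \<i> * (2 * pi * \<i> * h u)"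
    by (metis minus_diff_eq mult_minus_left mult_minus_right right_diff_distrib)
  also have "- \<i> * (2 * pi * \<i> * h u) = 2 * pi * h u" by simp
  finally show ?thesis unfolding \<Phi>_def u_def .
qed

lemma \<Lambda>_moment_integrable:
  assumes "\<bar>\<theta>\<bar> < pi / 2"
  shows "integrable lborel (\<lambda>t. H t * exp (of_real t * of_real \<theta>) * of_real t ^ n)"
proof (rule laplace_power_series(3)[where w = 0])
  show "integrable lborel (\<lambda>t. norm (H t * exp (of_real t * of_real \<theta>)) * exp ((pi / 2 - \<bar>\<theta>\<bar>) / 2 * \<bar>t\<bar>))"
    using assms by (intro \<Lambda>_exp_integrable) (auto simp: field_simps)
qed (use assms \<Lambda>_measurable in auto)

text \<open>By inversion the moments divided by \<open>fact n\<close> are the Taylor coefficients at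
  \<open>\<theta>\<close> of \<open>2 * pi * h (\<i> * w)\<close>, so Cauchy's estimate on the
  circle of radius \<open>\<rho>\<close> applies. Smallness of \<open>h\<close> near the cusp is
  thereby turned into smallness of all moments.\<close>

lemma \<Lambda>_moment_bound:
  assumes "\<bar>\<theta>\<bar> + \<rho> < pi / 2" "0 < \<rho>" and B: "\<And>w. norm (w - of_real \<theta>) = \<rho> \<Longrightarrow> norm (h (\<i> * w)) \<le> B"
  shows "norm (LBINT t. H t * exp (of_real t * of_real \<theta>) * of_real t ^ n)
           \<le> fact n * (2 * pi * B) / \<rho> ^ n"
proof -
  \<comment> \<open>The midpoint between \<open>\<rho>\<close> and
    \<open>pi / 2 - \<bar>\<theta>\<bar>\<close>, so that the power series converges on a slightly
    larger disc than the one needed.\<close>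
  define r where "r = (pi / 2 - \<bar>\<theta>\<bar> + \<rho>) / 2"
  have r: "\<rho> < r" "\<bar>\<theta>\<bar> + r < pi / 2"
    using assms(1) by (simp_all add: r_def add_divide_distrib diff_divide_distrib)
  let ?m = "\<lambda>n. LBINT t. H t * exp (of_real t * of_real \<theta>) * of_real t ^ n"
  let ?f = "\<lambda>w. 2 * pi * h (\<i> * (w + of_real \<theta>))"
  have "norm (?m n / fact n) \<le> 2 * pi * B / \<rho> ^ n"
  proof (rule power_series_Cauchy_bound[where R = r and f = ?f])
    fix w :: complex assume w: "norm w < r"
    have "(\<lambda>n. ?m n / fact n * w ^ n) sums
        (LBINT t. H t * exp (of_real t * of_real \<theta>) * exp (of_real t * w))"
      by (rule laplace_power_series(1)[OF _ \<Lambda>_exp_integrable[of \<theta> r]])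
        (use r assms w \<Lambda>_measurable in auto)
    moreover have "(LBINT t. H t * exp (of_real t * of_real \<theta>) * exp (of_real t * w))
       = (LBINT t. H t * exp (of_real t * (w + of_real \<theta>)))"
      by (intro Bochner_Integration.integral_cong) (auto simp: algebra_simps exp_add)
    moreover have "\<dots> = ?f w"
    proof (rule \<Lambda>_inversion)
      have "\<bar>Re w + \<theta>\<bar> \<le> norm w + \<bar>\<theta>\<bar>"
        using abs_Re_le_cmod[of w] abs_triangle_ineq[of "Re w" \<theta>] by linarith
      then show "\<bar>Re (w + of_real \<theta>)\<bar> < pi / 2"
        using w r by simp
    qed
    ultimately show "(\<lambda>n. ?m n / fact n * w ^ n) sums ?f w" by simp
  qed (use assms r B in \<open>auto simp: norm_mult\<close>)
  then show ?thesis by (simp add: norm_divide field_simps)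
qed

end

section \<open>Products over sparse zeros\<close>

text \<open>Euler's sine product at \<open>\<i> * y\<close> shows that the increasing partial
  products tend to \<open>sinh (pi * y) / (pi * y)\<close>.\<close>

lemma prod_one_plus_square_le_exp:
  fixes y :: real
  assumes "y \<ge> 0"
  shows "(\<Prod>j=1..n. 1 + y\<^sup>2 / (real j)\<^sup>2) \<le> exp (pi * y)"
proof (cases "y = 0")
  case False
  with assms have y: "y > 0" by simp
  define P where "P = (\<lambda>n. \<Prod>j=1..n. 1 + y\<^sup>2 / (real j)\<^sup>2)"
  have "(\<lambda>n. of_real pi * (\<i> * of_real y) * (\<Prod>k=1..n. 1 - (\<i> * of_real y)\<^sup>2 / of_nat k ^ 2)) \<longlonglongrightarrow> sin (of_real pi * (\<i> * of_real y))"
    by (rule sin_product_formula_complex)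
  moreover have "of_real pi * (\<i> * of_real y) * (\<Prod>k=1..n. 1 - (\<i> * of_real y)\<^sup>2 / of_nat k ^ 2) = \<i> * of_real (pi * y * P n)" for n
    by (simp add: P_def power_mult_distrib)
  moreover have "sin (of_real pi * (\<i> * of_real y)) = \<i> * of_real (sinh (pi * y))"
  proof -
    have "sin (of_real pi * (\<i> * of_real y)) = (exp (- of_real (pi * y)) - exp (of_real (pi * y))) / (2 * \<i>)"
    proof -
      have "\<i> * (of_real pi * (\<i> * of_real y)) = - of_real (pi * y)"
        by (simp add: complex_eq_iff)
      then show ?thesis unfolding sin_exp_eq by simp
    qed
    also have "\<dots> = \<i> * of_real (sinh (pi * y))"
      by (simp add: sinh_def complex_eq_iff Re_exp Im_exp) (simp add: field_simps)
    finally show ?thesis .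
  qed
  ultimately have "(\<lambda>n. \<i> * of_real (pi * y * P n)) \<longlonglongrightarrow> \<i> * of_real (sinh (pi * y))"
    by (simp only:)
  from tendsto_Im[OF this] have lim: "(\<lambda>n. pi * y * P n) \<longlonglongrightarrow> sinh (pi * y)" by simp
  have "incseq (\<lambda>n. pi * y * P n)"
  proof (rule incseq_SucI)
    fix n
    have "0 \<le> P n" unfolding P_def by (intro prod_nonneg) auto
    then have "P n * 1 \<le> P n * (1 + y\<^sup>2 / (real (Suc n))\<^sup>2)" by (intro mult_left_mono) auto
    then have "P n \<le> P (Suc n)" by (simp add: P_def)
    then show "pi * y * P n \<le> pi * y * P (Suc n)" using y by (intro mult_left_mono) auto
  qed
  from incseq_le[OF this lim] have "pi * y * P n \<le> sinh (pi * y)" .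
  \<comment> \<open>Since \<open>1 - 2 x \<le> exp (- 2 x)\<close>, one has
    \<open>sinh x \<le> x * exp x\<close>; the extra \<open>x\<close> cancels the factor in front of
    the product.\<close>
  also have "\<dots> \<le> pi * y * exp (pi * y)"
  proof -
    have "1 - 2 * (pi * y) \<le> exp (- 2 * (pi * y))" using exp_ge_add_one_self[of "- 2 * (pi * y)"] by simp
    then have "exp (pi * y) * (1 - exp (- 2 * (pi * y))) \<le> exp (pi * y) * (2 * (pi * y))"
      by (intro mult_left_mono) auto
    then have "exp (pi * y) - exp (- (pi * y)) \<le> 2 * (pi * y * exp (pi * y))"
      by (simp add: right_diff_distrib exp_add[symmetric] algebra_simps)
    then show ?thesis by (simp add: sinh_def)
  qed
  finally show ?thesis using y by (simp add: P_def)
qed simp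

text \<open>Numbers the zeros in increasing order, so that products over zeros can be compared with
  products over \<open>1, ..., n\<close>.\<close>

lemma bij_betw_rank:
  fixes Z :: "'a :: linorder set"
  assumes "finite Z"
  shows "bij_betw (\<lambda>x. card {y \<in> Z. y \<le> x}) Z {1..card Z}"
proof -
  let ?r = "\<lambda>x. card {y \<in> Z. y \<le> x}"
  have lt: "?r x < ?r x'" if "x \<in> Z" "x' \<in> Z" "x < x'" for x x'
  proof (rule psubset_card_mono)
    have "x' \<notin> {y \<in> Z. y \<le> x}" "x' \<in> {y \<in> Z. y \<le> x'}" using that by auto
    moreover have "{y \<in> Z. y \<le> x} \<subseteq> {y \<in> Z. y \<le> x'}" using that by auto
    ultimately show "{y \<in> Z. y \<le> x} \<subset> {y \<in> Z. y \<le> x'}" by blast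
  qed (use assms in auto)
  have inj: "inj_on ?r Z"
  proof (rule inj_onI)
    fix x x' assume "x \<in> Z" "x' \<in> Z" "?r x = ?r x'"
    then show "x = x'" using lt[of x x'] lt[of x' x] by (cases x x' rule: linorder_cases) auto
  qed
  have "?r ` Z \<subseteq> {1..card Z}"
    using assms by (auto simp: Suc_le_eq card_gt_0_iff intro: card_mono)
  moreover have "card (?r ` Z) = card {1..card Z}" using inj by (simp add: card_image)
  ultimately have "?r ` Z = {1..card Z}" by (intro card_subset_eq) auto
  with inj show ?thesis by (simp add: bij_betw_def)
qed

text \<open>A zero of rank \<open>r\<close> beyond \<open>T\<close> has
  \<open>1 / \<tau>^2 \<le> \<epsilon>^4 / r^4\<close>, so its factor is at most the square of the
  \<open>r\<close>-th factor of Euler's product at \<open>\<epsilon> * y\<close>; squaring produces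
  the 2 in the exponent. Zeros below \<open>T\<close>, where the rank is not controlled, only cost a
  factor independent of \<open>y\<close>. In the application \<open>y^4 = t^2\<close>.\<close>

lemma prod_zeros_le:
  fixes Z :: "real set" and y \<epsilon> T :: real
  assumes Z: "finite Z" "Z \<subseteq> {0<..}" and \<epsilon>: "\<epsilon> > 0" and y: "y \<ge> 0"
    and rank: "\<And>\<tau>. \<tau> \<in> Z \<Longrightarrow> T \<le> \<tau> \<Longrightarrow> real (card {\<tau>' \<in> Z. \<tau>' \<le> \<tau>}) \<le> \<epsilon> * sqrt \<tau>"
  shows "(\<Prod>\<tau>\<in>Z. 1 + y ^ 4 / \<tau>\<^sup>2) \<le>
    (\<Prod>\<tau>\<in>{\<tau> \<in> Z. \<tau> < T}. 1 + real (card {\<tau> \<in> Z. \<tau> < T}) ^ 4 / (\<epsilon> ^ 4 * \<tau>\<^sup>2)) * exp (2 * pi * (\<epsilon> * y))"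
proof -
  define r where "r = (\<lambda>x. card {y \<in> Z. y \<le> x})"
  define J where "J = real (card {\<tau> \<in> Z. \<tau> < T})"
  \<comment> \<open>The price of a zero below \<open>T\<close>. Its rank is at most
    \<open>J\<close>, so \<open>J ^ 4 / (\<epsilon> ^ 4 * \<tau>\<^sup>2)\<close> is what the Euler
    factor has to be inflated by.\<close>
  define c where "c = (\<lambda>\<tau>. if \<tau> < T then 1 + J ^ 4 / (\<epsilon> ^ 4 * \<tau>\<^sup>2) else 1)"
  have r1: "real (r \<tau>) \<ge> 1" if "\<tau> \<in> Z" for \<tau>
    using bij_betw_apply[OF bij_betw_rank[OF Z(1)] that] by (simp add: r_def)
  have c1: "c \<tau> \<ge> 1" for \<tau> using \<epsilon> by (simp add: c_def J_def)
  have "(\<Prod>\<tau>\<in>Z. 1 + y ^ 4 / \<tau>\<^sup>2) \<le> (\<Prod>\<tau>\<in>Z. c \<tau> * (1 + (\<epsilon> * y)\<^sup>2 / (real (r \<tau>))\<^sup>2)\<^sup>2)"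
  proof (rule prod_mono, rule conjI)
    fix \<tau> assume \<tau>: "\<tau> \<in> Z"
    then have \<tau>0: "\<tau> > 0" using Z by auto
    show "0 \<le> 1 + y ^ 4 / \<tau>\<^sup>2" by simp
    define s where "s = (\<epsilon> * y) ^ 4 / real (r \<tau>) ^ 4"
    have s0: "s \<ge> 0" by (simp add: s_def)
    have sq: "1 + s \<le> (1 + (\<epsilon> * y)\<^sup>2 / (real (r \<tau>))\<^sup>2)\<^sup>2"
    proof -
      have "s = ((\<epsilon> * y)\<^sup>2 / (real (r \<tau>))\<^sup>2)\<^sup>2" by (simp add: s_def power_divide flip: power_mult)
      then show ?thesis by (simp add: power2_sum)
    qed
    have "1 + y ^ 4 / \<tau>\<^sup>2 \<le> c \<tau> * (1 + s)"
    proof (cases "\<tau> < T")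
      case True
      have "r \<tau> \<le> card {\<tau> \<in> Z. \<tau> < T}" unfolding r_def using Z True by (intro card_mono) auto
      then have "real (r \<tau>) ^ 4 \<le> J ^ 4" unfolding J_def by (intro power_mono) auto
      then have "1 \<le> J ^ 4 / real (r \<tau>) ^ 4" using r1[OF \<tau>] by (simp add: divide_simps)
      then have "y ^ 4 / \<tau>\<^sup>2 * 1 \<le> y ^ 4 / \<tau>\<^sup>2 * (J ^ 4 / real (r \<tau>) ^ 4)" by (intro mult_left_mono) auto
      also have "\<dots> = J ^ 4 / (\<epsilon> ^ 4 * \<tau>\<^sup>2) * s"
        using \<epsilon> \<tau>0 by (simp add: s_def power_mult_distrib field_simps)
      also have "\<dots> \<le> c \<tau> * (1 + s) - 1"
      proof -
        define a where "a = J ^ 4 / (\<epsilon> ^ 4 * \<tau>\<^sup>2)"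
        have "a \<ge> 0" using \<epsilon> by (simp add: a_def J_def)
        moreover have "c \<tau> = 1 + a" using True by (simp add: c_def a_def)
        ultimately show ?thesis using s0 unfolding a_def[symmetric] by (simp add: algebra_simps)
      qed
      finally show ?thesis by simp
    next
      case False
      then have "real (r \<tau>) \<le> \<epsilon> * sqrt \<tau>" using rank[OF \<tau>] by (simp add: r_def)
      then have "real (r \<tau>) ^ 4 \<le> (\<epsilon> * sqrt \<tau>) ^ 4" by (intro power_mono) auto
      also have "\<dots> = \<epsilon> ^ 4 * ((sqrt \<tau>)\<^sup>2)\<^sup>2" by (simp add: power_mult_distrib flip: power_mult)
      also have "\<dots> = \<epsilon> ^ 4 * \<tau>\<^sup>2" using \<tau>0 by simp
      finally have "real (r \<tau>) ^ 4 \<le> \<epsilon> ^ 4 * \<tau>\<^sup>2" .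
      then have "1 / \<tau>\<^sup>2 \<le> \<epsilon> ^ 4 / real (r \<tau>) ^ 4" using r1[OF \<tau>] \<tau>0 by (simp add: field_simps)
      then have "y ^ 4 * (1 / \<tau>\<^sup>2) \<le> y ^ 4 * (\<epsilon> ^ 4 / real (r \<tau>) ^ 4)" by (intro mult_left_mono) auto
      then show ?thesis using False by (simp add: c_def s_def power_mult_distrib mult.commute)
    qed
    also have "\<dots> \<le> c \<tau> * (1 + (\<epsilon> * y)\<^sup>2 / (real (r \<tau>))\<^sup>2)\<^sup>2"
      using sq c1[of \<tau>] by (intro mult_left_mono) auto
    finally show "1 + y ^ 4 / \<tau>\<^sup>2 \<le> c \<tau> * (1 + (\<epsilon> * y)\<^sup>2 / (real (r \<tau>))\<^sup>2)\<^sup>2" .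
  qed
  also have "\<dots> = (\<Prod>\<tau>\<in>Z. c \<tau>) * (\<Prod>\<tau>\<in>Z. 1 + (\<epsilon> * y)\<^sup>2 / (real (r \<tau>))\<^sup>2)\<^sup>2"
    by (simp add: prod.distrib prod_power_distrib)
  also have "(\<Prod>\<tau>\<in>Z. 1 + (\<epsilon> * y)\<^sup>2 / (real (r \<tau>))\<^sup>2) = (\<Prod>j=1..card Z. 1 + (\<epsilon> * y)\<^sup>2 / (real j)\<^sup>2)"
    unfolding r_def by (rule prod.reindex_bij_betw[OF bij_betw_rank[OF Z(1)]])
  also have "(\<Prod>\<tau>\<in>Z. c \<tau>) = (\<Prod>\<tau>\<in>{\<tau> \<in> Z. \<tau> < T}. 1 + J ^ 4 / (\<epsilon> ^ 4 * \<tau>\<^sup>2))"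
    using Z by (simp add: c_def prod.If_cases Int_def)
  also have "\<dots> * (\<Prod>j=1..card Z. 1 + (\<epsilon> * y)\<^sup>2 / (real j)\<^sup>2)\<^sup>2 \<le> \<dots> * (exp (pi * (\<epsilon> * y)))\<^sup>2"
    using \<epsilon> y by (intro mult_left_mono power_mono prod_one_plus_square_le_exp prod_nonneg) (auto simp: J_def)
  also have "(exp (pi * (\<epsilon> * y)))\<^sup>2 = exp (2 * pi * (\<epsilon> * y))"
    by (simp flip: exp_of_nat_mult)
  finally show ?thesis by (simp add: J_def)
qed

section \<open>Coefficients of the polynomial formed from the zeros\<close>

lemma coeff_prod_linear_bound:
  fixes b :: "'a \<Rightarrow> real"
  assumes b: "\<And>\<tau>. \<tau> \<in> Z \<Longrightarrow> b \<tau> \<ge> 0"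
  shows "\<bar>Polynomial.coeff (\<Prod>\<tau>\<in>Z. [:1, - b \<tau>:]) m\<bar> \<le> Polynomial.coeff (\<Prod>\<tau>\<in>Z. [:1, b \<tau>:]) m"
  using b
proof (induction Z arbitrary: m rule: infinite_finite_induct)
  case (insert x F)
  have "\<bar>Polynomial.coeff (\<Prod>\<tau>\<in>F. [:1, - b \<tau>:]) k\<bar> \<le> Polynomial.coeff (\<Prod>\<tau>\<in>F. [:1, b \<tau>:]) k" for k
    using insert by auto
  moreover have "b x \<ge> 0" using insert by auto
  ultimately show ?case using insert(1,2)
    by (cases m) (auto simp: coeff_pCons abs_mult intro!: order_trans[OF abs_triangle_ineq4] add_mono mult_left_mono)
qed (auto simp: coeff_1)

text \<open>After the signs are made positive, a single term of the polynomial is at most its value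
  at \<open>x \<ge> 0\<close>. Keeping \<open>x\<close> free allows it to be optimised separately
  for each coefficient.\<close>

lemma coeff_prod_linear_le:
  fixes b :: "'a \<Rightarrow> real"
  assumes b: "\<And>\<tau>. \<tau> \<in> Z \<Longrightarrow> b \<tau> \<ge> 0" and x: "x \<ge> 0"
  shows "\<bar>Polynomial.coeff (\<Prod>\<tau>\<in>Z. [:1, - b \<tau>:]) m\<bar> * x ^ m \<le> (\<Prod>\<tau>\<in>Z. 1 + b \<tau> * x)"
proof -
  let ?q = "\<Prod>\<tau>\<in>Z. [:1, b \<tau>:]"
  have bd: "\<bar>Polynomial.coeff (\<Prod>\<tau>\<in>Z. [:1, - b \<tau>:]) k\<bar> \<le> Polynomial.coeff ?q k" for k
    by (rule coeff_prod_linear_bound) (fact b)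
  have nn: "Polynomial.coeff ?q k \<ge> 0" for k
    using bd[of k] by linarith
  have "\<bar>Polynomial.coeff (\<Prod>\<tau>\<in>Z. [:1, - b \<tau>:]) m\<bar> * x ^ m \<le> Polynomial.coeff ?q m * x ^ m"
    using x by (intro mult_right_mono bd) auto
  also have "\<dots> \<le> poly ?q x"
  proof (cases "m \<le> degree ?q")
    case True
    have "(\<Sum>i\<in>{m}. Polynomial.coeff ?q i * x ^ i) \<le> (\<Sum>i\<le>degree ?q. Polynomial.coeff ?q i * x ^ i)"
      using True nn x by (intro sum_mono2) auto
    then show ?thesis by (simp add: poly_altdef)
  next
    case False
    then have "Polynomial.coeff ?q m = 0" by (simp add: coeff_eq_0)
    moreover have "0 \<le> poly ?q x" unfolding poly_altdef using nn x by (intro sum_nonneg) auto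
    ultimately show ?thesis by simp
  qed
  also have "\<dots> = (\<Prod>\<tau>\<in>Z. 1 + b \<tau> * x)" by (simp add: poly_prod mult.commute)
  finally show ?thesis .
qed

text \<open>The coefficients decay like \<open>m^(- 4 m)\<close> and the factorials grow only like
  \<open>m^(2 m)\<close>, so what remains is the square of an exponential series. The degree of
  \<open>p\<close> does not enter the bound, which makes it uniform in the truncation
  height.\<close>

lemma sum_coeff_fact_le:
  fixes p :: "real poly" and \<epsilon> \<rho> C M :: real
  assumes coeff: "\<And>m y. y \<ge> 0 \<Longrightarrow> \<bar>Polynomial.coeff p m\<bar> * y ^ (4 * m) \<le> C * exp (2 * pi * (\<epsilon> * y))"
    and pos: "\<epsilon> > 0" "\<rho> > 0" "M \<ge> 0"
  shows "(\<Sum>m\<le>degree p. \<bar>Polynomial.coeff p m\<bar> * (fact (2 * m) * M / \<rho> ^ (2 * m))) \<le> C * M * exp (4 * exp pi * \<epsilon>\<^sup>2 / \<rho>)"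
proof -
  define B where "B = 2 * exp pi * \<epsilon>\<^sup>2 / \<rho>"
  have B: "B > 0" using pos by (simp add: B_def)
  have C0: "0 \<le> C" using order_trans[OF abs_ge_zero, of "Polynomial.coeff p 0" C] coeff[of 0 0] by simp
  have e: "(\<lambda>n. B ^ n / fact n) sums exp B"
    using exp_converges[of B] by (simp add: divide_inverse mult.commute)
  have ele: "(\<Sum>n\<in>A. B ^ n / fact n) \<le> exp B" if "finite A" for A
    using sum_le_suminf[of "\<lambda>n. B ^ n / fact n" A] e B that by (auto simp: sums_iff)
  have trm: "\<bar>Polynomial.coeff p m\<bar> * (fact (2 * m) * M / \<rho> ^ (2 * m)) \<le> C * M * (B ^ m / fact m)\<^sup>2" for m
  proof (cases "m = 0")
    case True
    then show ?thesis using coeff[of 0 0] pos by (simp add: mult_right_mono)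
  next
    case False
    then have m: "real m > 0" by simp
    \<comment> \<open>The choice \<open>y = m / \<epsilon>\<close> has the order of magnitude of the
      minimiser of \<open>exp (2 * pi * \<epsilon> * y) / y ^ (4 * m)\<close>.\<close>
    have "\<bar>Polynomial.coeff p m\<bar> * (real m / \<epsilon>) ^ (4 * m) \<le> C * exp (2 * pi * (\<epsilon> * (real m / \<epsilon>)))"
      using pos by (intro coeff) auto
    also have "\<epsilon> * (real m / \<epsilon>) = real m" using pos by simp
    also have "exp (2 * pi * real m) = (exp pi) ^ (2 * m)" by (simp add: mult_ac flip: exp_of_nat_mult)
    finally have *: "\<bar>Polynomial.coeff p m\<bar> * (real m / \<epsilon>) ^ (4 * m) \<le> C * (exp pi) ^ (2 * m)" .
    have c: "\<bar>Polynomial.coeff p m\<bar> \<le> C * (exp pi) ^ (2 * m) * \<epsilon> ^ (4 * m) / real m ^ (4 * m)"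
    proof -
      have "0 < (real m / \<epsilon>) ^ (4 * m)" using pos m by simp
      with * have "\<bar>Polynomial.coeff p m\<bar> \<le> C * (exp pi) ^ (2 * m) / (real m / \<epsilon>) ^ (4 * m)"
        by (simp only: pos_le_divide_eq)
      then show ?thesis by (simp add: power_divide)
    qed
    have f: "fact (2 * m) \<le> (2 * real m) ^ (2 * m)"
      using fact_le_power[of "2 * m", where ?'a = real] by simp
    have "\<bar>Polynomial.coeff p m\<bar> * (fact (2 * m) * M / \<rho> ^ (2 * m)) \<le>
        (C * (exp pi) ^ (2 * m) * \<epsilon> ^ (4 * m) / real m ^ (4 * m)) * ((2 * real m) ^ (2 * m) * M / \<rho> ^ (2 * m))"
      using c f pos C0 by (intro mult_mono divide_right_mono mult_right_mono) auto
    also have "\<dots> = C * M * (B ^ m / real m ^ m)\<^sup>2"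
    proof -
      have "(C * (exp pi) ^ (2 * m) * \<epsilon> ^ (4 * m) / real m ^ (4 * m)) * ((2 * real m) ^ (2 * m) * M / \<rho> ^ (2 * m))
          = C * M * ((exp pi)\<^sup>2 * \<epsilon> ^ 4 / real m ^ 4 * ((2 * real m)\<^sup>2 / \<rho>\<^sup>2)) ^ m"
        unfolding power_mult power_mult_distrib[of _ _ m] power_divide[of _ _ m] by simp
      also have "(exp pi)\<^sup>2 * \<epsilon> ^ 4 / real m ^ 4 * ((2 * real m)\<^sup>2 / \<rho>\<^sup>2) = (B / real m)\<^sup>2"
        using m pos by (simp add: B_def power2_eq_square power4_eq_xxxx mult_ac)
      also have "((B / real m)\<^sup>2) ^ m = (B ^ m / real m ^ m)\<^sup>2"
        by (metis power_divide power_mult power_even_eq)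
      finally show ?thesis .
    qed
    also have "\<dots> \<le> C * M * (B ^ m / fact m)\<^sup>2"
    proof -
      have "fact m \<le> real m ^ m" using fact_le_power[of m, where ?'a = real] by simp
      then show ?thesis using B C0 pos m by (intro mult_left_mono power_mono divide_left_mono) auto
    qed
    finally show ?thesis .
  qed
  \<comment> \<open>One factor of the square is bounded by the whole series \<open>exp B\<close> and
    the other is summed, for a total of \<open>exp (2 * B)\<close>.\<close>
  have sq: "(B ^ m / fact m)\<^sup>2 \<le> exp B * (B ^ m / fact m)" for m
    using ele[of "{m}"] B unfolding power2_eq_square by (intro mult_right_mono) auto
  have "(\<Sum>m\<le>degree p. \<bar>Polynomial.coeff p m\<bar> * (fact (2 * m) * M / \<rho> ^ (2 * m))) \<le> (\<Sum>m\<le>degree p. C * M * (exp B * (B ^ m / fact m)))"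
    by (intro sum_mono order_trans[OF trm] mult_left_mono sq) (use C0 pos in auto)
  also have "\<dots> = C * M * (exp B * (\<Sum>m\<le>degree p. B ^ m / fact m))"
    by (simp add: sum_distrib_left)
  also have "\<dots> \<le> C * M * (exp B * exp B)"
    using C0 pos by (intro mult_left_mono ele) auto
  also have "exp B * exp B = exp (4 * exp pi * \<epsilon>\<^sup>2 / \<rho>)"
    by (simp add: exp_add[symmetric] B_def)
  finally show ?thesis .
qed

section \<open>Sign changes on the real line\<close>

text \<open>The points around which \<open>E\<close> is positive, and those around which it is
  negative, form disjoint open sets covering a connected interval. Punctured neighbourhoods are used
  so that \<open>E\<close> may touch 0 at isolated points without changing sign.\<close>

lemma locally_signed_imp_constant_sign:
  fixes E :: "real \<Rightarrow> real"
  assumes cont: "continuous_on UNIV E"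
    and loc: "\<And>t. a < t \<Longrightarrow> t < b \<Longrightarrow> \<exists>s. eventually (\<lambda>x. s * E x > 0) (at t)"
  shows "\<exists>s\<in>{1, -1}. \<forall>t. a < t \<and> t < b \<longrightarrow> s * E t \<ge> 0"
proof -
  define U where "U = (\<lambda>s. {t. eventually (\<lambda>x. s * E x > 0) (at t)})"
  have opU: "open (U s)" for s
  proof (rule openI)
    fix t assume "t \<in> U s"
    then obtain d where d: "d > 0" "\<And>x. x \<noteq> t \<Longrightarrow> dist x t < d \<Longrightarrow> s * E x > 0"
      by (auto simp: U_def eventually_at)
    have "ball t d \<subseteq> U s"
    proof
      fix t' assume t': "t' \<in> ball t d"
      show "t' \<in> U s"
      proof (cases "t' = t")
        case False
        have "eventually (\<lambda>x. x \<in> ball t d - {t}) (nhds t')"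
          using t' False by (intro eventually_nhds_in_open) auto
        then have "eventually (\<lambda>x. s * E x > 0) (nhds t')"
          by eventually_elim (use d in \<open>auto simp: dist_commute\<close>)
        then show ?thesis by (simp add: U_def eventually_at_filter eventually_mono)
      qed (use \<open>t \<in> U s\<close> in auto)
    qed
    then show "\<exists>T>0. ball t T \<subseteq> U s" using d by blast
  qed
  have disj: "U 1 \<inter> U (-1) = {}"
  proof -
    have False if "eventually (\<lambda>x. 1 * E x > 0) (at t)" "eventually (\<lambda>x. -1 * E x > 0) (at t)" for t
    proof -
      have "eventually (\<lambda>x. False) (at t)" using that by eventually_elim auto
      then show False by (simp add: eventually_False)
    qed
    then show ?thesis by (auto simp: U_def)
  qed
  have cover: "{a<..<b} \<subseteq> U 1 \<union> U (-1)"
  proof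
    fix t assume "t \<in> {a<..<b}"
    then obtain s where s: "eventually (\<lambda>x. s * E x > 0) (at t)" using loc by auto
    then obtain x where "s * E x > 0" by (metis eventually_happens' at_neq_bot)
    then have "s \<noteq> 0" by auto
    then consider "s > 0" | "s < 0" by linarith
    then show "t \<in> U 1 \<union> U (-1)"
    proof cases
      case 1
      with s have "t \<in> U 1" by (auto simp: U_def zero_less_mult_iff elim!: eventually_mono)
      then show ?thesis by blast
    next
      case 2
      with s have "t \<in> U (-1)" by (auto simp: U_def zero_less_mult_iff elim!: eventually_mono)
      then show ?thesis by blast
    qed
  qed
  have main: "s * E t \<ge> 0" if "s \<in> {1, -1}" "U (-s) \<inter> {a<..<b} = {}" "t \<in> {a<..<b}" for s t
  proof (rule ccontr)
    assume "\<not> s * E t \<ge> 0"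
    then have "- s * E t > 0" by simp
    moreover have "((\<lambda>x. - s * E x) \<longlongrightarrow> - s * E t) (at t)"
      using cont by (intro tendsto_intros) (simp add: continuous_on_def)
    ultimately have "eventually (\<lambda>x. - s * E x > 0) (at t)" by (metis order_tendstoD(1))
    with that show False by (auto simp: U_def)
  qed
  have "U 1 \<inter> {a<..<b} = {} \<or> U (-1) \<inter> {a<..<b} = {}"
    by (rule connectedD) (use opU disj cover in auto)
  then show ?thesis
    using main[of 1] main[of "-1"] by auto
qed

text \<open>The order of vanishing along the real parameter is the complex order. The cofactor from
  the local factorisation is real away from \<open>t0\<close>, because \<open>R\<close> is, and
  hence by continuity also at \<open>t0\<close>; so its real part does not vanish there.\<close>

lemma real_line_zero_factor:
  fixes F :: "complex \<Rightarrow> complex" and R :: "real \<Rightarrow> real" and t0 :: real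
  assumes hol: "F holomorphic_on UNIV" and nz: "\<exists>w. F w \<noteq> 0"
    and R: "\<And>t. F (\<i> * of_real t) = \<eta> * of_real (R t)" and \<eta>: "\<eta> \<noteq> 0"
  defines "n \<equiv> nat (zorder F (\<i> * of_real t0))"
  obtains \<rho> :: "real \<Rightarrow> real" where "isCont \<rho> t0" "\<rho> t0 \<noteq> 0"
    "eventually (\<lambda>t. R t = (t - t0) ^ n * \<rho> t) (nhds t0)"
    "zorder F (\<i> * of_real t0) = int n" "F (\<i> * of_real t0) \<noteq> 0 \<Longrightarrow> n = 0"
proof -
  define z where "z = \<i> * complex_of_real t0"
  define g where "g = zor_poly F z"
  have "(if F z = 0 then zorder F z > 0 else zorder F z = 0) \<and>
     (\<exists>r. r > 0 \<and> cball z r \<subseteq> UNIV \<and> g holomorphic_on cball z r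
    \<and> (\<forall>w\<in>cball z r. F w = g w * (w - z) ^ nat (zorder F z) \<and> g w \<noteq> 0))"
    unfolding g_def by (rule zorder_exist_zero[OF hol]) (use nz in auto)
  then obtain r where zo: "if F z = 0 then zorder F z > 0 else zorder F z = 0"
    and r: "r > 0" "g holomorphic_on cball z r"
    and g: "\<And>w. w \<in> cball z r \<Longrightarrow> F w = g w * (w - z) ^ n" "\<And>w. w \<in> cball z r \<Longrightarrow> g w \<noteq> 0"
    unfolding n_def z_def[symmetric] by blast
  \<comment> \<open>The factor \<open>\<i> ^ n\<close> arises from rewriting the power of
    \<open>\<i> * t - \<i> * t0\<close> in terms of \<open>t - t0\<close>.\<close>
  define q where "q = (\<lambda>t. g (\<i> * of_real t) * \<i> ^ n / \<eta>)"
  have inb: "\<i> * of_real t \<in> cball z r" if "dist t t0 < r" for t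
  proof -
    have "z - \<i> * of_real t = \<i> * of_real (t0 - t)" by (simp add: z_def algebra_simps)
    then have "dist z (\<i> * of_real t) = \<bar>t0 - t\<bar>" by (metis dist_norm norm_mult norm_ii mult_1 norm_of_real)
    with that show ?thesis by (simp add: dist_real_def)
  qed
  have eq: "complex_of_real (R t) = of_real (t - t0) ^ n * q t" if "dist t t0 < r" for t
  proof -
    have "\<eta> * of_real (R t) = g (\<i> * of_real t) * (\<i> * of_real t - z) ^ n"
      using g(1)[OF inb[OF that]] R by simp
    also have "\<i> * of_real t - z = \<i> * of_real (t - t0)" by (simp add: z_def algebra_simps)
    finally have "of_real (R t) = g (\<i> * of_real t) * (\<i> * of_real (t - t0)) ^ n / \<eta>"
      using \<eta> by (metis nonzero_mult_div_cancel_left)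
    then show ?thesis by (simp only: q_def power_mult_distrib) simp
  qed
  have gcont: "isCont g z"
    using r by (intro continuous_on_interior[OF holomorphic_on_imp_continuous_on[OF r(2)]]) auto
  have qcont: "isCont q t0"
  proof -
    have "isCont (\<lambda>t. g (\<i> * of_real t)) t0"
      by (rule isCont_o2[where g = g]) (use gcont in \<open>auto simp: z_def intro!: continuous_intros\<close>)
    then show ?thesis unfolding q_def using \<eta> by (intro continuous_intros) auto
  qed
  have Im0: "Im (q t) = 0" if "dist t t0 < r" "t \<noteq> t0" for t
  proof -
    have "q t = of_real (R t / (t - t0) ^ n)"
      using eq[OF that(1)] that(2) by (simp add: field_simps)
    then show ?thesis by simp
  qed
  have "((\<lambda>t. Im (q t)) \<longlongrightarrow> Im (q t0)) (at t0)"
    using qcont by (intro tendsto_intros) (simp add: isCont_def)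
  moreover have "eventually (\<lambda>t. Im (q t) = 0) (at t0)"
    unfolding eventually_at using r Im0 by blast
  then have "((\<lambda>t. Im (q t)) \<longlongrightarrow> 0) (at t0)" by (rule tendsto_eventually)
  ultimately have "Im (q t0) = 0" using tendsto_unique at_neq_bot by blast
  moreover have "q t0 \<noteq> 0" using g(2)[of z] r \<eta> by (simp add: q_def z_def)
  ultimately have "Re (q t0) \<noteq> 0" by (simp add: complex_eq_iff)
  moreover have "isCont (\<lambda>t. Re (q t)) t0" using qcont unfolding isCont_def by (intro tendsto_intros)
  moreover have "eventually (\<lambda>t. R t = (t - t0) ^ n * Re (q t)) (nhds t0)"
  proof -
    have "R t = (t - t0) ^ n * Re (q t)" if "dist t t0 < r" for t
    proof -
      have "complex_of_real (R t) = of_real ((t - t0) ^ n) * q t" using eq[OF that] by simp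
      from arg_cong[OF this, of Re] show ?thesis by simp
    qed
    then show ?thesis unfolding eventually_nhds_metric using r by blast
  qed
  moreover have "zorder F (\<i> * of_real t0) = int n" "F (\<i> * of_real t0) \<noteq> 0 \<Longrightarrow> n = 0"
    using zo by (auto simp: n_def z_def split: if_splits)
  ultimately show thesis using that by blast
qed

text \<open>The Weierstrass product inequality; it keeps the polynomial with the odd zeros away from
  0 near the origin.\<close>

lemma one_minus_sum_le_prod:
  fixes f :: "'a \<Rightarrow> real"
  assumes "\<And>x. x \<in> A \<Longrightarrow> 0 \<le> f x \<and> f x \<le> 1"
  shows "1 - sum f A \<le> (\<Prod>x\<in>A. 1 - f x)"
  using assms
proof (induction A rule: infinite_finite_induct)
  case (insert x F)
  have p: "(\<Prod>x\<in>F. 1 - f x) \<le> 1" "0 \<le> (\<Prod>x\<in>F. 1 - f x)"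
    using insert by (auto intro!: prod_le_1 prod_nonneg)
  have "f x * (\<Prod>x\<in>F. 1 - f x) \<le> f x * 1" using p insert by (intro mult_left_mono) auto
  moreover have "1 - sum f F \<le> (\<Prod>x\<in>F. 1 - f x)" using insert by auto
  ultimately show ?case using insert(1,2) by (simp add: algebra_simps)
qed auto

text \<open>Turns an upper bound for the product at one point into a bound for the sum of
  \<open>1 / \<tau>^2\<close> that is uniform in the truncation.\<close>

lemma sum_le_prod_one_plus:
  fixes f :: "'a \<Rightarrow> real"
  assumes "\<And>x. x \<in> A \<Longrightarrow> 0 \<le> f x"
  shows "sum f A \<le> (\<Prod>x\<in>A. 1 + f x)"
proof -
  have "1 + sum f A \<le> (\<Prod>x\<in>A. 1 + f x)"
    using assms
  proof (induction A rule: infinite_finite_induct)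
    case (insert x F)
    have "1 \<le> (\<Prod>x\<in>F. 1 + f x)" using insert by (intro prod_ge_1) auto
    then have "f x * 1 \<le> f x * (\<Prod>x\<in>F. 1 + f x)" using insert by (intro mult_left_mono) auto
    moreover have "1 + sum f F \<le> (\<Prod>x\<in>F. 1 + f x)" using insert by auto
    ultimately show ?case using insert(1,2) by (simp add: algebra_simps)
  qed auto
  then show ?thesis by simp
qed

section \<open>Odd zeros of the Laplace transform\<close>

text \<open>\<open>\<sigma>\<close> will be the Fricke eigenvalue, and \<open>\<omega>\<close> the
  common phase of the Fourier coefficients: 1 if they are real, \<open>\<i>\<close> if they are
  purely imaginary.\<close>

locale parity_strip_function = strip_function +
  fixes \<sigma> :: real and \<omega> :: complex
  assumes \<sigma>: "\<sigma> = 1 \<or> \<sigma> = -1" and parity: "h (of_real (- x)) = of_real \<sigma> * h (of_real x)"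
    and \<omega>: "\<omega> \<noteq> 0" and real_valued: "Im (h (of_real x) / \<omega>) = 0"
    and nonzero: "\<exists>x. h (of_real x) \<noteq> 0"
begin

lemma \<Lambda>_nonzero: "\<exists>t. H t \<noteq> 0"
proof (rule ccontr)
  assume "\<not> ?thesis"
  then have z: "H t = 0" for t by blast
  obtain x where x: "h (of_real x) \<noteq> 0" using nonzero by blast
  have "(LBINT t. H t * exp (of_real t * (- \<i> * of_real x))) = 2 * pi * h (\<i> * (- \<i> * of_real x))"
    by (rule \<Lambda>_inversion) auto
  then show False using x by (simp add: z)
qed

lemma \<Lambda>_parity: "\<Lambda> (- s) = of_real \<sigma> * \<Lambda> s"
proof -
  have "\<Lambda> (- s) = (LBINT x. h (of_real (- x)) * exp (of_real x * s))"
    unfolding \<Lambda>_def by (subst lborel_integral_real_affine[of "-1" _ 0]) auto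
  also have "\<dots> = (LBINT x. of_real \<sigma> * (h (of_real x) * exp (of_real x * s)))"
    unfolding parity by (simp add: mult.assoc)
  finally show ?thesis by (simp add: \<Lambda>_def)
qed

lemma \<Lambda>_cnj: "cnj (H t / \<omega>) = of_real \<sigma> * (H t / \<omega>)"
proof -
  have "cnj (h (of_real x) / \<omega>) = h (of_real x) / \<omega>" for x
    using real_valued[of x] by (simp add: complex_eq_iff del: complex_cnj_divide)
  then have c: "cnj (h (of_real x)) / cnj \<omega> = h (of_real x) / \<omega>" for x by simp
  have "cnj (H t / \<omega>) = (LBINT x. cnj (h (of_real x) * exp (of_real x * (\<i> * of_real t)))) / cnj \<omega>"
    by (simp only: \<Lambda>_def complex_cnj_divide Bochner_Integration.integral_cnj)
  also have "\<dots> = (LBINT x. cnj (h (of_real x) * exp (of_real x * (\<i> * of_real t))) / cnj \<omega>)"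
    by (rule integral_divide_zero[symmetric])
  also have "\<dots> = (LBINT x. h (of_real x) * exp (of_real x * (- (\<i> * of_real t))) / \<omega>)"
  proof (rule Bochner_Integration.integral_cong[OF refl])
    fix x
    have "cnj (exp (of_real x * (\<i> * of_real t))) = exp (of_real x * (- (\<i> * of_real t)))"
      by (simp add: exp_cnj)
    then show "cnj (h (of_real x) * exp (of_real x * (\<i> * of_real t))) / cnj \<omega> =
        h (of_real x) * exp (of_real x * (- (\<i> * of_real t))) / \<omega>"
      by (simp only: complex_cnj_mult times_divide_eq_left[symmetric] c)
  qed
  also have "\<dots> = \<Lambda> (- (\<i> * of_real t)) / \<omega>"
    unfolding \<Lambda>_def by (rule integral_divide_zero)
  finally show ?thesis by (simp add: \<Lambda>_parity)
qed

text \<open>For even \<open>h\<close> the transform divided by \<open>\<omega>\<close> is real, for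
  odd \<open>h\<close> it is purely imaginary; the additional \<open>\<i>\<close> makes
  \<open>R\<close> carry all the information in both cases.\<close>

definition \<eta> :: complex where "\<eta> = (if \<sigma> = 1 then \<omega> else \<i> * \<omega>)"

definition R :: "real \<Rightarrow> real" where "R t = Re (H t / \<eta>)"

lemma \<eta>_nonzero: "\<eta> \<noteq> 0" using \<omega> by (simp add: \<eta>_def)

lemma \<Lambda>_eq_R: "H t = \<eta> * of_real (R t)"
proof -
  have "Im (H t / \<eta>) = 0"
  proof (cases "\<sigma> = 1")
    case True
    then have "\<eta> = \<omega>" unfolding \<eta>_def by (rule if_P)
    then show ?thesis using arg_cong[OF \<Lambda>_cnj[of t], of Im] True
      by (simp del: complex_cnj_divide)
  next
    case False
    then have s: "\<sigma> = -1" using \<sigma> by auto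
    have "Re (H t / \<omega>) = 0"
      using arg_cong[OF \<Lambda>_cnj[of t], of Re] s by (simp del: complex_cnj_divide)
    moreover have "H t / \<eta> = - \<i> * (H t / \<omega>)"
      using False \<omega> by (simp add: \<eta>_def field_simps)
    ultimately show ?thesis by (simp del: times_divide_eq_right)
  qed
  then have "H t / \<eta> = of_real (R t)" by (simp add: R_def complex_eq_iff)
  then show ?thesis using \<eta>_nonzero by (metis nonzero_mult_div_cancel_left times_divide_eq_right)
qed

lemma R_parity: "R (- t) = \<sigma> * R t"
  using \<Lambda>_parity[of "\<i> * of_real t"] \<sigma> by (auto simp: R_def)

lemma R_cont: "continuous_on UNIV R"
proof -
  have "continuous_on UNIV (\<lambda>t. H t)"
    by (rule continuous_on_compose2[OF holomorphic_on_imp_continuous_on[OF \<Lambda>_holomorphic]])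
      (auto intro!: continuous_intros)
  then show ?thesis unfolding R_def using \<eta>_nonzero by (intro continuous_intros) auto
qed

lemma R_measurable [measurable]: "R \<in> borel_measurable lborel"
  using R_cont by (simp add: borel_measurable_continuous_onI)

lemma norm_\<Lambda>_R: "norm (H t) = norm \<eta> * \<bar>R t\<bar>"
  by (simp add: \<Lambda>_eq_R norm_mult)

lemma R_exp_integrable:
  assumes "0 \<le> r" "r < pi / 2"
  shows "integrable lborel (\<lambda>t. \<bar>R t\<bar> * exp (r * \<bar>t\<bar>))"
proof -
  have "integrable lborel (\<lambda>t. norm (H t) * exp (r * \<bar>t\<bar>))"
    using \<Lambda>_exp_integrable[of 0 r] assms by simp
  then have "integrable lborel (\<lambda>t. (1 / norm \<eta>) * (norm (H t) * exp (r * \<bar>t\<bar>)))"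
    by (rule integrable_mult_right)
  then show ?thesis using \<eta>_nonzero by (simp add: norm_\<Lambda>_R)
qed

lemma finite_zeros: "finite {t. 0 \<le> t \<and> t \<le> A \<and> R t = 0}"
proof -
  obtain t0 where t0: "H t0 \<noteq> 0" using \<Lambda>_nonzero by blast
  let ?K = "(\<lambda>t. \<i> * complex_of_real t) ` {0..A}"
  have "finite {z \<in> ?K. \<Lambda> z = 0}"
  proof (cases "\<Lambda> constant_on UNIV")
    case True
    then have "\<Lambda> z \<noteq> 0" for z using t0 by (auto simp: constant_on_def)
    then show ?thesis by simp
  next
    case False
    then show ?thesis
      by (intro holomorphic_compact_finite_zeros[OF \<Lambda>_holomorphic] compact_continuous_image continuous_intros) auto
  qed
  then have "finite ((\<lambda>t. \<i> * complex_of_real t) -` {z \<in> ?K. \<Lambda> z = 0})"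
    by (rule finite_vimageI) (auto simp: inj_def)
  then show ?thesis
    by (rule finite_subset[rotated]) (auto simp: \<Lambda>_eq_R)
qed

text \<open>A zero at 0 is left out because it would give no factor
  \<open>1 - t^2 / \<tau>^2\<close>, and negative zeros are mirror images. The strict upper end lets
  the rank of a zero be estimated from slightly larger sets.\<close>

definition Z :: "real \<Rightarrow> real set" where
  "Z A = {t. 0 < t \<and> t < A \<and> H t = 0 \<and> odd (zorder \<Lambda> (\<i> * of_real t))}"

lemma finite_Z: "finite (Z A)"
  by (rule finite_subset[OF _ finite_zeros[of A]]) (use \<eta>_nonzero in \<open>auto simp: Z_def \<Lambda>_eq_R\<close>)

lemma Z_pos: "\<tau> \<in> Z A \<Longrightarrow> 0 < \<tau>" by (simp add: Z_def)

text \<open>The variable stands for \<open>t^2\<close>: a factor covers both \<open>\<tau>\<close>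
  and \<open>- \<tau>\<close>, parity is preserved, and the \<open>m\<close>-th coefficient is
  paired with the moment of order \<open>2 * m\<close>.\<close>

definition P :: "real \<Rightarrow> real poly" where "P A = (\<Prod>\<tau>\<in>Z A. [:1, - (1 / \<tau>\<^sup>2):])"

abbreviation Q :: "real \<Rightarrow> real \<Rightarrow> real" where "Q A t \<equiv> poly (P A) (t\<^sup>2)"

lemma poly_P: "Q A t = (\<Prod>\<tau>\<in>Z A. 1 - t\<^sup>2 / \<tau>\<^sup>2)"
  by (simp add: P_def poly_prod)

text \<open>\<open>Q A\<close> has a simple zero exactly at the points of \<open>Z A\<close> on the
  positive axis. Wherever \<open>R\<close> vanishes to odd order the product therefore vanishes to
  even order, and elsewhere the order was even already.\<close>

lemma R_P_locally_signed:
  assumes t0: "0 < t0" "t0 < A"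
  shows "\<exists>s. eventually (\<lambda>t. s * (R t * Q A t) > 0) (at t0)"
proof -
  define n where "n = nat (zorder \<Lambda> (\<i> * of_real t0))"
  obtain \<rho> where \<rho>: "isCont \<rho> t0" "\<rho> t0 \<noteq> 0"
    and ev: "eventually (\<lambda>t. R t = (t - t0) ^ n * \<rho> t) (nhds t0)"
    and n: "zorder \<Lambda> (\<i> * of_real t0) = int n" "H t0 \<noteq> 0 \<Longrightarrow> n = 0"
    unfolding n_def
    by (rule real_line_zero_factor[OF \<Lambda>_holomorphic _ \<Lambda>_eq_R \<eta>_nonzero]) (use \<Lambda>_nonzero in blast)+
  \<comment> \<open>\<open>m\<close> is the order of \<open>Q A\<close> at \<open>t0\<close>, either
    1 or 0, and \<open>p\<close> the nonvanishing cofactor.\<close>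
  obtain m p where p: "isCont p t0" "p t0 \<noteq> 0" "even (n + m)"
    and pm: "\<And>t. Q A t = (t - t0) ^ m * p t"
  proof (cases "t0 \<in> Z A")
    case True
    define p where "p = (\<lambda>t. - (t + t0) / t0\<^sup>2 * (\<Prod>\<tau>\<in>Z A - {t0}. 1 - t\<^sup>2 / \<tau>\<^sup>2))"
    show ?thesis
    proof (rule that[of p 1])
      show "isCont p t0" unfolding p_def using t0
        by (intro continuous_intros) (auto simp: Z_def)
      have "(\<Prod>\<tau>\<in>Z A - {t0}. 1 - t0\<^sup>2 / \<tau>\<^sup>2) \<noteq> 0"
        using finite_Z t0 by (auto simp: Z_def power2_eq_iff field_simps)
      then show "p t0 \<noteq> 0" using t0 by (simp add: p_def)
      show "even (n + 1)" using True n by (auto simp: Z_def)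
      show "Q A t = (t - t0) ^ 1 * p t" for t
        unfolding poly_P prod.remove[OF finite_Z True] p_def using t0
        by (simp add: field_simps power2_eq_square)
    qed
  next
    case False
    show ?thesis
    proof (rule that[of "\<lambda>t. Q A t" 0])
      show "isCont (\<lambda>t. Q A t) t0" by (intro continuous_intros)
      show "Q A t0 \<noteq> 0"
        unfolding poly_P using False t0 finite_Z by (auto simp: power2_eq_iff Z_def field_simps)
      show "even (n + 0)" using False n t0 by (cases "H t0 = 0") (auto simp: Z_def)
    qed auto
  qed
  \<comment> \<open>Taking the limit value itself as \<open>s\<close> makes \<open>s\<close> times
    the limit a nonzero square.\<close>
  define s where "s = \<rho> t0 * p t0"
  have "((\<lambda>t. s * (\<rho> t * p t)) \<longlongrightarrow> s * (\<rho> t0 * p t0)) (at t0)"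
    using \<rho>(1) p(1) by (intro tendsto_intros) (auto simp: isCont_def)
  moreover have "s * (\<rho> t0 * p t0) > 0"
    using \<rho>(2) p(2) unfolding s_def by (metis mult_eq_0_iff not_real_square_gt_zero)
  ultimately have "eventually (\<lambda>t. s * (\<rho> t * p t) > 0) (at t0)"
    by (rule order_tendstoD(1))
  moreover have "eventually (\<lambda>t. R t = (t - t0) ^ n * \<rho> t) (at t0)"
    using ev by (simp add: eventually_at_filter eventually_mono)
  moreover have "eventually (\<lambda>t. t \<noteq> t0) (at t0)" by (simp add: eventually_at_filter)
  ultimately have "eventually (\<lambda>t. s * (R t * Q A t) > 0) (at t0)"
  proof eventually_elim
    case (elim t)
    have "s * (R t * Q A t) = (t - t0) ^ (n + m) * (s * (\<rho> t * p t))"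
      using elim(2) pm[of t] by (simp add: power_add)
    moreover have "(t - t0) ^ (n + m) > 0" using p(3) elim(3) by (simp add: zero_less_power_eq)
    ultimately show ?case using elim(1) by (metis mult_pos_pos)
  qed
  then show ?thesis by blast
qed

lemma R_P_constant_sign:
  "\<exists>s\<in>{1, -1}. \<forall>t. 0 < t \<and> t < A \<longrightarrow> s * (R t * Q A t) \<ge> 0"
proof (rule locally_signed_imp_constant_sign)
  show "continuous_on UNIV (\<lambda>t. R t * Q A t)"
    by (intro continuous_intros R_cont)
qed (use R_P_locally_signed in blast)


text \<open>The constant is the product over the zeros below \<open>T\<close> and so does not depend
  on \<open>A\<close>. This uniformity is what makes the later limit in \<open>A\<close>
  possible.\<close>

lemma P_upper:
  assumes \<epsilon>: "\<epsilon> > 0" and T: "\<And>A. A \<ge> T \<Longrightarrow> real (card (Z A)) \<le> \<epsilon> * sqrt A" "T > 0"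
  obtains C where "\<And>A y. A > T \<Longrightarrow> y \<ge> 0 \<Longrightarrow> (\<Prod>\<tau>\<in>Z A. 1 + y ^ 4 / \<tau>\<^sup>2) \<le> C * exp (2 * pi * (\<epsilon> * y))"
proof -
  have "(\<Prod>\<tau>\<in>Z A. 1 + y ^ 4 / \<tau>\<^sup>2) \<le>
      (\<Prod>\<tau>\<in>Z T. 1 + real (card (Z T)) ^ 4 / (\<epsilon> ^ 4 * \<tau>\<^sup>2)) * exp (2 * pi * (\<epsilon> * y))"
    if A: "A > T" and y: "y \<ge> 0" for A y
  proof -
    have eq: "{\<tau> \<in> Z A. \<tau> < T} = Z T" using A by (auto simp: Z_def)
    show ?thesis
      unfolding eq[symmetric]
    proof (rule prod_zeros_le)
      fix \<tau> assume \<tau>: "\<tau> \<in> Z A" "T \<le> \<tau>"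
      \<comment> \<open>\<open>Z \<tau>\<close> does not contain \<open>\<tau>\<close>, so the count
        is taken in \<open>Z B\<close> for \<open>B > \<tau>\<close>, and \<open>B\<close> then
        tends to \<open>\<tau>\<close> from the right.\<close>
      have "real (card {\<tau>' \<in> Z A. \<tau>' \<le> \<tau>}) \<le> \<epsilon> * sqrt B" if B: "B > \<tau>" for B
      proof -
        have "card {\<tau>' \<in> Z A. \<tau>' \<le> \<tau>} \<le> card (Z B)"
          by (intro card_mono finite_Z) (use B in \<open>auto simp: Z_def\<close>)
        also have "real (card (Z B)) \<le> \<epsilon> * sqrt B" using T(1)[of B] B \<tau> by simp
        finally show ?thesis by simp
      qed
      then have "eventually (\<lambda>B. real (card {\<tau>' \<in> Z A. \<tau>' \<le> \<tau>}) \<le> \<epsilon> * sqrt B) (at_right \<tau>)"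
        by (auto simp: eventually_at_filter)
      moreover have "((\<lambda>B. \<epsilon> * sqrt B) \<longlongrightarrow> \<epsilon> * sqrt \<tau>) (at_right \<tau>)"
        by (intro tendsto_intros)
      ultimately show "real (card {\<tau>' \<in> Z A. \<tau>' \<le> \<tau>}) \<le> \<epsilon> * sqrt \<tau>"
        by (intro tendsto_lowerbound) auto
    qed (use finite_Z Z_pos \<epsilon> y in auto)
  qed
  then show ?thesis using that by blast
qed

text \<open>Expanding \<open>Q A\<close> gives a finite combination of even moments of
  \<open>H\<close>. Each moment carries the smallness \<open>B\<close> of \<open>h\<close> near the
  cusp, and the growth of \<open>P\<close> costs only
  \<open>exp (4 * exp pi * \<epsilon>\<^sup>2 / \<rho>)\<close>.\<close>

lemma R_P_integral_bound:
  assumes \<theta>: "\<bar>\<theta>\<bar> + \<rho> < pi / 2" "0 < \<rho>" and B: "\<And>w. norm (w - of_real \<theta>) = \<rho> \<Longrightarrow> norm (h (\<i> * w)) \<le> B"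
    and \<epsilon>: "\<epsilon> > 0" and C: "\<And>y. y \<ge> 0 \<Longrightarrow> (\<Prod>\<tau>\<in>Z A. 1 + y ^ 4 / \<tau>\<^sup>2) \<le> C * exp (2 * pi * (\<epsilon> * y))"
  shows "integrable lborel (\<lambda>t. R t * Q A t * exp (t * \<theta>))" (is ?A)
    and "norm \<eta> * \<bar>LBINT t. R t * Q A t * exp (t * \<theta>)\<bar> \<le> C * (2 * pi * B) * exp (4 * exp pi * \<epsilon>\<^sup>2 / \<rho>)" (is ?B)
proof -
  let ?M = "\<lambda>n t. H t * exp (of_real t * of_real \<theta>) * of_real t ^ n"
  have M: "integrable lborel (?M n)" for n
    using \<theta> by (intro \<Lambda>_moment_integrable) auto
  have B0: "B \<ge> 0"
    using order_trans[OF norm_ge_zero B[of "of_real (\<theta> + \<rho>)"]] \<theta> by simp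
  have eq: "of_real (R t * Q A t * exp (t * \<theta>)) = (\<Sum>m\<le>degree (P A). of_real (Polynomial.coeff (P A) m) / \<eta> * ?M (2 * m) t)" for t
  proof -
    have "of_real (R t * Q A t * exp (t * \<theta>)) =
        of_real (R t) * (\<Sum>m\<le>degree (P A). of_real (Polynomial.coeff (P A) m) * of_real t ^ (2 * m)) * exp (of_real t * of_real \<theta>)"
      by (simp add: poly_altdef power_mult exp_of_real[symmetric])
    also have "of_real (R t) = H t / \<eta>"
      using \<eta>_nonzero by (simp add: \<Lambda>_eq_R)
    finally show ?thesis
      by (simp add: sum_distrib_left sum_distrib_right mult_ac)
  qed
  have int: "integrable lborel (\<lambda>t. complex_of_real (R t * Q A t * exp (t * \<theta>)))"
    unfolding eq by (intro Bochner_Integration.integrable_sum integrable_mult_right M)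
  from integrable_Re[OF this] show ?A by simp
  have "complex_of_real (LBINT t. R t * Q A t * exp (t * \<theta>)) =
      (LBINT t. complex_of_real (R t * Q A t * exp (t * \<theta>)))"
    by (rule integral_complex_of_real[symmetric])
  also have "\<dots> = (\<Sum>m\<le>degree (P A). of_real (Polynomial.coeff (P A) m) / \<eta> * integral\<^sup>L lborel (?M (2 * m)))"
    unfolding eq
    by (subst Bochner_Integration.integral_sum) (intro integrable_mult_right M, simp)
  finally have "norm (complex_of_real (LBINT t. R t * Q A t * exp (t * \<theta>))) \<le>
      (\<Sum>m\<le>degree (P A). norm (of_real (Polynomial.coeff (P A) m) / \<eta> * integral\<^sup>L lborel (?M (2 * m))))"
    by (simp only: norm_sum)
  also have "\<dots> \<le> (\<Sum>m\<le>degree (P A). \<bar>Polynomial.coeff (P A) m\<bar> / norm \<eta> * (fact (2 * m) * (2 * pi * B) / \<rho> ^ (2 * m)))"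
  proof (rule sum_mono)
    fix m
    show "norm (of_real (Polynomial.coeff (P A) m) / \<eta> * integral\<^sup>L lborel (?M (2 * m))) \<le> \<bar>Polynomial.coeff (P A) m\<bar> / norm \<eta> * (fact (2 * m) * (2 * pi * B) / \<rho> ^ (2 * m))"
      unfolding norm_mult norm_divide norm_of_real
      by (intro mult_left_mono \<Lambda>_moment_bound[OF \<theta> B]) auto
  qed
  also have "\<dots> = (1 / norm \<eta>) * (\<Sum>m\<le>degree (P A). \<bar>Polynomial.coeff (P A) m\<bar> * (fact (2 * m) * (2 * pi * B) / \<rho> ^ (2 * m)))"
    by (simp add: sum_distrib_left)
  also have "\<dots> \<le> (1 / norm \<eta>) * (C * (2 * pi * B) * exp (4 * exp pi * \<epsilon>\<^sup>2 / \<rho>))"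
  proof (intro mult_left_mono sum_coeff_fact_le)
    fix m :: nat and y :: real assume y: "y \<ge> 0"
    have "\<bar>Polynomial.coeff (P A) m\<bar> * (y ^ 4) ^ m \<le> (\<Prod>\<tau>\<in>Z A. 1 + 1 / \<tau>\<^sup>2 * y ^ 4)"
      unfolding P_def by (rule coeff_prod_linear_le) (use y in auto)
    also have "\<dots> \<le> C * exp (2 * pi * (\<epsilon> * y))" using C[OF y] by simp
    finally show "\<bar>Polynomial.coeff (P A) m\<bar> * y ^ (4 * m) \<le> C * exp (2 * pi * (\<epsilon> * y))"
      by (simp add: power_mult)
  qed (use \<epsilon> \<theta> B0 in auto)
  finally have "\<bar>LBINT t. R t * Q A t * exp (t * \<theta>)\<bar> \<le> (1 / norm \<eta>) * (C * (2 * pi * B) * exp (4 * exp pi * \<epsilon>\<^sup>2 / \<rho>))"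
    by (simp only: norm_of_real)
  then show ?B
    using \<eta>_nonzero by (simp add: field_simps)
qed

section \<open>A lower bound for the integral of constant sign\<close>

abbreviation W :: "real \<Rightarrow> real \<Rightarrow> real" where
  "W \<kappa> t \<equiv> indicator {-\<kappa>..\<kappa>} t * (\<bar>R t\<bar> * \<bar>exp t - exp (- t)\<bar>)"

text \<open>\<open>R\<close> has finitely many zeros in the interval from 0 to
  \<open>\<kappa>\<close>, so the integrand is positive almost everywhere on it. The value involves
  neither \<open>A\<close> nor \<open>\<delta>\<close> and is the fixed quantity that the final
  estimate contradicts.\<close>

lemma R_sinh_integral_pos:
  assumes \<kappa>: "\<kappa> > 0"
  shows "0 < (LBINT t. W \<kappa> t)"
    and "integrable lborel (\<lambda>t. W \<kappa> t)"
proof -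
  have "set_integrable lborel {-\<kappa>..\<kappa>} (\<lambda>t. \<bar>R t\<bar> * \<bar>exp t - exp (- t)\<bar>)"
    by (intro borel_integrable_atLeastAtMost' continuous_intros continuous_on_subset[OF R_cont]) auto
  then show int: "integrable lborel (W \<kappa>)" by (simp add: set_integrable_def)
  have "integral\<^sup>L lborel (W \<kappa>) \<noteq> 0"
  proof
    assume "integral\<^sup>L lborel (W \<kappa>) = 0"
    then have ae: "AE t in lborel. W \<kappa> t = 0"
      using integral_nonneg_eq_0_iff_AE[OF int] by simp
    have "{t. 0 \<le> t \<and> t \<le> \<kappa> \<and> R t = 0} \<in> null_sets lborel"
      by (intro finite_imp_null_set_lborel finite_zeros)
    then have "AE t in lborel. t \<notin> {t. 0 \<le> t \<and> t \<le> \<kappa> \<and> R t = 0}"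
      by (rule AE_not_in)
    with ae have "AE t in lborel. t \<notin> {0<..<\<kappa>}"
      by eventually_elim (use \<kappa> in auto)
    then have "emeasure lborel {0<..<\<kappa>} = 0"
      by (subst (asm) AE_iff_measurable[of "{0<..<\<kappa>}"]) auto
    then show False using \<kappa> by simp
  qed
  moreover have "integral\<^sup>L lborel (W \<kappa>) \<ge> 0" by (intro integral_nonneg_AE AE_I2) auto
  ultimately show "0 < integral\<^sup>L lborel (W \<kappa>)" by (metis less_eq_real_def)
qed

text \<open>A majorant, up to a constant, of the integrand beyond \<open>A\<close>, where
  \<open>Q A\<close> no longer corrects the sign. It does not depend on \<open>A\<close>, so its
  cut-off integrals tend to 0.\<close>

definition tail :: "real \<Rightarrow> real \<Rightarrow> real \<Rightarrow> real" where
  "tail \<epsilon> \<theta> t = \<bar>R t\<bar> * exp (2 * pi * (\<epsilon> * sqrt \<bar>t\<bar>)) * exp (\<theta> * \<bar>t\<bar>)"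

abbreviation cut_tail :: "real \<Rightarrow> real \<Rightarrow> real \<Rightarrow> real \<Rightarrow> real" where
  "cut_tail A \<epsilon> \<theta> t \<equiv> indicator {t. \<bar>t\<bar> \<ge> A} t * tail \<epsilon> \<theta> t"

text \<open>The symmetrised kernel. \<open>R\<close> and \<open>\<psi> \<theta>\<close> both have
  parity \<open>\<sigma>\<close>, hence the integrand against \<open>Q A\<close> is even and a
  constant sign on the positive axis suffices.\<close>

abbreviation \<psi> :: "real \<Rightarrow> real \<Rightarrow> real" where
  "\<psi> \<theta> t \<equiv> exp (t * \<theta>) + \<sigma> * exp (- t * \<theta>)"

lemma tail_integrable:
  assumes "0 \<le> \<theta>" "\<theta> < pi / 2" "\<epsilon> > 0"
  shows "integrable lborel (tail \<epsilon> \<theta>)"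
proof -
  define r where "r = (pi / 2 - \<theta>) / 2"
  have r: "r > 0" "0 \<le> \<theta> + r" "\<theta> + r < pi / 2" using assms by (auto simp: r_def field_simps)
  define a where "a = 2 * pi * \<epsilon>"
  \<comment> \<open>Completing the square: the growth in \<open>sqrt \<bar>t\<bar>\<close> is
    absorbed by an arbitrarily small linear exponent, and half of the available room
    \<open>pi / 2 - \<theta>\<close> is spent on it.\<close>
  have le: "a * sqrt \<bar>t\<bar> \<le> a\<^sup>2 / (4 * r) + r * \<bar>t\<bar>" for t
  proof -
    have "0 \<le> (a - 2 * r * sqrt \<bar>t\<bar>)\<^sup>2" by simp
    also have "\<dots> = a\<^sup>2 - 4 * r * (a * sqrt \<bar>t\<bar>) + 4 * r\<^sup>2 * \<bar>t\<bar>"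
      by (simp add: power2_diff power_mult_distrib)
    finally have "a * sqrt \<bar>t\<bar> \<le> (a\<^sup>2 + 4 * r\<^sup>2 * \<bar>t\<bar>) / (4 * r)"
      using r by (simp add: pos_le_divide_eq mult_ac)
    also have "\<dots> = a\<^sup>2 / (4 * r) + r * \<bar>t\<bar>"
      using r by (simp add: add_divide_distrib power2_eq_square)
    finally show ?thesis .
  qed
  show ?thesis
  proof (rule Bochner_Integration.integrable_bound[OF integrable_mult_right[OF R_exp_integrable[OF r(2,3)], of "exp (a\<^sup>2 / (4 * r))"]])
    show "tail \<epsilon> \<theta> \<in> borel_measurable lborel" unfolding tail_def by measurable
    show "AE t in lborel. norm (tail \<epsilon> \<theta> t) \<le> norm (exp (a\<^sup>2 / (4 * r)) * (\<bar>R t\<bar> * exp ((\<theta> + r) * \<bar>t\<bar>)))"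
    proof (rule AE_I2)
      fix t
      have "tail \<epsilon> \<theta> t = \<bar>R t\<bar> * exp (a * sqrt \<bar>t\<bar> + \<theta> * \<bar>t\<bar>)"
        by (simp add: tail_def a_def exp_add mult_ac)
      also have "\<dots> \<le> \<bar>R t\<bar> * exp (a\<^sup>2 / (4 * r) + (\<theta> + r) * \<bar>t\<bar>)"
        using le[of t] by (intro mult_left_mono) (auto simp: algebra_simps)
      finally show "norm (tail \<epsilon> \<theta> t) \<le> norm (exp (a\<^sup>2 / (4 * r)) * (\<bar>R t\<bar> * exp ((\<theta> + r) * \<bar>t\<bar>)))"
        by (simp add: exp_add mult_ac tail_def abs_mult)
    qed
  qed
qed

text \<open>For \<open>0 < t < A\<close> the sign is constant and \<open>\<theta> \<ge> 1\<close>
  gives \<open>\<psi> \<theta> t \<ge> exp t - exp (- t)\<close> for either value of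
  \<open>\<sigma>\<close>. For \<open>t \<ge> A\<close> only absolute values are available, whence
  the subtracted tail. Negative \<open>t\<close> follow by evenness.\<close>

lemma R_P_lower_pointwise:
  assumes \<theta>: "1 \<le> \<theta>" and \<kappa>: "0 < \<kappa>" "\<kappa> < A" and s: "s = 1 \<or> s = -1"
    and sign: "\<And>t. 0 < t \<Longrightarrow> t < A \<Longrightarrow> s * (R t * Q A t) \<ge> 0"
    and half: "\<And>t. \<bar>t\<bar> \<le> \<kappa> \<Longrightarrow> Q A t \<ge> 1 / 2"
    and upper: "\<And>t. \<bar>Q A t\<bar> \<le> C * exp (2 * pi * (\<epsilon> * sqrt \<bar>t\<bar>))"
    and t: "t \<noteq> 0"
  shows "W \<kappa> t / 2 - 2 * C * cut_tail A \<epsilon> \<theta> t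
      \<le> s * (R t * Q A t * \<psi> \<theta> t)"
proof -
  have pos: "W \<kappa> t / 2 - 2 * C * cut_tail A \<epsilon> \<theta> t
      \<le> s * (R t * Q A t * \<psi> \<theta> t)" if t: "t > 0" for t
  proof (cases "t < A")
    case True
    have psi: "\<psi> \<theta> t \<ge> exp t - exp (- t)"
    proof -
      have "t * 1 \<le> t * \<theta>" using \<theta> t by (intro mult_left_mono) auto
      then have "exp t \<le> exp (t * \<theta>)" "exp (- t * \<theta>) \<le> exp (- t)" by auto
      moreover have "\<sigma> * exp (- t * \<theta>) \<ge> - exp (- t * \<theta>)" using \<sigma> by auto
      ultimately show ?thesis by linarith
    qed
    have e: "exp t - exp (- t) \<ge> 0" using t by simp
    have sg: "s * (R t * Q A t) \<ge> 0" using sign t True by blast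
    then have eq: "s * (R t * Q A t) = \<bar>R t\<bar> * \<bar>Q A t\<bar>"
      using s by (auto simp: abs_mult[symmetric])
    have "W \<kappa> t / 2 \<le> \<bar>R t\<bar> * \<bar>Q A t\<bar> * (exp t - exp (- t))"
    proof (cases "t \<le> \<kappa>")
      case True
      then have "1 / 2 \<le> \<bar>Q A t\<bar>" using half[of t] t by auto
      then have "\<bar>R t\<bar> * (exp t - exp (- t)) * (1 / 2) \<le> \<bar>R t\<bar> * (exp t - exp (- t)) * \<bar>Q A t\<bar>"
        using e by (intro mult_left_mono) auto
      then show ?thesis using True t e by (simp add: mult_ac)
    qed (use e in auto)
    also have "\<dots> \<le> \<bar>R t\<bar> * \<bar>Q A t\<bar> * \<psi> \<theta> t"
      using psi by (intro mult_left_mono) auto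
    also have "\<dots> = s * (R t * Q A t * \<psi> \<theta> t)"
      using eq by (simp only: mult.assoc[symmetric])
    finally show ?thesis using True t by simp
  next
    case False
    have psi: "\<bar>\<psi> \<theta> t\<bar> \<le> 2 * exp (\<theta> * \<bar>t\<bar>)"
    proof -
      have "exp (- t * \<theta>) \<le> exp (t * \<theta>)" using t \<theta> by simp
      moreover have "\<bar>\<sigma> * exp (- t * \<theta>)\<bar> = exp (- t * \<theta>)" using \<sigma> by auto
      moreover have "\<bar>\<psi> \<theta> t\<bar> \<le> \<bar>exp (t * \<theta>)\<bar> + \<bar>\<sigma> * exp (- t * \<theta>)\<bar>"
        by (rule abs_triangle_ineq)
      ultimately have "\<bar>\<psi> \<theta> t\<bar> \<le> 2 * exp (t * \<theta>)"
        unfolding abs_exp_cancel by linarith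
      then show ?thesis using t by (simp add: mult.commute)
    qed
    have "\<bar>s * (R t * Q A t * \<psi> \<theta> t)\<bar> =
        \<bar>R t\<bar> * \<bar>Q A t\<bar> * \<bar>\<psi> \<theta> t\<bar>"
      using s by (auto simp: abs_mult)
    also have "\<dots> \<le> \<bar>R t\<bar> * (C * exp (2 * pi * (\<epsilon> * sqrt \<bar>t\<bar>))) * (2 * exp (\<theta> * \<bar>t\<bar>))"
      by (intro mult_mono upper psi order_refl mult_left_mono) (auto intro!: mult_nonneg_nonneg order_trans[OF abs_ge_zero upper])
    also have "\<dots> = 2 * C * tail \<epsilon> \<theta> t" by (simp add: tail_def)
    finally have "- (2 * C * tail \<epsilon> \<theta> t) \<le> s * (R t * Q A t * \<psi> \<theta> t)"
      by (simp only: abs_le_iff) linarith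
    then show ?thesis using False \<kappa> t by simp
  qed
  show ?thesis
  proof (cases "t > 0")
    case False
    with t have "- t > 0" by simp
    from pos[OF this] have "W \<kappa> t / 2 - 2 * C * cut_tail A \<epsilon> \<theta> t
      \<le> s * (R (- t) * Q A t * (exp (- t * \<theta>) + \<sigma> * exp (t * \<theta>)))"
    proof -
      have "\<bar>R (- t)\<bar> = \<bar>R t\<bar>" using R_parity[of t] \<sigma> by auto
      moreover have "\<bar>exp (- t) - exp t\<bar> = \<bar>exp t - exp (- t)\<bar>" by (rule abs_minus_commute)
      moreover have "indicator {-\<kappa>..\<kappa>} (- t) = (indicator {-\<kappa>..\<kappa>} t :: real)"
        by (auto simp: indicator_def)
      ultimately show ?thesis using pos[OF \<open>- t > 0\<close>] by (simp add: tail_def indicator_def)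
    qed
    also have "R (- t) * Q A t * (exp (- t * \<theta>) + \<sigma> * exp (t * \<theta>)) =
        R t * Q A t * \<psi> \<theta> t"
      using \<sigma> by (auto simp: R_parity algebra_simps)
    finally show ?thesis .
  qed (use pos in auto)
qed

lemma R_P_lower_integral:
  assumes \<theta>: "1 \<le> \<theta>" "\<theta> < pi / 2" and \<kappa>: "0 < \<kappa>" "\<kappa> < A" and \<epsilon>: "\<epsilon> > 0"
    and half: "\<And>t. \<bar>t\<bar> \<le> \<kappa> \<Longrightarrow> Q A t \<ge> 1 / 2"
    and upper: "\<And>t. \<bar>Q A t\<bar> \<le> C * exp (2 * pi * (\<epsilon> * sqrt \<bar>t\<bar>))"
    and int: "integrable lborel (\<lambda>t. R t * Q A t * exp (t * \<theta>))"
  shows "(LBINT t. W \<kappa> t) / 2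
       - 2 * C * (LBINT t. cut_tail A \<epsilon> \<theta> t)
      \<le> 2 * \<bar>LBINT t. R t * Q A t * exp (t * \<theta>)\<bar>"
proof -
  let ?I = "LBINT t. R t * Q A t * exp (t * \<theta>)"
  obtain s where "s \<in> {1, -1}" and sign: "\<And>t. 0 < t \<Longrightarrow> t < A \<Longrightarrow> s * (R t * Q A t) \<ge> 0"
    using R_P_constant_sign[of A] by blast
  then have s: "s = 1 \<or> s = -1" by auto
  have neg_eq: "R t * Q A t * exp (- t * \<theta>) = \<sigma> * (R (- t) * Q A (- t) * exp (- t * \<theta>))" for t
    using \<sigma> by (auto simp: R_parity)
  have int': "integrable lborel (\<lambda>t. R t * Q A t * exp (- t * \<theta>))"
    unfolding neg_eq using lborel_integrable_real_affine[OF int, of "-1" 0]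
    by (intro integrable_mult_right) simp
  \<comment> \<open>Reflection contributes \<open>\<sigma>\<close>, and \<open>\<psi>\<close>
    contributes a second \<open>\<sigma>\<close>, so the symmetrised integral is twice the original
    one.\<close>
  have I': "(LBINT t. R t * Q A t * exp (- t * \<theta>)) = \<sigma> * ?I"
    unfolding neg_eq integral_mult_right_zero
    by (subst lborel_integral_real_affine[of "-1" "\<lambda>t. R t * Q A t * exp (t * \<theta>)" 0]) auto
  have ti: "integrable lborel (\<lambda>t. cut_tail A \<epsilon> \<theta> t)"
    using integrable_mult_indicator[OF _ tail_integrable[of \<theta> \<epsilon>], of "{t. \<bar>t\<bar> \<ge> A}"] \<theta> \<epsilon> by simp
  note gi = R_sinh_integral_pos(2)[OF \<kappa>(1)]
  have "(LBINT t. W \<kappa> t) / 2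
       - 2 * C * (LBINT t. cut_tail A \<epsilon> \<theta> t) =
      (LBINT t. W \<kappa> t / 2 - 2 * C * cut_tail A \<epsilon> \<theta> t)"
    using gi ti by (subst Bochner_Integration.integral_diff) auto
  also have "\<dots> \<le> (LBINT t. s * (R t * Q A t * exp (t * \<theta>) + \<sigma> * (R t * Q A t * exp (- t * \<theta>))))"
  proof (rule integral_mono_AE)
    show "AE t in lborel. W \<kappa> t / 2 - 2 * C * cut_tail A \<epsilon> \<theta> t
      \<le> s * (R t * Q A t * exp (t * \<theta>) + \<sigma> * (R t * Q A t * exp (- t * \<theta>)))"
      using AE_lborel_singleton[of 0]
    proof eventually_elim
      case (elim t)
      from R_P_lower_pointwise[OF \<theta>(1) \<kappa> s sign half upper elim]
      show ?case by (simp add: algebra_simps)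
    qed
  qed (use gi ti int int' in auto)
  also have "\<dots> = s * (?I + \<sigma> * (\<sigma> * ?I))"
    using int int' I' by simp
  also have "\<dots> \<le> 2 * \<bar>?I\<bar>" using s \<sigma> by auto
  finally show ?thesis .
qed

text \<open>At fixed \<open>\<delta>\<close> the tail vanishes as \<open>A\<close> tends to
  infinity, leaving a positive constant bounded by a multiple of
  \<open>exp (- (c / 2) / \<delta>)\<close>. Letting \<open>\<delta>\<close> tend to 0 is then
  contradictory.\<close>

theorem odd_zeros_not_sparse:
  assumes c: "c > 0" "\<delta>\<^sub>0 > 0"
    and cusp: "\<And>\<delta> w. 0 < \<delta> \<Longrightarrow> \<delta> \<le> \<delta>\<^sub>0 \<Longrightarrow> norm (w - of_real (pi / 2 - \<delta>)) = \<delta> / 2 \<Longrightarrow>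
        norm (h (\<i> * w)) \<le> B * exp (- (c / \<delta>))"
  shows "\<exists>\<epsilon>>0. \<not> (\<exists>T. \<forall>A\<ge>T. real (card (Z A)) \<le> \<epsilon> * sqrt A)"
proof (intro exI conjI notI)
  \<comment> \<open>With \<open>\<rho> = \<delta> / 2\<close> the growth exponent
    \<open>4 * exp pi * \<epsilon>\<^sup>2 / \<rho>\<close> becomes
    \<open>c / (2 * \<delta>)\<close>, exactly half of the decay exponent at the cusp.\<close>
  define \<epsilon> where "\<epsilon> = sqrt (c / (16 * exp pi))"
  show \<epsilon>: "\<epsilon> > 0" using c by (simp add: \<epsilon>_def)
  have \<epsilon>2: "\<epsilon>\<^sup>2 = c / (16 * exp pi)" using c by (simp add: \<epsilon>_def)
  assume "\<exists>T. \<forall>A\<ge>T. real (card (Z A)) \<le> sqrt (c / (16 * exp pi)) * sqrt A"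
  then obtain T' where T': "\<And>A. A \<ge> T' \<Longrightarrow> real (card (Z A)) \<le> \<epsilon> * sqrt A" by (auto simp: \<epsilon>_def)
  define T where "T = max T' 1"
  obtain C where C: "\<And>A y. A > T \<Longrightarrow> y \<ge> 0 \<Longrightarrow> (\<Prod>\<tau>\<in>Z A. 1 + y ^ 4 / \<tau>\<^sup>2) \<le> C * exp (2 * pi * (\<epsilon> * y))"
  proof (rule P_upper[OF \<epsilon>])
    show "real (card (Z A)) \<le> \<epsilon> * sqrt A" if "A \<ge> T" for A using T'[of A] that by (simp add: T_def)
    show "T > 0" by (simp add: T_def)
  qed blast
  define S where "S = C * exp (2 * pi * \<epsilon>)"
  have S: "(\<Sum>\<tau>\<in>Z A. 1 / \<tau>\<^sup>2) \<le> S" if "A > T" for A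
    using sum_le_prod_one_plus[of "Z A" "\<lambda>\<tau>. 1 / \<tau>\<^sup>2"] C[OF that, of 1] by (simp add: S_def)
  \<comment> \<open>Chosen so that \<open>t\<^sup>2 * S \<le> 1 / 2\<close> on the interval, which
    keeps \<open>Q A\<close> above 1/2 there for every \<open>A > T\<close>. The maximum with 1
    keeps the denominator positive.\<close>
  define \<kappa> where "\<kappa> = 1 / sqrt (2 * max S 1)"
  have \<kappa>: "\<kappa> > 0" by (simp add: \<kappa>_def)
  have half: "Q A t \<ge> 1 / 2" if A: "A > T" and t: "\<bar>t\<bar> \<le> \<kappa>" for A t
  proof -
    have "\<bar>t\<bar>\<^sup>2 \<le> \<kappa>\<^sup>2" using t by (intro power_mono) auto
    then have "t\<^sup>2 \<le> \<kappa>\<^sup>2" by simp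
    also have "\<dots> = 1 / (2 * max S 1)" by (simp add: \<kappa>_def power_divide)
    finally have t2: "t\<^sup>2 * max S 1 \<le> 1 / 2" by (simp add: field_simps)
    have "t\<^sup>2 * (\<Sum>\<tau>\<in>Z A. 1 / \<tau>\<^sup>2) \<le> t\<^sup>2 * max S 1" using S[OF A] by (intro mult_left_mono) auto
    with t2 have sum: "(\<Sum>\<tau>\<in>Z A. t\<^sup>2 / \<tau>\<^sup>2) \<le> 1 / 2" by (simp add: sum_distrib_left)
    have "1 - (\<Sum>\<tau>\<in>Z A. t\<^sup>2 / \<tau>\<^sup>2) \<le> (\<Prod>\<tau>\<in>Z A. 1 - t\<^sup>2 / \<tau>\<^sup>2)"
    proof (rule one_minus_sum_le_prod)
      fix \<tau> assume "\<tau> \<in> Z A"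
      then have "t\<^sup>2 / \<tau>\<^sup>2 \<le> (\<Sum>\<tau>\<in>Z A. t\<^sup>2 / \<tau>\<^sup>2)"
        by (intro member_le_sum finite_Z) auto
      with sum show "0 \<le> t\<^sup>2 / \<tau>\<^sup>2 \<and> t\<^sup>2 / \<tau>\<^sup>2 \<le> 1" by auto
    qed
    with sum show ?thesis by (simp add: poly_P)
  qed
  have upper: "\<bar>Q A t\<bar> \<le> C * exp (2 * pi * (\<epsilon> * sqrt \<bar>t\<bar>))" if A: "A > T" for A t
  proof -
    have "\<bar>Q A t\<bar> = (\<Prod>\<tau>\<in>Z A. \<bar>1 - t\<^sup>2 / \<tau>\<^sup>2\<bar>)" by (simp add: poly_P abs_prod)
    also have "\<dots> \<le> (\<Prod>\<tau>\<in>Z A. 1 + sqrt \<bar>t\<bar> ^ 4 / \<tau>\<^sup>2)"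
    proof (intro prod_mono conjI)
      fix \<tau> :: real
      have "sqrt \<bar>t\<bar> ^ 4 = ((sqrt \<bar>t\<bar>)\<^sup>2)\<^sup>2" by (simp only: power_mult[symmetric]) simp
      also have "(sqrt \<bar>t\<bar>)\<^sup>2 = \<bar>t\<bar>" by simp
      finally have "sqrt \<bar>t\<bar> ^ 4 = t\<^sup>2" by simp
      then show "\<bar>1 - t\<^sup>2 / \<tau>\<^sup>2\<bar> \<le> 1 + sqrt \<bar>t\<bar> ^ 4 / \<tau>\<^sup>2"
        using abs_triangle_ineq4[of 1 "t\<^sup>2 / \<tau>\<^sup>2"] by simp
    qed auto
    also have "\<dots> \<le> C * exp (2 * pi * (\<epsilon> * sqrt \<bar>t\<bar>))" by (intro C A) auto
    finally show ?thesis .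
  qed
  let ?b = "\<lambda>\<delta>. 2 * (C * (2 * pi * B) * exp (- (c / 2) / \<delta>) / norm \<eta>)"
  let ?K = "LBINT t. W \<kappa> t"
  have K: "?K > 0" by (rule R_sinh_integral_pos(1)[OF \<kappa>])
  \<comment> \<open>The condition \<open>\<delta> \<le> 1 / 2\<close> ensures
    \<open>\<theta> = pi / 2 - \<delta> \<ge> 1\<close>, as \<open>pi > 3\<close>.\<close>
  have bound: "?K / 2 \<le> ?b \<delta>"
    if \<delta>: "0 < \<delta>" "\<delta> \<le> \<delta>\<^sub>0" "\<delta> \<le> 1 / 2" for \<delta>
  proof -
    define \<theta> where "\<theta> = pi / 2 - \<delta>"
    have \<theta>: "1 \<le> \<theta>" "\<theta> < pi / 2" "\<bar>\<theta>\<bar> + \<delta> / 2 < pi / 2"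
      using \<delta> pi_gt3 by (auto simp: \<theta>_def)
    have "?K / 2 - 2 * C * (LBINT t. cut_tail A \<epsilon> \<theta> t) \<le>
        ?b \<delta>" if A: "A > T" "A > \<kappa>" for A
    proof -
      have h\<theta>: "norm (h (\<i> * w)) \<le> B * exp (- (c / \<delta>))" if "norm (w - of_real \<theta>) = \<delta> / 2" for w
        using cusp[OF \<delta>(1,2), of w] that by (simp add: \<theta>_def)
      note b = R_P_integral_bound[OF \<theta>(3) _ h\<theta> \<epsilon> C[OF A(1)]]
      have d2: "0 < \<delta> / 2" using \<delta> by simp
      have "?K / 2 - 2 * C * (LBINT t. cut_tail A \<epsilon> \<theta> t) \<le> 2 * \<bar>LBINT t. R t * Q A t * exp (t * \<theta>)\<bar>"
        by (rule R_P_lower_integral[OF \<theta>(1,2) \<kappa> A(2) \<epsilon> half[OF A(1)] upper[OF A(1)] b(1)[OF d2]])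
      also have "\<bar>LBINT t. R t * Q A t * exp (t * \<theta>)\<bar> \<le> C * (2 * pi * (B * exp (- (c / \<delta>)))) * exp (4 * exp pi * \<epsilon>\<^sup>2 / (\<delta> / 2)) / norm \<eta>"
        using b(2)[OF d2] \<eta>_nonzero by (simp add: field_simps)
      also have "C * (2 * pi * (B * exp (- (c / \<delta>)))) * exp (4 * exp pi * \<epsilon>\<^sup>2 / (\<delta> / 2)) = C * (2 * pi * B) * (exp (- (c / \<delta>)) * exp (c / 2 / \<delta>))"
        using \<delta> by (simp add: \<epsilon>2)
      also have "exp (- (c / \<delta>)) * exp (c / 2 / \<delta>) = exp (- (c / 2) / \<delta>)"
        using \<delta> by (simp add: exp_add[symmetric] field_simps)
      finally show ?thesis by simp
    qed
    then have ev: "eventually (\<lambda>n. ?K / 2 - 2 * C * (LBINT t. cut_tail (real n) \<epsilon> \<theta> t) \<le>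
        ?b \<delta>) sequentially"
      using eventually_gt_at_top[of "max T \<kappa>"]
      by (intro eventually_compose_filterlim[OF _ filterlim_real_sequentially, of "\<lambda>A. ?K / 2 - 2 * C * (LBINT t. cut_tail A \<epsilon> \<theta> t) \<le>
        ?b \<delta>"]) (auto elim!: eventually_mono)
    have tin: "integrable lborel (tail \<epsilon> \<theta>)" using \<theta> \<epsilon> by (intro tail_integrable) auto
    \<comment> \<open>The limit in the truncation height \<open>A = n\<close>;
      \<open>\<delta>\<close> stays fixed, so \<open>tail\<close> is integrable and
      dominates.\<close>
    have "(\<lambda>n. LBINT t. cut_tail (real n) \<epsilon> \<theta> t) \<longlonglongrightarrow> (LBINT t::real. 0)"
    proof (rule integral_dominated_convergence[where w = "\<lambda>t. norm (tail \<epsilon> \<theta> t)"])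
      show "AE t in lborel. (\<lambda>n. cut_tail (real n) \<epsilon> \<theta> t) \<longlonglongrightarrow> 0"
      proof (rule AE_I2)
        fix t :: real
        have "eventually (\<lambda>n. real n > \<bar>t\<bar>) sequentially"
          using eventually_gt_at_top[of "\<bar>t\<bar>"] filterlim_real_sequentially by (rule eventually_compose_filterlim)
        then have "eventually (\<lambda>n. cut_tail (real n) \<epsilon> \<theta> t = 0) sequentially"
          by eventually_elim (auto simp: indicator_def)
        then show "(\<lambda>n. cut_tail (real n) \<epsilon> \<theta> t) \<longlonglongrightarrow> 0"
          by (rule tendsto_eventually)
      qed
    qed (use tin in \<open>auto simp: indicator_def\<close>)
    then have "(\<lambda>n. ?K / 2 - 2 * C * (LBINT t. cut_tail (real n) \<epsilon> \<theta> t)) \<longlonglongrightarrow> ?K / 2 - 2 * C * 0"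
      by (intro tendsto_intros) simp
    from tendsto_upperbound[OF this ev] show ?thesis by simp
  qed
  have "(?b \<longlongrightarrow> 0) (at_right 0)"
    using c \<eta>_nonzero by real_asymp
  moreover have "eventually (\<lambda>\<delta>. ?K / 2 \<le> ?b \<delta>) (at_right 0)"
  proof -
    have "eventually (\<lambda>\<delta>. \<delta> \<in> {0<..<min \<delta>\<^sub>0 (1 / 2)}) (at_right 0)"
      using c by (intro eventually_at_right_real) auto
    then show ?thesis by eventually_elim (rule bound, auto)
  qed
  ultimately have "?K / 2 \<le> 0" by (intro tendsto_lowerbound) auto
  with K show False by simp
qed

end

section \<open>Growth of cusp forms\<close>

lemma jacobi_symbol_sq:
  assumes "coprime c d" "d \<noteq> 0"
  shows "(jacobi_symbol c d)\<^sup>2 = 1"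
proof -
  have "(Legendre c p ^ multiplicity p d)\<^sup>2 = 1" if p: "p \<in> prime_factors d" for p
  proof -
    have "\<not> p dvd c"
      using p assms(1) by (metis coprime_common_divisor in_prime_factors_iff not_prime_unit)
    then have "Legendre c p = 1 \<or> Legendre c p = -1"
      by (auto simp: Legendre_def cong_0_iff)
    then have "(Legendre c p)\<^sup>2 = 1" by auto
    then show ?thesis by (metis power_mult mult.commute power_one)
  qed
  then show ?thesis by (simp add: jacobi_symbol_def prod_power_distrib)
qed

lemma shimura_symbol_power_8:
  assumes "a * d - b * c = 1" "c \<noteq> 0 \<or> d \<noteq> 0"
  shows "(shimura_symbol c d ^ n) ^ 8 = 1"
proof (cases "d = 0")
  \<comment> \<open>By convention 0 has no prime factors, so the empty product makes the symbol
    equal to 1.\<close>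
  case True
  then show ?thesis by (simp add: shimura_symbol_def jacobi_symbol_def)
next
  case False
  have "coprime c d"
    using assms(1) by (intro coprimeI) (metis dvd_diff dvd_mult)
  then have "(jacobi_symbol c \<bar>d\<bar>)\<^sup>2 = 1" using False by (intro jacobi_symbol_sq) auto
  moreover have "(if P then - x else x)\<^sup>2 = 1" if "x\<^sup>2 = 1" for P and x :: int
    using that by simp
  ultimately have "(shimura_symbol c d)\<^sup>2 = 1" unfolding shimura_symbol_def by blast
  then have "((shimura_symbol c d)\<^sup>2) ^ (4 * n) = 1" by simp
  then show ?thesis by (simp only: power_mult[symmetric]) (simp add: mult.commute)
qed

lemma theta_eps_power_8: "(theta_eps d powi n) ^ 8 = 1"
proof -
  have "theta_eps d ^ 8 = 1" by (simp add: theta_eps_def power_numeral_reduce)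
  then have "(theta_eps d ^ 8) powi n = 1" by simp
  then show ?thesis by (simp add: power_int_power power_int_power' mult.commute flip: power_int_mult)
qed

lemma half_power_nat: "half_power z (int k) = csqrt z ^ (2 * k + 1)"
proof -
  have "2 * int k + 1 = int (2 * k + 1)" by simp
  then show ?thesis by (simp only: half_power_def power_int_of_nat)
qed

lemma half_power_power_8: "half_power z (int k) ^ 8 = z ^ (8 * k + 4)"
proof -
  have "half_power z (int k) ^ 8 = (csqrt z ^ (2 * k + 1)) ^ 8" by (simp only: half_power_nat)
  also have "\<dots> = (csqrt z ^ 2) ^ (8 * k + 4)"
  proof -
    have "(2 * k + 1) * 8 = 2 * (8 * k + 4)" by simp
    then show ?thesis by (simp only: power_mult[symmetric])
  qed
  finally show ?thesis by simp
qed

lemma half_power_neg: "half_power z (- int k - 1) = inverse (half_power z (int k))"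
proof -
  have "2 * (- int k - 1) + 1 = - (2 * int k + 1)" by simp
  then show ?thesis unfolding half_power_def by (simp only: power_int_minus)
qed

lemma Im_moebius:
  fixes a b c d :: int and z :: complex
  assumes "a * d - b * c = 1"
  shows "Im ((of_int a * z + of_int b) / (of_int c * z + of_int d)) = Im z / (norm (of_int c * z + of_int d))\<^sup>2"
proof -
  have "of_int a * Im z * (of_int c * Re z + of_int d) - (of_int a * Re z + of_int b) * (of_int c * Im z) = of_int (a * d - b * c) * Im z"
    by (simp add: algebra_simps)
  then show ?thesis using assms by (simp add: Im_divide cmod_power2)
qed

lemma moebius_denominator_nonzero:
  fixes a b c d :: int
  assumes "a * d - b * c = 1" "Im z > 0"
  shows "of_int c * z + of_int d \<noteq> 0"
proof
  assume *: "of_int c * z + of_int d = 0"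
  from arg_cong[OF this, of Im] assms have "c = 0" by simp
  with * assms(1) show False by auto
qed

lemma moebius_upper_half_plane:
  fixes a b c d :: int
  assumes "a * d - b * c = 1" "Im z > 0"
  shows "Im ((of_int a * z + of_int b) / (of_int c * z + of_int d)) > 0"
  using moebius_denominator_nonzero[OF assms] assms(2) by (simp add: Im_moebius[OF assms(1)])

lemma open_upper_half_plane: "open upper_half_plane"
  unfolding upper_half_plane_def by (rule open_halfspace_Im_gt)

lemma Im_log_quotient: "q \<noteq> 0 \<Longrightarrow> Im (Ln q / (2 * of_real pi * \<i>)) = - ln (norm q) / (2 * pi)"
  by (simp add: Im_divide Re_Ln power2_eq_square)

text \<open>The function descends to the punctured disc along \<open>q = exp (2 \<pi> i z)\<close>, where it extends over
  \<open>0\<close> with value \<open>0\<close>.\<close>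
lemma periodic_vanishing_decay:
  fixes g :: "complex \<Rightarrow> complex"
  assumes hol: "g holomorphic_on upper_half_plane"
    and per: "\<And>z. Im z > 0 \<Longrightarrow> g (z + 1) = g z"
    and lim: "(g \<longlongrightarrow> 0) (filtercomap Im at_top)"
    and y0: "y0 > 0"
  shows "\<exists>C. \<forall>z. Im z \<ge> y0 \<longrightarrow> norm (g z) \<le> C * exp (- 2 * pi * Im z)"
proof -
  define \<phi> where "\<phi> = (\<lambda>q. if q = 0 then 0 else g (Ln q / (2 * of_real pi * \<i>)))"
  have per_nat: "g (z + of_nat n) = g z" if "Im z > 0" for z n
  proof (induction n)
    case (Suc n)
    have "g (z + of_nat (Suc n)) = g (z + of_nat n + 1)" by (simp add: add_ac)
    also have "\<dots> = g (z + of_nat n)" using that by (intro per) auto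
    finally show ?case using Suc by simp
  qed auto
  have per_int: "g (z + of_int n) = g z" if "Im z > 0" for z n
  proof (cases "n \<ge> 0")
    case True
    then show ?thesis using per_nat[OF that, of "nat n"] by simp
  next
    case False
    then show ?thesis using per_nat[of "z + of_int n" "nat (- n)"] that by simp
  qed
  have \<phi>_exp: "\<phi> (exp (2 * of_real pi * \<i> * z)) = g z" if "Im z > 0" for z
  proof -
    define w where "w = Ln (exp (2 * of_real pi * \<i> * z)) / (2 * of_real pi * \<i>)"
    have "exp (2 * of_real pi * \<i> * w) = exp (2 * of_real pi * \<i> * z)" by (simp add: w_def)
    then obtain n where n: "2 * of_real pi * \<i> * w = 2 * of_real pi * \<i> * z + complex_of_real (real_of_int (2 * n) * pi) * \<i>"
      unfolding exp_eq by blast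
    then have "(2 * of_real pi * \<i>) * w = (2 * of_real pi * \<i>) * (z + of_int n)" by (simp add: algebra_simps)
    then have "w = z + of_int n" by (simp only: mult_cancel_left) simp
    then show ?thesis using per_int[OF that] by (simp add: \<phi>_def w_def)
  qed
  have hol0: "\<phi> holomorphic_on ball 0 1 - {0}"
    unfolding holomorphic_on_def
  proof
    fix q :: complex assume q: "q \<in> ball 0 1 - {0}"
    \<comment> \<open>\<open>Ln (x / q) + Ln q\<close> is a logarithm of \<open>x\<close> that is
      holomorphic near \<open>q\<close> even if \<open>q\<close> lies on the branch cut of
      \<open>Ln\<close>.\<close>
    define p where "p = (\<lambda>x. (Ln (x / q) + Ln q) / (2 * of_real pi * \<i>))"
    have pe: "exp (2 * of_real pi * \<i> * p x) = x" if "x \<noteq> 0" for x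
      using q that by (simp add: p_def exp_add)
    have imp: "Im (p x) > 0" if "x \<in> ball 0 1 - {0}" for x
    proof -
      have "norm (exp (2 * of_real pi * \<i> * p x)) < 1" using pe that by simp
      then show ?thesis by (simp add: zero_less_mult_iff)
    qed
    have "p field_differentiable at q"
    proof -
      have "((\<lambda>x. x / q) has_field_derivative 1 / q) (at q)"
        by (rule DERIV_cdivide[OF DERIV_ident])
      moreover have "(Ln has_field_derivative 1 / (q / q)) (at (q / q))"
        using q has_field_derivative_Ln[of "q / q"] by (simp add: divide_inverse)
      ultimately have "((\<lambda>x. Ln (x / q)) has_field_derivative (1 / (q / q)) * (1 / q)) (at q)"
        by (rule DERIV_chain')
      then have "(\<lambda>x. Ln (x / q)) field_differentiable at q" by (auto simp: field_differentiable_def)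
      then show ?thesis unfolding p_def by (intro derivative_intros) auto
    qed
    moreover have "g field_differentiable at (p q)"
      by (rule holomorphic_on_imp_differentiable_at[OF hol open_upper_half_plane])
        (use imp[OF q] in \<open>simp add: upper_half_plane_def\<close>)
    ultimately have "(g \<circ> p) field_differentiable at q" by (rule field_differentiable_compose)
    then have "(g \<circ> p) field_differentiable (at q within (ball 0 1 - {0}))"
      by (rule field_differentiable_at_within)
    then show "\<phi> field_differentiable (at q within (ball 0 1 - {0}))"
    proof (rule field_differentiable_transform_within[of 1, rotated 3])
      fix x assume x: "x \<in> ball 0 1 - {0}" "dist x q < 1"
      show "(g \<circ> p) x = \<phi> x"
        using \<phi>_exp[OF imp[OF x(1)]] pe[of x] x by simp
    qed (use q in auto)
  qed
  have lim0: "(\<phi> \<longlongrightarrow> 0) (at 0)"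
  proof (rule tendstoI)
    fix e :: real assume e: "e > 0"
    have "eventually (\<lambda>z. dist (g z) 0 < e) (filtercomap Im at_top)" using lim e by (rule tendstoD)
    then obtain Y where Y: "\<And>z. Im z \<ge> Y \<Longrightarrow> dist (g z) 0 < e"
      by (auto simp: eventually_filtercomap_at_top_linorder)
    have "eventually (\<lambda>q::complex. q \<in> ball 0 (exp (- 2 * pi * Y)) - {0}) (at 0)"
      by (intro eventually_at_in_open) auto
    then show "eventually (\<lambda>q. dist (\<phi> q) 0 < e) (at 0)"
    proof eventually_elim
      case (elim q)
      then have "ln (norm q) < ln (exp (- 2 * pi * Y))" by (subst ln_less_cancel_iff) auto
      then have "Y * (2 * pi) \<le> - ln (norm q)" by (simp add: mult_ac)
      then have "Y \<le> - ln (norm q) / (2 * pi)" by (subst pos_le_divide_eq) auto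
      then have "Im (Ln q / (2 * of_real pi * \<i>)) \<ge> Y"
        using elim by (subst Im_log_quotient) auto
      from Y[OF this] show ?case using elim by (simp add: \<phi>_def)
    qed
  qed
  have cont: "continuous_on (ball 0 1) \<phi>"
    unfolding continuous_on_eq_continuous_at[OF open_ball]
  proof
    fix q :: complex assume q: "q \<in> ball 0 1"
    show "isCont \<phi> q"
    proof (cases "q = 0")
      case True
      then show ?thesis using lim0 by (simp add: isCont_def \<phi>_def)
    next
      case False
      then show ?thesis using q holomorphic_on_imp_continuous_on[OF hol0]
        by (simp add: continuous_on_eq_continuous_at open_delete)
    qed
  qed
  have "\<phi> holomorphic_on ball 0 1"
    using no_isolated_singularity[OF cont hol0] by auto
  then have "\<phi> field_differentiable at 0"
    by (simp add: holomorphic_on_imp_differentiable_at)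
  then obtain D where "(\<phi> has_field_derivative D) (at 0)" by (auto simp: field_differentiable_def)
  \<comment> \<open>Since \<open>\<phi>\<close> vanishes at 0, the derivative bounds it by a
    multiple of the modulus of \<open>q\<close>, which is
    \<open>exp (- 2 * pi * Im z)\<close>.\<close>
  then have "((\<lambda>q. \<phi> q / q) \<longlongrightarrow> D) (at 0)"
    by (simp add: has_field_derivative_iff \<phi>_def)
  then have "((\<lambda>q. norm (\<phi> q / q)) \<longlongrightarrow> norm D) (at 0)" by (rule tendsto_norm)
  then have "eventually (\<lambda>q. norm (\<phi> q / q) < norm D + 1) (at 0)" by (rule order_tendstoD(2)) simp
  then obtain r where r: "r > 0" "\<And>q. q \<noteq> 0 \<Longrightarrow> norm q < r \<Longrightarrow> norm (\<phi> q / q) < norm D + 1"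
    by (auto simp: eventually_at)
  \<comment> \<open>At this height and above, the modulus of \<open>q\<close> is at most
    \<open>r * exp (- 2 * pi)\<close>, hence below \<open>r\<close>.\<close>
  define Y where "Y = max y0 (1 - ln r / (2 * pi))"
  have high: "norm (g z) \<le> (norm D + 1) * exp (- 2 * pi * Im z)" if z: "Im z \<ge> Y" for z
  proof -
    define q where "q = exp (2 * of_real pi * \<i> * z)"
    have nq: "norm q = exp (- 2 * pi * Im z)" by (simp add: q_def)
    have "2 * pi * (1 - ln r / (2 * pi)) \<le> 2 * pi * Im z"
      using z by (intro mult_left_mono) (auto simp: Y_def)
    then have "2 * pi - ln r \<le> 2 * pi * Im z" by (simp add: right_diff_distrib)
    then have "exp (- 2 * pi * Im z) < exp (ln r)" using pi_gt_zero by (subst exp_less_cancel_iff) linarith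
    then have "norm q < r" using r(1) by (simp add: nq)
    then have "norm (\<phi> q / q) < norm D + 1" using r(2)[of q] by (simp add: q_def)
    moreover have "\<phi> q = g z" using \<phi>_exp[of z] z y0 by (simp add: q_def Y_def)
    ultimately have "norm (g z) / norm q < norm D + 1" by (simp add: norm_divide)
    then show ?thesis by (simp add: nq divide_less_eq)
  qed
  \<comment> \<open>Between heights \<open>y0\<close> and \<open>Y\<close>, periodicity reduces the
    claim to a compact rectangle, where any bound can be rewritten with the exponential
    factor.\<close>
  define K where "K = cbox (Complex 0 y0) (Complex 1 Y)"
  have "continuous_on K g"
    by (rule continuous_on_subset[OF holomorphic_on_imp_continuous_on[OF hol]])
      (use y0 in \<open>auto simp: K_def in_cbox_complex_iff upper_half_plane_def\<close>)
  then have "bounded (g ` K)" by (intro compact_imp_bounded compact_continuous_image) (auto simp: K_def)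
  then obtain B where B: "\<And>z. z \<in> K \<Longrightarrow> norm (g z) \<le> B" by (auto simp: bounded_iff)
  have B0: "B \<ge> 0"
    using order_trans[OF norm_ge_zero B[of "Complex 0 y0"]] by (simp add: K_def in_cbox_complex_iff Y_def)
  have low: "norm (g z) \<le> B * exp (2 * pi * Y) * exp (- 2 * pi * Im z)" if z: "Im z \<ge> y0" "Im z \<le> Y" for z
  proof -
    have "z - of_int \<lfloor>Re z\<rfloor> \<in> K" using z by (auto simp: K_def in_cbox_complex_iff) linarith
    then have "norm (g (z - of_int \<lfloor>Re z\<rfloor>)) \<le> B" by (rule B)
    moreover have "g (z - of_int \<lfloor>Re z\<rfloor>) = g z" using per_int[of z "- \<lfloor>Re z\<rfloor>"] z y0 by simp
    ultimately have "norm (g z) \<le> B * 1" by simp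
    also have "\<dots> \<le> B * (exp (2 * pi * Y) * exp (- 2 * pi * Im z))"
      using B0 z by (intro mult_left_mono) (auto simp: exp_add[symmetric])
    finally show ?thesis by simp
  qed
  have "norm (g z) \<le> (norm D + 1 + B * exp (2 * pi * Y)) * exp (- 2 * pi * Im z)" if z: "Im z \<ge> y0" for z
  proof (cases "Im z \<ge> Y")
    case True
    have "0 \<le> B * exp (2 * pi * Y) * exp (- 2 * pi * Im z)" using B0 by simp
    then show ?thesis using high[OF True] by (simp add: distrib_right)
  next
    case False
    have "0 \<le> (norm D + 1) * exp (- 2 * pi * Im z)" by simp
    then show ?thesis using low[OF z] False by (simp only: distrib_right) linarith
  qed
  then show ?thesis by blast
qed

section \<open>Transforms of the eighth power under the modular group\<close>

locale half_cusp_form =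
  fixes k m :: nat and f :: "complex \<Rightarrow> complex"
  assumes m: "m > 0" and f: "f \<in> half_cusp_forms k (4 * m\<^sup>2)"
begin

lemma f_holomorphic: "f holomorphic_on upper_half_plane"
  using f by (simp add: half_cusp_forms_def)

text \<open>The eighth power has integral weight and trivial multiplier.\<close>
definition F :: "complex \<Rightarrow> complex" where "F z = f z ^ 8"

lemma F_transform:
  fixes a b c d :: int
  assumes det: "a * d - b * c = 1" and c: "int (4 * m\<^sup>2) dvd c" and z: "Im z > 0"
  shows "F ((of_int a * z + of_int b) / (of_int c * z + of_int d)) = (of_int c * z + of_int d) ^ (8 * k + 4) * F z"
proof -
  have "f ((of_int a * z + of_int b) / (of_int c * z + of_int d)) =
                 of_int (shimura_symbol c d) ^ (2 * k + 1) *
                 theta_eps d powi (- 2 * int k - 1) *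
                 half_power (of_int c * z + of_int d) (int k) * f z"
    using f det c z by (auto simp: half_cusp_forms_def upper_half_plane_def)
  moreover have "(of_int (shimura_symbol c d) ^ (2 * k + 1)) ^ 8 = (1 :: complex)"
  proof -
    have "c \<noteq> 0 \<or> d \<noteq> 0" using det by auto
    from shimura_symbol_power_8[OF det this, of "2 * k + 1"] show ?thesis
      by (metis of_int_1 of_int_power)
  qed
  ultimately show ?thesis
    by (simp only: F_def power_mult_distrib theta_eps_power_8 half_power_power_8) simp
qed

text \<open>The slash action of the matrix on \<open>F\<close> in weight
  \<open>8 * k + 4\<close>.\<close>

definition G :: "int \<Rightarrow> int \<Rightarrow> int \<Rightarrow> int \<Rightarrow> complex \<Rightarrow> complex" where
  "G a b c d z = F ((of_int a * z + of_int b) / (of_int c * z + of_int d)) / (of_int c * z + of_int d) ^ (8 * k + 4)"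

lemma G_tendsto_0:
  assumes "a * d - b * c = 1"
  shows "(G a b c d \<longlongrightarrow> 0) (filtercomap Im at_top)"
proof -
  let ?j = "\<lambda>z. of_int c * z + of_int d"
  have "((\<lambda>z. (half_power (?j z) (- int k - 1) * f ((of_int a * z + of_int b) / ?j z)) ^ 8) \<longlongrightarrow> 0 ^ 8) (filtercomap Im at_top)"
    using f assms unfolding half_cusp_forms_def vanishes_at_cusps_def by (intro tendsto_power) blast
  moreover have "(half_power (?j z) (- int k - 1) * f ((of_int a * z + of_int b) / ?j z)) ^ 8 = G a b c d z" for z
    by (simp add: power_mult_distrib half_power_neg power_inverse half_power_power_8 G_def F_def field_simps)
  ultimately show ?thesis by simp
qed

lemma G_holomorphic:
  assumes "a * d - b * c = 1"
  shows "G a b c d holomorphic_on upper_half_plane"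
proof -
  have nz: "of_int c * z + of_int d \<noteq> 0" if "z \<in> upper_half_plane" for z
    using that moebius_denominator_nonzero[OF assms] by (auto simp: upper_half_plane_def)
  have "(\<lambda>z. f ((of_int a * z + of_int b) / (of_int c * z + of_int d))) holomorphic_on upper_half_plane"
    by (rule holomorphic_on_compose_gen[OF _ f_holomorphic, unfolded o_def])
      (use nz moebius_upper_half_plane[OF assms] in \<open>auto intro!: holomorphic_intros simp: upper_half_plane_def\<close>)
  then show ?thesis unfolding G_def F_def using nz by (intro holomorphic_intros) auto
qed

text \<open>The first matrix times the inverse of the second has lower left entry
  \<open>c * d' - d * c'\<close>. If the level divides it, the quotient leaves \<open>F\<close>
  invariant in its weight, and the two transforms agree.\<close>

lemma G_cong:
  fixes a b c d a' b' c' d' :: int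
  assumes det: "a * d - b * c = 1" "a' * d' - b' * c' = 1"
    and dv: "int (4 * m\<^sup>2) dvd c * d' - d * c'" and z: "Im z > 0"
  shows "G a b c d z = G a' b' c' d' z"
proof -
  define w where "w = (of_int a' * z + of_int b') / (of_int c' * z + of_int d')"
  have nz: "of_int c * z + of_int d \<noteq> 0" "of_int c' * z + of_int d' \<noteq> 0"
    using moebius_denominator_nonzero det z by auto
  have mult_add: "A * (X / Y) + B = (A * X + B * Y) / Y" if "Y \<noteq> 0" for A B X Y :: complex
    using that by (simp add: field_simps)
  have w: "Im w > 0" unfolding w_def by (rule moebius_upper_half_plane[OF det(2) z])
  have det': "complex_of_int a' * of_int d' - of_int b' * of_int c' = 1"
    using det(2) by (metis of_int_1 of_int_diff of_int_mult)
  have "(a * d' - b * c') * (d * a' - c * b') - (b * a' - a * b') * (c * d' - d * c') = (a * d - b * c) * (a' * d' - b' * c')"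
    by (simp add: algebra_simps)
  then have D: "(a * d' - b * c') * (d * a' - c * b') - (b * a' - a * b') * (c * d' - d * c') = 1"
    using det by simp
  have den: "of_int (c * d' - d * c') * w + of_int (d * a' - c * b') = (of_int c * z + of_int d) / (of_int c' * z + of_int d')"
  proof -
    have "of_int (c * d' - d * c') * (of_int a' * z + of_int b') + of_int (d * a' - c * b') * (of_int c' * z + of_int d')
        = (of_int c * z + of_int d) * (of_int a' * of_int d' - of_int b' * of_int c')"
      by (simp add: algebra_simps)
    moreover have "of_int (c * d' - d * c') * w + of_int (d * a' - c * b') =
        (of_int (c * d' - d * c') * (of_int a' * z + of_int b') + of_int (d * a' - c * b') * (of_int c' * z + of_int d')) / (of_int c' * z + of_int d')"
      unfolding w_def by (rule mult_add[OF nz(2)])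
    ultimately show ?thesis by (simp only: det' mult_1_right)
  qed
  have num: "of_int (a * d' - b * c') * w + of_int (b * a' - a * b') = (of_int a * z + of_int b) / (of_int c' * z + of_int d')"
  proof -
    have "of_int (a * d' - b * c') * (of_int a' * z + of_int b') + of_int (b * a' - a * b') * (of_int c' * z + of_int d')
        = (of_int a * z + of_int b) * (of_int a' * of_int d' - of_int b' * of_int c')"
      by (simp add: algebra_simps)
    moreover have "of_int (a * d' - b * c') * w + of_int (b * a' - a * b') =
        (of_int (a * d' - b * c') * (of_int a' * z + of_int b') + of_int (b * a' - a * b') * (of_int c' * z + of_int d')) / (of_int c' * z + of_int d')"
      unfolding w_def by (rule mult_add[OF nz(2)])
    ultimately show ?thesis by (simp only: det' mult_1_right)
  qed
  have "F ((of_int a * z + of_int b) / (of_int c * z + of_int d)) =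
      ((of_int c * z + of_int d) / (of_int c' * z + of_int d')) ^ (8 * k + 4) * F w"
    using F_transform[OF D dv w] nz unfolding den num by simp
  then show ?thesis using nz by (simp add: G_def w_def power_divide)
qed

lemma G_translate:
  "G a b c d (z + of_int n) = G a (b + a * n) c (d + c * n) z"
proof -
  have "of_int a * (z + of_int n) + of_int b = of_int a * z + of_int (b + a * n)"
    "of_int c * (z + of_int n) + of_int d = of_int c * z + of_int (d + c * n)"
    by (simp_all add: distrib_left)
  then show ?thesis by (simp only: G_def)
qed


lemma G_bounded_strip:
  fixes a b c d :: int
  assumes det: "a * d - b * c = 1" and y0: "y0 > 0"
  shows "\<exists>B. \<forall>z. Im z \<ge> y0 \<and> 0 \<le> Re z \<and> Re z \<le> 1 \<longrightarrow> norm (G a b c d z) \<le> B"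
proof -
  have "eventually (\<lambda>z. dist (G a b c d z) 0 < 1) (filtercomap Im at_top)"
    using G_tendsto_0[OF det] by (rule tendstoD) simp
  then obtain Y where Y: "\<And>z. Im z \<ge> Y \<Longrightarrow> norm (G a b c d z) < 1"
    by (auto simp: eventually_filtercomap_at_top_linorder)
  define K where "K = cbox (Complex 0 y0) (Complex 1 Y)"
  have "continuous_on K (G a b c d)"
    by (rule continuous_on_subset[OF holomorphic_on_imp_continuous_on[OF G_holomorphic[OF det]]])
      (use y0 in \<open>auto simp: K_def in_cbox_complex_iff upper_half_plane_def\<close>)
  then have "bounded (G a b c d ` K)" by (intro compact_imp_bounded compact_continuous_image) (auto simp: K_def)
  then obtain B where B: "\<And>z. z \<in> K \<Longrightarrow> norm (G a b c d z) \<le> B" by (auto simp: bounded_iff)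
  have "norm (G a b c d z) \<le> max B 1" if "Im z \<ge> y0 \<and> 0 \<le> Re z \<and> Re z \<le> 1" for z
  proof (cases "Im z \<ge> Y")
    case True
    then show ?thesis using Y[of z] by simp
  next
    case False
    then have "z \<in> K" using that by (auto simp: K_def in_cbox_complex_iff)
    then show ?thesis using B[of z] by simp
  qed
  then show ?thesis by blast
qed

text \<open>Up to the invariance of \<open>F\<close> only the residues of the bottom row modulo \<open>4 m\<^sup>2\<close> matter,
  so finitely many matrices have to be considered.\<close>
lemma G_bounded:
  assumes y0: "y0 > 0"
  shows "\<exists>B\<ge>0. \<forall>a b c d z. a * d - b * c = 1 \<longrightarrow> Im z \<ge> y0 \<longrightarrow> norm (G a b c d z) \<le> B"
proof -
  let ?M = "int (4 * m\<^sup>2)"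
  let ?S = "{0..<?M} \<times> {0..<?M}"
  have M: "?M > 0" using m by simp
  have "\<exists>B\<ge>0. \<forall>a b c d z. a * d - b * c = 1 \<longrightarrow> (c mod ?M, d mod ?M) = r \<longrightarrow>
      Im z \<ge> y0 \<and> 0 \<le> Re z \<and> Re z \<le> 1 \<longrightarrow> norm (G a b c d z) \<le> B" for r
  proof (cases "\<exists>a b c d. a * d - b * c = 1 \<and> (c mod ?M, d mod ?M) = r")
    case True
    then obtain a' b' c' d' where g: "a' * d' - b' * c' = 1" "(c' mod ?M, d' mod ?M) = r" by blast
    obtain B where B: "\<And>z. Im z \<ge> y0 \<and> 0 \<le> Re z \<and> Re z \<le> 1 \<Longrightarrow> norm (G a' b' c' d' z) \<le> B"
      using G_bounded_strip[OF g(1) y0] by blast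
    have "norm (G a b c d z) \<le> max B 0"
      if h: "a * d - b * c = 1" "(c mod ?M, d mod ?M) = r" "Im z \<ge> y0 \<and> 0 \<le> Re z \<and> Re z \<le> 1" for a b c d z
    proof -
      have cc: "[c = c'] (mod ?M)" "[d' = d] (mod ?M)" using g h by (auto simp: cong_def)
      have "[c * d' = c' * d] (mod ?M)" by (rule cong_mult[OF cc])
      then have "?M dvd c * d' - d * c'" by (simp add: cong_iff_dvd_diff mult.commute)
      then have "G a b c d z = G a' b' c' d' z" using G_cong[OF h(1) g(1)] h(3) y0 by auto
      then show ?thesis using B[OF h(3)] by simp
    qed
    then show ?thesis by (intro exI[of _ "max B 0"]) auto
  qed auto
  then obtain B where B0: "\<And>r. B r \<ge> 0" and B: "\<And>r a b c d z. a * d - b * c = 1 \<Longrightarrow> (c mod ?M, d mod ?M) = r \<Longrightarrow>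
      Im z \<ge> y0 \<and> 0 \<le> Re z \<and> Re z \<le> 1 \<Longrightarrow> norm (G a b c d z) \<le> B r"
    by metis
  have strip: "norm (G a b c d z) \<le> (\<Sum>r\<in>?S. B r)" if h: "a * d - b * c = 1" "Im z \<ge> y0 \<and> 0 \<le> Re z \<and> Re z \<le> 1" for a b c d z
  proof -
    have "norm (G a b c d z) \<le> B (c mod ?M, d mod ?M)" using B[OF h(1) refl h(2)] .
    also have "\<dots> \<le> (\<Sum>r\<in>?S. B r)"
      using M B0 by (intro member_le_sum) auto
    finally show ?thesis .
  qed
  have "norm (G a b c d z) \<le> (\<Sum>r\<in>?S. B r)" if h: "a * d - b * c = 1" "Im z \<ge> y0" for a b c d z
  proof -
    \<comment> \<open>Translating into the strip changes the matrix, which is harmless because the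
      bound over the strip holds for all matrices simultaneously.\<close>
    define n where "n = \<lfloor>Re z\<rfloor>"
    have "G a b c d z = G a (b + a * n) c (d + c * n) (z - of_int n)"
      using G_translate[of a b c d "z - of_int n" n] by simp
    moreover have "a * (d + c * n) - (b + a * n) * c = 1" using h(1) by (simp add: algebra_simps)
    moreover have "Im (z - of_int n) \<ge> y0 \<and> 0 \<le> Re (z - of_int n) \<and> Re (z - of_int n) \<le> 1"
      using h(2) unfolding n_def by simp linarith
    ultimately show ?thesis using strip by metis
  qed
  moreover have "(\<Sum>r\<in>?S. B r) \<ge> 0" using B0 by (intro sum_nonneg) auto
  ultimately show ?thesis by blast
qed

text \<open>Instead of reducing to a fundamental domain, Dirichlet approximation of
  \<open>Re z\<close> with denominators up to about \<open>1 / sqrt (Im z)\<close> yields a modular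
  matrix lifting \<open>z\<close> to height at least 1/5. There the transforms are uniformly
  bounded, and the automorphy factor is at least \<open>Im z\<close> in modulus.\<close>

lemma F_polynomial_bound:
  "\<exists>B\<ge>0. \<forall>z. 0 < Im z \<and> Im z \<le> 1 \<longrightarrow> norm (F z) \<le> B / Im z ^ (8 * k + 4)"
proof -
  obtain B where B0: "B \<ge> 0" and B: "\<And>a b c d z. a * d - b * c = 1 \<Longrightarrow> Im z \<ge> 1 / 5 \<Longrightarrow> norm (G a b c d z) \<le> B"
    using G_bounded[of "1 / 5"] by auto
  have "norm (F z) \<le> B / Im z ^ (8 * k + 4)" if y: "0 < Im z" "Im z \<le> 1" for z
  proof -
    define x y where "x = Re z" and "y = Im z"
    have y: "0 < y" "y \<le> 1" using y by (auto simp: y_def)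
    define Q where "Q = nat \<lceil>1 / sqrt y\<rceil>"
    have sq: "1 \<le> 1 / sqrt y" using y by simp
    have Q: "1 / sqrt y \<le> real Q" "real Q \<le> 1 / sqrt y + 1" "Q > 0"
      using sq unfolding Q_def by linarith+
    obtain h n where hn: "coprime h n" "0 < n" "n \<le> int Q" "\<bar>of_int n * x - of_int h\<bar> < 1 / real Q"
      using Dirichlet_approx_coprime[OF Q(3)] by blast
    obtain u v where uv: "h * u + n * v = 1"
      using hn(1) bezout_int[of h n] by (auto simp: coprime_iff_gcd_eq_1 mult.commute)
    \<comment> \<open>The bottom row \<open>(n, - h)\<close> makes \<open>j = n * z - h\<close>
      small; the top row is supplied by Bezout.\<close>
    define a b c d where "a = - u" and "b = - v" and "c = n" and "d = - h"
    have det: "a * d - b * c = 1" using uv by (simp add: a_def b_def c_def d_def algebra_simps)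
    have det': "d * a - (- b) * (- c) = 1" using det by (simp add: algebra_simps)
    define j where "j = of_int c * z + of_int d"
    define w where "w = (of_int a * z + of_int b) / j"
    have z0: "Im z > 0" using y by (simp add: y_def)
    have j0: "j \<noteq> 0" unfolding j_def by (rule moebius_denominator_nonzero[OF det z0])
    have nj: "(norm j)\<^sup>2 = (of_int n * x - of_int h)\<^sup>2 + (of_int n * y)\<^sup>2"
      by (simp add: j_def c_def d_def cmod_power2 x_def y_def)
    have jlow: "norm j \<ge> y"
    proof -
      have "y * 1 \<le> y * of_int n" using y hn by (intro mult_left_mono) auto
      also have "y * of_int n = \<bar>Im j\<bar>" using y hn by (simp add: j_def c_def d_def y_def)
      also have "\<dots> \<le> norm j" by (rule abs_Im_le_cmod)
      finally show ?thesis by simp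
    qed
    have "(norm j)\<^sup>2 \<le> 5 * y"
    proof -
      have "\<bar>of_int n * x - of_int h\<bar> \<le> sqrt y"
      proof -
        have "1 / real Q \<le> sqrt y" using Q y by (simp add: field_simps)
        then show ?thesis using hn(4) by linarith
      qed
      then have "\<bar>of_int n * x - of_int h\<bar>\<^sup>2 \<le> (sqrt y)\<^sup>2" by (intro power_mono) auto
      then have 1: "(of_int n * x - of_int h)\<^sup>2 \<le> y" using y by simp
      have "of_int n \<le> 2 / sqrt y"
      proof -
        have "of_int n \<le> real Q" using hn(3) by linarith
        also have "\<dots> \<le> 1 / sqrt y + 1 / sqrt y" using Q sq by linarith
        finally show ?thesis by simp
      qed
      then have "of_int n * y \<le> 2 / sqrt y * y" using y by (intro mult_right_mono) auto
      also have "\<dots> = 2 * sqrt y" using y by (simp add: real_div_sqrt flip: times_divide_eq_right)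
      finally have "(of_int n * y)\<^sup>2 \<le> (2 * sqrt y)\<^sup>2" using y hn by (intro power_mono) auto
      then have 2: "(of_int n * y)\<^sup>2 \<le> 4 * y" using y by (simp add: power_mult_distrib)
      show ?thesis using 1 2 nj by simp
    qed
    moreover have "Im w = y / (norm j)\<^sup>2"
      unfolding w_def j_def y_def by (rule Im_moebius[OF det])
    \<comment> \<open>The 5 is 1 + 4: the squared real part of \<open>j\<close> is at most
      \<open>y\<close>, and the squared imaginary part at most \<open>4 * y\<close>.\<close>
    ultimately have "Im w \<ge> 1 / 5" using j0 by (simp add: pos_le_divide_eq)
    then have Gw: "norm (G d (- b) (- c) a w) \<le> B" by (rule B[OF det'])
    have detc: "complex_of_int a * of_int d - of_int b * of_int c = 1"
      using det by (metis of_int_1 of_int_diff of_int_mult)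
    have mult_add: "A * (X / j) + C = (A * X + C * j) / j" for A C X
      using j0 by (simp add: field_simps)
    have den: "of_int (- c) * w + of_int a = 1 / j"
    proof -
      have "of_int (- c) * (of_int a * z + of_int b) + of_int a * j = complex_of_int a * of_int d - of_int b * of_int c"
        by (simp add: j_def algebra_simps)
      then have "(of_int (- c) * (of_int a * z + of_int b) + of_int a * j) / j = 1 / j"
        by (simp only: detc)
      then show ?thesis unfolding w_def mult_add .
    qed
    have num: "of_int d * w + of_int (- b) = z / j"
    proof -
      have "of_int d * (of_int a * z + of_int b) + of_int (- b) * j = z * (complex_of_int a * of_int d - of_int b * of_int c)"
        by (simp add: j_def algebra_simps)
      then have "(of_int d * (of_int a * z + of_int b) + of_int (- b) * j) / j = z / j"
        by (simp only: detc mult_1_right)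
      then show ?thesis unfolding w_def mult_add .
    qed
    have "G d (- b) (- c) a w = F z * j ^ (8 * k + 4)"
      unfolding G_def den num using j0 by (simp add: power_divide)
    then have "norm (F z) * norm j ^ (8 * k + 4) \<le> B" using Gw by (simp add: norm_mult norm_power)
    moreover have "norm (F z) * y ^ (8 * k + 4) \<le> norm (F z) * norm j ^ (8 * k + 4)"
      using jlow y by (intro mult_left_mono power_mono) auto
    ultimately have "norm (F z) * y ^ (8 * k + 4) \<le> B" by linarith
    then show ?thesis using y by (simp add: pos_le_divide_eq y_def)
  qed
  then show ?thesis using B0 by blast
qed

text \<open>Taking eighth roots gives the exponent \<open>k + 1/2\<close>, rounded up to an integer,
  which is allowed since \<open>Im z \<le> 1\<close>. The maximum with 1 makes the constant at most
  its own eighth power.\<close>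

lemma f_polynomial_bound:
  "\<exists>B\<ge>0. \<forall>z. 0 < Im z \<and> Im z \<le> 1 \<longrightarrow> norm (f z) \<le> B / Im z ^ (k + 1)"
proof -
  obtain B where B0: "B \<ge> 0" and B: "\<And>z. 0 < Im z \<and> Im z \<le> 1 \<Longrightarrow> norm (F z) \<le> B / Im z ^ (8 * k + 4)"
    using F_polynomial_bound by auto
  have "norm (f z) \<le> max B 1 / Im z ^ (k + 1)" if z: "0 < Im z \<and> Im z \<le> 1" for z
  proof (rule power_le_imp_le_base)
    have "norm (f z) ^ Suc 7 = norm (F z)" by (simp add: F_def norm_power)
    also have "\<dots> \<le> B / Im z ^ (8 * k + 4)" by (rule B[OF z])
    also have "\<dots> \<le> max B 1 ^ 8 / Im z ^ (8 * (k + 1))"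
    proof (rule frac_le)
      have "B \<le> max B 1 ^ 1" by simp
      also have "\<dots> \<le> max B 1 ^ 8" by (intro power_increasing) auto
      finally show "B \<le> max B 1 ^ 8" .
      show "Im z ^ (8 * (k + 1)) \<le> Im z ^ (8 * k + 4)" using z by (intro power_decreasing) auto
    qed (use z in auto)
    also have "\<dots> = (max B 1 / Im z ^ (k + 1)) ^ Suc 7"
      by (simp only: power_divide power_mult[symmetric] mult.commute[of 8]) simp
    finally show "norm (f z) ^ Suc 7 \<le> (max B 1 / Im z ^ (k + 1)) ^ Suc 7" .
  qed (use z in auto)
  then show ?thesis by (intro exI[of _ "max B 1"]) auto
qed

end

section \<open>The Mellin transform of the cusp form\<close>

lemma exp_mult_exp_exp_le:
  fixes A l x :: real
  assumes "A > 0" "x \<ge> 0"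
  shows "exp (l * x - A * exp x) \<le> exp (l\<^sup>2 / (2 * A))"
proof -
  have "x\<^sup>2 / 2 \<le> exp x" using exp_lower_Taylor_quadratic[OF assms(2)] assms by linarith
  then have "A * (x\<^sup>2 / 2) \<le> A * exp x" using assms by (intro mult_left_mono) auto
  moreover have "l * x - A * (x\<^sup>2 / 2) \<le> l\<^sup>2 / (2 * A)"
  proof -
    have "0 \<le> (l - A * x)\<^sup>2" by simp
    then have "2 * A * (l * x - A * (x\<^sup>2 / 2)) \<le> l\<^sup>2"
      by (simp add: power2_eq_square algebra_simps)
    then show ?thesis using assms by (simp add: pos_le_divide_eq mult.commute)
  qed
  ultimately show ?thesis by simp
qed

lemma integrable_exp_minus_exp:
  fixes c :: real and s :: complex
  assumes c: "c > 0" and s: "Re s > 0"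
  shows "integrable lborel (\<lambda>u. exp (- of_real (c * exp u)) * exp (s * of_real u) :: complex)"
proof (rule Bochner_Integration.integrable_bound[OF integrable_mult_right[OF integrable_exp_minus_abs[OF s], of "exp ((2 * Re s)\<^sup>2 / (2 * c))"]])
  show "AE u in lborel. norm (exp (- of_real (c * exp u)) * exp (s * of_real u) :: complex)
      \<le> norm (exp ((2 * Re s)\<^sup>2 / (2 * c)) * exp (- Re s * \<bar>u\<bar>))"
  proof (rule AE_I2)
    fix u :: real
    have eq: "norm (exp (- of_real (c * exp u)) * exp (s * of_real u) :: complex) = exp (Re s * u - c * exp u)"
      unfolding norm_mult norm_exp_eq_Re exp_add[symmetric] by simp
    have "exp (Re s * u - c * exp u) \<le> exp ((2 * Re s)\<^sup>2 / (2 * c)) * exp (- Re s * \<bar>u\<bar>)"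
    proof (cases "u \<ge> 0")
      case True
      have "exp (Re s * u - c * exp u) = exp (2 * Re s * u - c * exp u) * exp (- Re s * \<bar>u\<bar>)"
        using True by (simp add: exp_add[symmetric])
      also have "\<dots> \<le> exp ((2 * Re s)\<^sup>2 / (2 * c)) * exp (- Re s * \<bar>u\<bar>)"
        using exp_mult_exp_exp_le[OF c True, of "2 * Re s"] by (intro mult_right_mono) auto
      finally show ?thesis .
    next
      case False
      have "exp (Re s * u - c * exp u) \<le> 1 * exp (- Re s * \<bar>u\<bar>)"
        using c False by simp
      also have "\<dots> \<le> exp ((2 * Re s)\<^sup>2 / (2 * c)) * exp (- Re s * \<bar>u\<bar>)"
        using c by (intro mult_right_mono) auto
      finally show ?thesis .
    qed
    then show "norm (exp (- of_real (c * exp u)) * exp (s * of_real u) :: complex)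
      \<le> norm (exp ((2 * Re s)\<^sup>2 / (2 * c)) * exp (- Re s * \<bar>u\<bar>))"
      unfolding eq by simp
  qed
qed simp

text \<open>Euler's integral under the substitution \<open>t = c * exp u\<close>, which matches the
  coordinate of the strip.\<close>

lemma Gamma_exp_integral:
  fixes c :: real and s :: complex
  assumes c: "c > 0" and s: "Re s > 0"
  shows "(LBINT u. exp (- of_real (c * exp u)) * exp (s * of_real u)) = Gamma s * of_real c powr (- s)"
proof -
  define \<phi> where "\<phi> = (\<lambda>t::real. of_real t powr (s - 1) / of_real (exp t) :: complex)"
  have int0: "set_integrable lborel {0<..} \<phi>"
    using absolutely_integrable_Gamma_integral'[OF s]
    by (simp add: set_integrable_def integrable_completion \<phi>_def)
  have val0: "set_lebesgue_integral lborel {0<..} \<phi> = Gamma s"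
    using set_borel_integral_eq_integral(2)[OF int0] Gamma_integral_complex'[OF s]
    by (simp add: \<phi>_def integral_unique)
  have key: "(c * exp u) *\<^sub>R \<phi> (c * exp u) = of_real c powr s * (exp (- of_real (c * exp u)) * exp (s * of_real u))" for u
  proof -
    have "of_real (c * exp u) powr (s - 1) * of_real (c * exp u) = (of_real (c * exp u) powr s :: complex)"
      using c by (simp add: powr_diff)
    also have "\<dots> = of_real c powr s * of_real (exp u) powr s"
      using c by (simp add: powr_times_real)
    also have "of_real (exp u) powr s = exp (s * of_real u)"
      by (simp add: powr_def Ln_of_real exp_of_real[symmetric])
    finally show ?thesis
      by (simp add: \<phi>_def scaleR_conv_of_real exp_of_real[symmetric] exp_minus field_simps)
  qed
  have "(LBINT x=0..\<infinity>. \<phi> x) = (LBINT u=-\<infinity>..\<infinity>. (c * exp u) *\<^sub>R \<phi> (c * exp u))"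
  proof (rule interval_integral_substitution_integrable)
    show "DERIV (\<lambda>u. c * exp u) u :> c * exp u" for u by (auto intro!: derivative_eq_intros)
    show "isCont \<phi> (c * exp u)" for u
      unfolding \<phi>_def using c by (intro continuous_intros) (auto simp: complex_nonpos_Reals_iff)
    show "((ereal \<circ> (\<lambda>u. c * exp u) \<circ> real_of_ereal) \<longlongrightarrow> 0) (at_right (-\<infinity>))"
    proof -
      have "((\<lambda>u. c * exp u) \<longlongrightarrow> 0) at_bot" by real_asymp
      then show ?thesis
        by (simp only: zero_ereal_def ereal_tendsto_simps)
    qed
    show "((ereal \<circ> (\<lambda>u. c * exp u) \<circ> real_of_ereal) \<longlongrightarrow> \<infinity>) (at_left \<infinity>)"
    proof -
      have "filterlim (\<lambda>u. c * exp u) at_top at_top" using c by real_asymp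
      then show ?thesis by (simp only: ereal_tendsto_simps)
    qed
    show "set_integrable lborel (einterval (-\<infinity>) \<infinity>) (\<lambda>u. (c * exp u) *\<^sub>R \<phi> (c * exp u))"
      unfolding key using integrable_exp_minus_exp[OF c s] by (simp add: set_integrable_def)
    show "set_integrable lborel (einterval 0 \<infinity>) \<phi>"
      using int0 by (simp add: zero_ereal_def)
  qed (use c in auto)
  then have "Gamma s = (LBINT u. (c * exp u) *\<^sub>R \<phi> (c * exp u))"
    by (simp add: interval_lebesgue_integral_def val0 zero_ereal_def set_lebesgue_integral_def[of _ UNIV])
  then have "Gamma s = of_real c powr s * (LBINT u. exp (- of_real (c * exp u)) * exp (s * of_real u))"
    unfolding key by simp
  then show ?thesis using c by (simp add: powr_minus field_simps)
qed

lemma is_entire_L_imp_entire_L: "is_entire_L a L \<Longrightarrow> entire_L a = L"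
  unfolding entire_L_def using is_entire_L_unique by blast

locale fricke_cusp_form = half_cusp_form +
  fixes a :: "nat \<Rightarrow> complex" and \<sigma> :: real
  assumes fourier: "Im z > 0 \<Longrightarrow> (\<lambda>n. a (Suc n) * exp (2 * of_real pi * \<i> * of_nat (Suc n) * z)) sums f z"
    and sign: "\<sigma> = 1 \<or> \<sigma> = -1"
    and fricke: "Im z > 0 \<Longrightarrow> fricke k (4 * m\<^sup>2) f z = of_real \<sigma> * f z"
    and nonzero_form: "\<exists>z. Im z > 0 \<and> f z \<noteq> 0"
begin

lemma f_periodic: "Im z > 0 \<Longrightarrow> f (z + 1) = f z"
proof -
  assume z: "Im z > 0"
  have "exp (2 * of_real pi * \<i> * of_nat (Suc n) * (z + 1)) = exp (2 * of_real pi * \<i> * of_nat (Suc n) * z)" for n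
  proof -
    have "exp (2 * of_real pi * \<i> * of_nat (Suc n)) = (1 :: complex)"
      using exp_integer_2pi[of "of_nat (Suc n)"] by (simp add: mult_ac)
    then show ?thesis by (simp only: distrib_left exp_add mult_1_right)
  qed
  then have "(\<lambda>n. a (Suc n) * exp (2 * of_real pi * \<i> * of_nat (Suc n) * z)) sums f (z + 1)"
    using fourier[of "z + 1"] z by simp
  with fourier[OF z] show ?thesis using sums_unique2 by blast
qed

lemma f_decay:
  assumes "y0 > 0"
  shows "\<exists>C. \<forall>z. Im z \<ge> y0 \<longrightarrow> norm (f z) \<le> C * exp (- 2 * pi * Im z)"
proof (rule periodic_vanishing_decay[OF f_holomorphic f_periodic _ assms])
  have "((\<lambda>z. half_power (of_int 0 * z + of_int 1) (- int k - 1) * f ((of_int 1 * z + of_int 0) / (of_int 0 * z + of_int 1))) \<longlongrightarrow> 0) (filtercomap Im at_top)"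
  proof -
    have "(1::int) * 1 - 0 * 0 = 1" by simp
    then show ?thesis using f unfolding half_cusp_forms_def vanishes_at_cusps_def by blast
  qed
  then show "(f \<longlongrightarrow> 0) (filtercomap Im at_top)" by (simp add: half_power_def)
qed auto

text \<open>Hecke's argument: Cauchy's estimate for the \<open>q\<close>-series on the circle of
  radius \<open>exp (- 2 * pi / n)\<close>, which is the line \<open>Im z = 1 / n\<close>. The
  \<open>n\<close>-th power of the radius costs only \<open>exp (2 * pi)\<close>.\<close>

lemma coeff_bound: "\<exists>C\<ge>0. \<forall>n\<ge>1. norm (a n) \<le> C * real n ^ (k + 1)"
proof -
  obtain B where B0: "B \<ge> 0" and B: "\<And>z. 0 < Im z \<and> Im z \<le> 1 \<Longrightarrow> norm (f z) \<le> B / Im z ^ (k + 1)"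
    using f_polynomial_bound by auto
  define b where "b = (\<lambda>n. if n = 0 then 0 else a n)"
  define \<phi> where "\<phi> = (\<lambda>w. if w = 0 then 0 else f (Ln w / (2 * of_real pi * \<i>)))"
  have sums: "(\<lambda>n. b n * w ^ n) sums \<phi> w" if w: "norm w < 1" for w
  proof (cases "w = 0")
    case True
    have "(\<lambda>n. b n * w ^ n) = (\<lambda>n. 0)" using True by (auto simp: b_def fun_eq_iff power_0_left)
    then show ?thesis using True by (simp add: \<phi>_def)
  next
    case False
    define z where "z = Ln w / (2 * of_real pi * \<i>)"
    have z: "Im z > 0" using w False unfolding z_def Im_log_quotient[OF False] by (simp add: divide_neg_pos)
    have "exp (2 * of_real pi * \<i> * of_nat (Suc n) * z) = w ^ Suc n" for n
    proof -
      have "2 * of_real pi * \<i> * of_nat (Suc n) * z = of_nat (Suc n) * Ln w" by (simp add: z_def)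
      then show ?thesis using False by (simp only: exp_of_nat_mult exp_Ln) simp
    qed
    then have "(\<lambda>n. b (Suc n) * w ^ Suc n) sums f z" using fourier[OF z] by (simp add: b_def)
    then have "(\<lambda>n. b n * w ^ n) sums (f z + b 0 * w ^ 0)" by (subst (asm) sums_Suc_iff)
    then show ?thesis using False by (simp add: \<phi>_def z_def b_def)
  qed
  have "norm (a n) \<le> B * exp (2 * pi) * real n ^ (k + 1)" if n: "n \<ge> 1" for n
  proof -
    define r where "r = exp (- 2 * pi / real n)"
    have r: "0 < r" "r < 1" using n by (auto simp: r_def)
    have "norm (b n) \<le> (B * real n ^ (k + 1)) / r ^ n"
    proof (rule power_series_Cauchy_bound[OF sums r])
      fix w :: complex assume w: "norm w = r"
      then have "w \<noteq> 0" using r by auto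
      define z where "z = Ln w / (2 * of_real pi * \<i>)"
      have "Im z = 1 / real n" unfolding z_def Im_log_quotient[OF \<open>w \<noteq> 0\<close>] w by (simp add: r_def)
      then have "norm (f z) \<le> B / (1 / real n) ^ (k + 1)" using B[of z] n by simp
      then show "norm (\<phi> w) \<le> B * real n ^ (k + 1)"
        using \<open>w \<noteq> 0\<close> by (simp add: \<phi>_def z_def power_divide)
    qed
    also have "r ^ n = exp (- 2 * pi)" using n by (simp add: r_def flip: exp_of_nat_mult)
    finally show ?thesis using n by (simp add: b_def exp_minus field_simps)
  qed
  then show ?thesis using B0 by (intro exI[of _ "B * exp (2 * pi)"]) auto
qed

section \<open>The cusp form in the coordinate of the strip\<close>

definition \<kappa> :: real where "\<kappa> = real k / 2 + 1 / 4"

text \<open>Maps the strip onto the upper half-plane and the real line onto the imaginary axis. The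
  fixed point of the Fricke map is the image of 0, and the map itself becomes the reflection
  \<open>u \<mapsto> - u\<close>.\<close>

definition p :: "complex \<Rightarrow> complex" where "p u = \<i> * exp u / of_real (2 * real m)"

definition h :: "complex \<Rightarrow> complex" where "h u = f (p u) * exp (of_real \<kappa> * u)"

lemma Im_p: "Im (p u) = exp (Re u) * cos (Im u) / (2 * real m)"
  by (simp add: p_def Im_divide_of_real Re_exp)

lemma Im_p_pos: "\<bar>Im u\<bar> < pi / 2 \<Longrightarrow> Im (p u) > 0"
  using m by (simp add: Im_p cos_gt_zero_pi)

lemma p_holomorphic: "p holomorphic_on A"
  unfolding p_def using m by (intro holomorphic_intros) auto

lemma h_holomorphic: "h holomorphic_on {u. \<bar>Im u\<bar> < pi / 2}"
proof -
  have "(\<lambda>u. f (p u)) holomorphic_on {u. \<bar>Im u\<bar> < pi / 2}"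
    by (rule holomorphic_on_compose_gen[OF p_holomorphic f_holomorphic, unfolded o_def])
      (use Im_p_pos in \<open>auto simp: upper_half_plane_def\<close>)
  then show ?thesis unfolding h_def by (intro holomorphic_intros)
qed

text \<open>\<open>pi / 4 + Im u / 2\<close> stays between 0 and \<open>pi / 2\<close>, so the
  explicit root has positive real part and is the principal one. Half-integral powers thus become
  exponentials without any branch correction.\<close>

lemma csqrt_p:
  assumes "\<bar>Im u\<bar> < pi / 2"
  shows "csqrt (p u) = exp (\<i> * of_real (pi / 4) + u / 2) / of_real (sqrt (2 * real m))"
proof (rule csqrt_unique)
  let ?w = "exp (\<i> * of_real (pi / 4) + u / 2) / of_real (sqrt (2 * real m))"
  have "(exp (\<i> * of_real (pi / 4) + u / 2))\<^sup>2 = exp (\<i> * of_real (pi / 2) + u)"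
    by (simp add: exp_double[symmetric] algebra_simps)
  also have "\<dots> = \<i> * exp u"
  proof -
    have "exp (\<i> * of_real (pi / 2)) = \<i>" by (metis cis_conv_exp cis_pi_half)
    then show ?thesis by (simp only: exp_add)
  qed
  finally show "?w\<^sup>2 = p u"
    using m by (simp add: power_divide p_def flip: of_real_power)
  have "cos (pi / 4 + Im u / 2) > 0" using assms by (intro cos_gt_zero_pi) auto
  then have "Re ?w > 0" using m by (simp add: Re_divide_of_real Re_exp)
  then show "0 < Re ?w \<or> Re ?w = 0 \<and> 0 \<le> Im ?w" by blast
qed

text \<open>In the Fricke involution at \<open>p u\<close> the power of \<open>\<i>\<close> and the
  level cancel against the root of \<open>p u\<close>, leaving
  \<open>exp (- (2 * \<kappa> * u))\<close>. The factor \<open>exp (\<kappa> * u)\<close> in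
  \<open>h\<close> distributes this evenly between \<open>u\<close> and \<open>- u\<close>.\<close>

lemma h_parity:
  assumes u: "\<bar>Im u\<bar> < pi / 2"
  shows "h (- u) = of_real \<sigma> * h u"
proof -
  define e where "e = exp (\<i> * of_real (pi / 4))"
  define M where "M = sqrt (2 * real m)"
  have M: "M > 0" using m by (simp add: M_def)
  have e0: "e \<noteq> 0" by (simp add: e_def)
  have sqi: "csqrt \<i> = e"
  proof (rule csqrt_unique)
    have e: "e = cis (pi / 4)" by (simp only: e_def cis_conv_exp)
    show "e\<^sup>2 = \<i>" by (simp add: e power2_eq_square cis_mult)
    show "0 < Re e \<or> Re e = 0 \<and> 0 \<le> Im e" by (simp add: e cos_45)
  qed
  have sqp: "csqrt (p u) = e * exp (u / 2) / of_real M"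
    using csqrt_p[OF u] by (simp add: e_def M_def exp_add)
  have neg: "- 1 / (of_nat (4 * m\<^sup>2) * p u) = p (- u)"
    using m by (simp add: p_def exp_minus field_simps power2_eq_square)
  have pw: "of_real (real (4 * m\<^sup>2) powr (- real k / 2 - 1 / 4)) = inverse (complex_of_real M ^ (2 * k + 1))"
  proof -
    have "real (4 * m\<^sup>2) = M powr 4"
      using M by (simp add: powr_numeral M_def power_mult_distrib power_numeral_even)
    then have "real (4 * m\<^sup>2) powr (- real k / 2 - 1 / 4) = M powr (4 * (- real k / 2 - 1 / 4))"
      by (simp add: powr_powr)
    also have "4 * (- real k / 2 - 1 / 4) = - real (2 * k + 1)" by simp
    also have "M powr (- real (2 * k + 1)) = inverse (M ^ (2 * k + 1))"
      using M by (simp only: powr_minus powr_realpow)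
    finally show ?thesis by (simp add: of_real_inverse)
  qed
  have "half_power \<i> (int k) * of_real (real (4 * m\<^sup>2) powr (- real k / 2 - 1 / 4)) * half_power (p u) (- int k - 1)
     = (e * inverse (of_real M) * inverse (e * exp (u / 2) / of_real M)) ^ (2 * k + 1)"
    by (simp only: half_power_neg half_power_nat sqi sqp pw power_mult_distrib power_inverse)
  also have "e * inverse (of_real M) * inverse (e * exp (u / 2) / of_real M) = exp (- u / 2)"
    using e0 M by (simp add: exp_minus field_simps)
  also have "exp (- u / 2) ^ (2 * k + 1) = exp (- (2 * of_real \<kappa> * u))"
  proof -
    have "of_nat (2 * k + 1) * (- u / 2) = - (2 * of_real \<kappa> * u)"
      by (simp add: \<kappa>_def algebra_simps add_divide_distrib)
    then show ?thesis by (simp only: exp_of_nat_mult[symmetric])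
  qed
  finally have "exp (- (2 * of_real \<kappa> * u)) * f (p (- u)) = of_real \<sigma> * f (p u)"
    using fricke[OF Im_p_pos[OF u]] by (simp only: fricke_def neg)
  then have "exp (2 * of_real \<kappa> * u) * (exp (- (2 * of_real \<kappa> * u)) * f (p (- u))) = exp (2 * of_real \<kappa> * u) * (of_real \<sigma> * f (p u))"
    by simp
  moreover have "exp (2 * of_real \<kappa> * u) * (exp (- (2 * of_real \<kappa> * u)) * f (p (- u))) = f (p (- u))"
    by (simp add: mult.assoc[symmetric] exp_add[symmetric])
  ultimately have reflect: "f (p (- u)) = exp (2 * of_real \<kappa> * u) * (of_real \<sigma> * f (p u))"
    by (simp only:)
  have "h (- u) = of_real \<sigma> * (f (p u) * (exp (2 * of_real \<kappa> * u) * exp (- (of_real \<kappa> * u))))"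
    by (simp add: h_def reflect)
  also have "exp (2 * of_real \<kappa> * u) * exp (- (of_real \<kappa> * u)) = exp (of_real \<kappa> * u)"
    by (simp add: exp_add[symmetric] mult.commute)
  finally show ?thesis by (simp add: h_def)
qed

text \<open>For \<open>Re u \<ge> 0\<close> the height of \<open>p u\<close> is at least
  \<open>y0 * exp (Re u)\<close>, so \<open>f (p u)\<close> is doubly exponentially small and beats
  every exponential. The other half, where \<open>p u\<close> approaches the cusp 0, follows from
  parity.\<close>

lemma h_decay:
  assumes \<beta>: "0 \<le> \<beta>" "\<beta> < pi / 2"
  shows "\<exists>C. \<forall>u. \<bar>Im u\<bar> \<le> \<beta> \<longrightarrow> norm (h u) \<le> C * exp (- (\<mu> * \<bar>Re u\<bar>))"
proof -
  define y0 where "y0 = cos \<beta> / (2 * real m)"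
  have y0: "y0 > 0" using \<beta> m by (simp add: y0_def cos_gt_zero_pi)
  obtain C where C: "\<And>z. Im z \<ge> y0 \<Longrightarrow> norm (f z) \<le> C * exp (- 2 * pi * Im z)"
    using f_decay[OF y0] by blast
  have C0: "C \<ge> 0"
    using order_trans[OF norm_ge_zero C[of "Complex 0 y0"]] by (simp add: zero_le_mult_iff)
  have pos: "norm (h u) \<le> (C * exp ((\<kappa> + \<mu>)\<^sup>2 / (2 * (2 * pi * y0)))) * exp (- (\<mu> * \<bar>Re u\<bar>))"
    if u: "\<bar>Im u\<bar> \<le> \<beta>" "Re u \<ge> 0" for u
  proof -
    have "cos \<beta> \<le> cos \<bar>Im u\<bar>" using u \<beta> by (intro cos_monotone_0_pi_le) auto
    then have "cos \<beta> \<le> cos (Im u)" by simp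
    then have "exp (Re u) * cos \<beta> / (2 * real m) \<le> exp (Re u) * cos (Im u) / (2 * real m)"
      by (intro divide_right_mono mult_left_mono) auto
    then have im: "exp (Re u) * y0 \<le> Im (p u)" by (simp add: Im_p y0_def)
    have "1 * y0 \<le> exp (Re u) * y0" using u y0 by (intro mult_right_mono) auto
    then have "norm (f (p u)) \<le> C * exp (- 2 * pi * Im (p u))" using im by (intro C) auto
    also have "\<dots> \<le> C * exp (- (2 * pi * y0) * exp (Re u))"
      using im C0 by (intro mult_left_mono) (auto simp: mult_ac)
    finally have "norm (h u) \<le> C * exp (- (2 * pi * y0) * exp (Re u)) * exp (\<kappa> * Re u)"
      by (simp add: h_def norm_mult mult_right_mono)
    also have "\<dots> = C * exp ((\<kappa> + \<mu>) * Re u - (2 * pi * y0) * exp (Re u)) * exp (- (\<mu> * \<bar>Re u\<bar>))"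
      using u by (simp add: mult.assoc exp_add[symmetric] algebra_simps)
    also have "\<dots> \<le> C * exp ((\<kappa> + \<mu>)\<^sup>2 / (2 * (2 * pi * y0))) * exp (- (\<mu> * \<bar>Re u\<bar>))"
      using C0 y0 u by (intro mult_right_mono mult_left_mono exp_mult_exp_exp_le) auto
    finally show ?thesis .
  qed
  have "norm (h u) \<le> (C * exp ((\<kappa> + \<mu>)\<^sup>2 / (2 * (2 * pi * y0)))) * exp (- (\<mu> * \<bar>Re u\<bar>))"
    if u: "\<bar>Im u\<bar> \<le> \<beta>" for u
  proof (cases "Re u \<ge> 0")
    case False
    have "norm (h (- u)) = norm (h u)" using h_parity[of u] u \<beta> sign by (auto simp: norm_mult)
    then show ?thesis using pos[of "- u"] u False by simp
  qed (use pos u in blast)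
  then show ?thesis by blast
qed

lemma p_real: "p (of_real x) = \<i> * of_real (exp x / (2 * real m))"
  by (simp add: p_def exp_of_real)

text \<open>The real line covers the imaginary axis, and a holomorphic function vanishing there
  vanishes on the whole half-plane.\<close>

lemma h_nonzero: "\<exists>x. h (of_real x) \<noteq> 0"
proof (rule ccontr)
  assume "\<not> ?thesis"
  then have h0: "h (of_real x) = 0" for x by blast
  have zero: "f (\<i> * of_real y) = 0" if "y > 0" for y
  proof -
    have "p (of_real (ln (2 * real m * y))) = \<i> * of_real y"
      using that m by (simp add: p_real)
    then show ?thesis using h0[of "ln (2 * real m * y)"] by (simp add: h_def)
  qed
  obtain z where z: "Im z > 0" "f z \<noteq> 0" using nonzero_form by blast
  define U where "U = (\<lambda>y. \<i> * complex_of_real y) ` {0<..}"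
  have "f z = 0"
  proof (rule analytic_continuation[OF f_holomorphic open_upper_half_plane, of U \<i>])
    show "connected upper_half_plane"
      unfolding upper_half_plane_def by (intro convex_connected convex_halfspace_Im_gt)
    show "U \<subseteq> upper_half_plane" by (auto simp: U_def upper_half_plane_def)
    show "\<i> islimpt U"
      unfolding islimpt_approachable
    proof (intro allI impI)
      fix e :: real assume e: "e > 0"
      have "\<i> * of_real (1 + e / 2) \<in> U"
        unfolding U_def by (rule image_eqI[of _ _ "1 + e / 2"]) (use e in auto)
      moreover have "dist (\<i> * of_real (1 + e / 2)) \<i> < e"
      proof -
        have "\<i> * of_real (1 + e / 2) - \<i> = \<i> * of_real (e / 2)" by (simp add: algebra_simps)
        then show ?thesis using e by (simp add: dist_norm norm_mult del: of_real_add of_real_divide)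
      qed
      moreover have "\<i> * of_real (1 + e / 2) \<noteq> \<i>" using e by (simp add: complex_eq_iff)
      ultimately show "\<exists>x'\<in>U. x' \<noteq> \<i> \<and> dist x' \<i> < e" by blast
    qed
  qed (use zero z in \<open>auto simp: U_def upper_half_plane_def\<close>)
  with z show False by simp
qed

lemma h_real_valued:
  assumes "\<And>n. n \<ge> 1 \<Longrightarrow> Im (a n / \<omega>) = 0"
  shows "Im (h (of_real x) / \<omega>) = 0"
proof -
  define y where "y = exp x / (2 * real m)"
  have y: "y > 0" using m by (simp add: y_def)
  let ?E = "\<lambda>n. exp (2 * of_real pi * \<i> * of_nat (Suc n) * (\<i> * of_real y))"
  have "(\<lambda>n. a (Suc n) * ?E n) sums f (\<i> * of_real y)"
    using y by (intro fourier) auto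
  then have "(\<lambda>n. a (Suc n) * ?E n / \<omega>) sums (f (\<i> * of_real y) / \<omega>)"
    by (rule sums_divide)
  then have "(\<lambda>n. Im (a (Suc n) * ?E n / \<omega>)) sums Im (f (\<i> * of_real y) / \<omega>)"
    by (rule sums_Im)
  moreover have "Im (a (Suc n) * ?E n / \<omega>) = 0" for n
  proof -
    have "2 * of_real pi * \<i> * of_nat (Suc n) * (\<i> * of_real y) = complex_of_real (- (2 * pi * real (Suc n) * y))"
      by (simp add: complex_eq_iff)
    then have "?E n = complex_of_real (exp (- (2 * pi * real (Suc n) * y)))"
      by (simp only: exp_of_real)
    then have "a (Suc n) * ?E n / \<omega> = a (Suc n) / \<omega> * complex_of_real (exp (- (2 * pi * real (Suc n) * y)))"
      by (simp only: times_divide_eq_left)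
    moreover have "Im (w * of_real r) = Im w * r" for w r by simp
    ultimately have "Im (a (Suc n) * ?E n / \<omega>) =
        Im (a (Suc n) / \<omega>) * exp (- (2 * pi * real (Suc n) * y))"
      by (simp only:)
    then show ?thesis using assms[of "Suc n"] by simp
  qed
  ultimately have "Im (f (\<i> * of_real y) / \<omega>) = 0" using sums_unique2[OF sums_zero] by simp
  moreover have "h (of_real x) / \<omega> = f (\<i> * of_real y) / \<omega> * of_real (exp (\<kappa> * x))"
    by (simp add: h_def p_real y_def exp_of_real[symmetric])
  moreover have "Im (w * of_real r) = Im w * r" for w r by simp
  ultimately show ?thesis by (simp only: mult_zero_left)
qed

text \<open>As \<open>w\<close> tends to \<open>pi / 2\<close>, the point \<open>p (\<i> w)\<close> tends to \<open>- 1 / (2 m)\<close>, which is a cusp only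
  because \<open>N = m\<^sup>2\<close> is a square. The matrix \<open>((-1, 0), (2 m, -1))\<close> moves it to infinity.\<close>
lemma h_cusp_decay:
  "\<exists>c>0. \<exists>\<delta>\<^sub>0>0. \<exists>B. \<forall>\<delta> w. 0 < \<delta> \<longrightarrow> \<delta> \<le> \<delta>\<^sub>0 \<longrightarrow> norm (w - of_real (pi / 2 - \<delta>)) = \<delta> / 2 \<longrightarrow>
        norm (h (\<i> * w)) \<le> B * exp (- (c / \<delta>))"
proof -
  define q where "q = 8 * k + 4"
  let ?G = "G (- 1) 0 (2 * int m) (- 1)"
  have det: "(- 1) * (- 1) - 0 * (2 * int m) = 1" by simp
  have per: "?G (z + 1) = ?G z" if z: "Im z > 0" for z
  proof -
    have "?G (z + of_int 1) = G (- 1) (0 + - 1 * 1) (2 * int m) (- 1 + 2 * int m * 1) z"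
      by (rule G_translate)
    also have "\<dots> = ?G z"
      by (rule G_cong[OF _ det _ z]) (auto simp: power2_eq_square algebra_simps)
    finally show ?thesis by simp
  qed
  obtain C where C: "\<And>z. Im z \<ge> 1 \<Longrightarrow> norm (?G z) \<le> C * exp (- 2 * pi * Im z)"
    using periodic_vanishing_decay[OF G_holomorphic[OF det] per G_tendsto_0[OF det], of 1] by auto
  have C0: "C \<ge> 0"
    using order_trans[OF norm_ge_zero C[of \<i>]] by (simp add: zero_le_mult_iff)
  \<comment> \<open>Comes from the bound \<open>Im Z \<ge> 1 / (32 * m * \<delta>)\<close> below,
    multiplied by \<open>2 * pi\<close>.\<close>
  define c1 where "c1 = 2 * pi / (32 * real m)"
  have c1: "c1 > 0" using m by (simp add: c1_def)
  \<comment> \<open>Contains the cost of the automorphy factor: \<open>(8 / \<delta>) ^ q\<close> is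
    absorbed by half of the exponential decay, comparing with one term of the exponential
    series.\<close>
  define D where "D = C * (fact q * (16 / c1) ^ q)"
  have D0: "D \<ge> 0" using C0 c1 by (simp add: D_def)
  define \<delta>\<^sub>0 where "\<delta>\<^sub>0 = 1 / (32 * real m)"
  have \<delta>\<^sub>0: "\<delta>\<^sub>0 > 0" "\<delta>\<^sub>0 \<le> 1 / 32" using m by (auto simp: \<delta>\<^sub>0_def divide_simps)
  have main: "norm (h (\<i> * w)) \<le> max D 1 * exp \<kappa> * exp (- (c1 / 16 / \<delta>))"
    if \<delta>: "0 < \<delta>" "\<delta> \<le> \<delta>\<^sub>0" and w: "norm (w - of_real (pi / 2 - \<delta>)) = \<delta> / 2" for \<delta> w
  proof -
    define v where "v = of_real (pi / 2) - w"
    have v: "norm (v - of_real \<delta>) = \<delta> / 2"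
    proof -
      have "v - of_real \<delta> = - (w - of_real (pi / 2 - \<delta>))" by (simp add: v_def)
      then show ?thesis using w by (simp only: norm_minus_cancel)
    qed
    have d32: "\<delta> \<le> 1 / 32" using \<delta> \<delta>\<^sub>0 by linarith
    have nv: "norm v \<le> 3 / 2 * \<delta>" "norm v \<ge> \<delta> / 2"
      using norm_triangle_ineq2[of v "of_real \<delta>"] norm_triangle_ineq2[of "of_real \<delta>" v] v \<delta>
      by (auto simp: norm_minus_commute)
    have "\<bar>Re v - \<delta>\<bar> \<le> \<delta> / 2" using abs_Re_le_cmod[of "v - of_real \<delta>"] v by simp
    then have Rev: "Re v \<ge> \<delta> / 2" by linarith
    \<comment> \<open>To first order \<open>E\<close> is \<open>\<i> * v\<close>. The error is at
      most \<open>27 / 4 * \<delta>^2\<close>, and \<open>\<delta> \<le> 1 / 32\<close> makes it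
      smaller than \<open>\<delta> / 4\<close>, so \<open>E\<close> has both size and imaginary part
      of order \<open>\<delta>\<close>.\<close>
    define E where "E = exp (\<i> * v) - 1"
    have E: "norm (E - \<i> * v) \<le> \<delta> / 4"
    proof -
      have "norm (exp (\<i> * v) - (\<Sum>i\<le>1. (\<i> * v) ^ i / fact i)) \<le> exp \<bar>Re (\<i> * v)\<bar> * norm (\<i> * v) ^ Suc 1 / fact 1"
        by (rule Taylor_exp)
      then have "norm (E - \<i> * v) \<le> exp \<bar>Im v\<bar> * (norm v)\<^sup>2"
        by (simp add: E_def norm_mult algebra_simps numeral_2_eq_2)
      also have "\<dots> \<le> 3 * (3 / 2 * \<delta>)\<^sup>2"
      proof (intro mult_mono power_mono nv)
        have "\<bar>Im v\<bar> \<le> 1" using abs_Im_le_cmod[of v] nv d32 by linarith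
        then have "exp \<bar>Im v\<bar> \<le> exp 1" by simp
        then show "exp \<bar>Im v\<bar> \<le> 3" using exp_le by linarith
      qed auto
      also have "\<dots> = 27 / 4 * \<delta> * \<delta>" by (simp add: power2_eq_square)
      also have "\<dots> \<le> 27 / 4 * \<delta> * (1 / 32)" using \<delta> d32 by (intro mult_left_mono) auto
      also have "\<dots> \<le> \<delta> / 4" using \<delta> by simp
      finally show ?thesis .
    qed
    have nE: "norm E \<le> 2 * \<delta>" "norm E \<ge> \<delta> / 4"
      using norm_triangle_ineq2[of E "\<i> * v"] norm_triangle_ineq2[of "\<i> * v" E] E nv \<delta>
      by (auto simp: norm_minus_commute norm_mult)
    have "\<bar>Im E - Re v\<bar> \<le> \<delta> / 4" using abs_Im_le_cmod[of "E - \<i> * v"] E by simp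
    then have ImE: "Im E \<ge> \<delta> / 4" using Rev by linarith
    have E0: "E \<noteq> 0" using ImE \<delta> by auto
    \<comment> \<open>The preimage of \<open>p (\<i> * w)\<close> under the matrix. Its height is of
      order \<open>1 / \<delta>\<close>, so the decay at infinity becomes
      \<open>exp (- c1 / \<delta>)\<close>.\<close>
    define Z where "Z = - 1 / (2 * of_nat m * E)"
    have m0: "complex_of_nat m \<noteq> 0" using m by simp
    have ImZ: "Im Z \<ge> 1 / (32 * real m * \<delta>)"
    proof -
      have "Im (inverse E) = - Im E / (norm E)\<^sup>2" by (simp add: cmod_power2)
      moreover have "Z = - (inverse E / of_real (2 * real m))" using E0 m0 by (simp add: Z_def field_simps)
      ultimately have "Im Z = Im E / (norm E)\<^sup>2 / (2 * real m)"
        by (simp add: Im_divide_of_real cmod_power2 del: of_real_mult)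
      moreover have "(\<delta> / 4) / (2 * \<delta>)\<^sup>2 \<le> Im E / (norm E)\<^sup>2"
        using ImE nE \<delta> E0 by (intro frac_le power_mono) auto
      then have "(\<delta> / 4) / (2 * \<delta>)\<^sup>2 / (2 * real m) \<le> Im E / (norm E)\<^sup>2 / (2 * real m)"
        by (intro divide_right_mono) auto
      moreover have "(\<delta> / 4) / (2 * \<delta>)\<^sup>2 / (2 * real m) = 1 / (32 * real m * \<delta>)"
        using \<delta> m by (simp add: power2_eq_square)
      ultimately show ?thesis by simp
    qed
    have "1 \<le> 1 / (32 * real m * \<delta>)" using \<delta> m by (simp add: \<delta>\<^sub>0_def field_simps)
    then have ImZ1: "Im Z \<ge> 1" using ImZ by linarith
    have den: "of_int (2 * int m) * Z + of_int (- 1) = - (exp (\<i> * v) / E)"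
      using E0 m0 by (simp add: Z_def E_def field_simps)
    have piw: "p (\<i> * w) = - exp (- (\<i> * v)) / (2 * of_nat m)"
    proof -
      have "\<i> * w = \<i> * of_real (pi / 2) + - (\<i> * v)" by (simp add: v_def algebra_simps)
      moreover have "exp (\<i> * of_real (pi / 2)) = \<i>" by (metis cis_conv_exp cis_pi_half)
      ultimately have "exp (\<i> * w) = \<i> * exp (- (\<i> * v))" by (simp only: exp_add)
      then show ?thesis by (simp add: p_def)
    qed
    have num: "(of_int (- 1) * Z + of_int 0) / (of_int (2 * int m) * Z + of_int (- 1)) = p (\<i> * w)"
      unfolding den piw using E0 m0 by (simp add: Z_def exp_minus field_simps)
    have "?G Z = F (p (\<i> * w)) / (- (exp (\<i> * v) / E)) ^ q"
      unfolding G_def num unfolding den q_def ..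
    then have "F (p (\<i> * w)) = ?G Z * (- (exp (\<i> * v) / E)) ^ q"
      using E0 by simp
    then have "norm (F (p (\<i> * w))) = norm (?G Z) * (norm (exp (\<i> * v)) / norm E) ^ q"
      by (simp only: norm_mult norm_power norm_minus_cancel norm_divide)
    also have "\<dots> \<le> (C * exp (- (c1 / \<delta>))) * (8 / \<delta>) ^ q"
    proof (intro mult_mono power_mono)
      have "norm (?G Z) \<le> C * exp (- 2 * pi * Im Z)" by (rule C[OF ImZ1])
      also have "\<dots> \<le> C * exp (- (c1 / \<delta>))"
      proof (intro mult_left_mono C0)
        have "2 * pi * (1 / (32 * real m * \<delta>)) \<le> 2 * pi * Im Z" using ImZ by (intro mult_left_mono) auto
        then show "exp (- 2 * pi * Im Z) \<le> exp (- (c1 / \<delta>))" by (simp add: c1_def mult_ac)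
      qed
      finally show "norm (?G Z) \<le> C * exp (- (c1 / \<delta>))" .
      have "norm (exp (\<i> * v)) \<le> 1 + norm E"
        using norm_triangle_ineq[of 1 E] by (simp add: E_def)
      also have "\<dots> \<le> 2" using nE d32 by linarith
      finally have "norm (exp (\<i> * v)) / norm E \<le> 2 / (\<delta> / 4)" using nE \<delta> by (intro frac_le) auto
      then show "norm (exp (\<i> * v)) / norm E \<le> 8 / \<delta>" by simp
    qed (use C0 in auto)
    also have "(8 / \<delta>) ^ q \<le> fact q * (16 / c1) ^ q * exp (c1 / (2 * \<delta>))"
    proof -
      have "(\<lambda>n. (c1 / (2 * \<delta>)) ^ n /\<^sub>R fact n) sums exp (c1 / (2 * \<delta>))" by (rule exp_converges)
      then have "sum (\<lambda>n. (c1 / (2 * \<delta>)) ^ n /\<^sub>R fact n) {q} \<le> exp (c1 / (2 * \<delta>))"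
        using sum_le_suminf[of "\<lambda>n. (c1 / (2 * \<delta>)) ^ n /\<^sub>R fact n" "{q}"] c1 \<delta> by (auto simp: sums_iff)
      then have "(c1 / (2 * \<delta>)) ^ q / fact q \<le> exp (c1 / (2 * \<delta>))"
        by (simp only: sum.insert sum.empty finite.emptyI empty_iff not_False_eq_True add_0_right real_scaleR_def divide_inverse mult.commute)
      then have "(c1 / (2 * \<delta>)) ^ q \<le> fact q * exp (c1 / (2 * \<delta>))"
        by (subst (asm) pos_divide_le_eq) (simp_all only: fact_gt_zero mult.commute)
      then have "(16 / c1) ^ q * (c1 / (2 * \<delta>)) ^ q \<le> (16 / c1) ^ q * (fact q * exp (c1 / (2 * \<delta>)))"
        using c1 by (intro mult_left_mono) auto
      moreover have "16 / c1 * (c1 / (2 * \<delta>)) = 8 / \<delta>" using c1 by simp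
      ultimately show ?thesis by (simp only: power_mult_distrib[symmetric] mult_ac)
    qed
    then have "(C * exp (- (c1 / \<delta>))) * (8 / \<delta>) ^ q \<le> (C * exp (- (c1 / \<delta>))) * (fact q * (16 / c1) ^ q * exp (c1 / (2 * \<delta>)))"
      using C0 by (intro mult_left_mono) auto
    also have "\<dots> = D * (exp (- (c1 / \<delta>)) * exp (c1 / (2 * \<delta>)))" by (simp add: D_def)
    also have "exp (- (c1 / \<delta>)) * exp (c1 / (2 * \<delta>)) = exp (- (c1 / (2 * \<delta>)))"
      using \<delta> by (simp add: exp_add[symmetric] field_simps)
    finally have F: "norm (F (p (\<i> * w))) \<le> D * exp (- (c1 / (2 * \<delta>)))" .
    \<comment> \<open>Half of \<open>c1\<close> is left after absorbing the automorphy factor, and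
      the eighth root divides it by 8 more, whence 16.\<close>
    have "norm (f (p (\<i> * w))) \<le> max D 1 * exp (- (c1 / 16 / \<delta>))"
    proof (rule power_le_imp_le_base)
      have "norm (f (p (\<i> * w))) ^ Suc 7 \<le> D * exp (- (c1 / (2 * \<delta>)))"
        using F by (simp add: F_def norm_power)
      also have "\<dots> \<le> max D 1 ^ 8 * exp (- (c1 / (2 * \<delta>)))"
      proof (intro mult_right_mono)
        have "D \<le> max D 1 ^ 1" by simp
        also have "\<dots> \<le> max D 1 ^ 8" by (intro power_increasing) auto
        finally show "D \<le> max D 1 ^ 8" .
      qed auto
      also have "exp (- (c1 / (2 * \<delta>))) = exp (- (c1 / 16 / \<delta>)) ^ 8"
        by (simp flip: exp_of_nat_mult)
      finally show "norm (f (p (\<i> * w))) ^ Suc 7 \<le> (max D 1 * exp (- (c1 / 16 / \<delta>))) ^ Suc 7"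
        by (simp add: power_mult_distrib)
    qed auto
    moreover have "norm (exp (of_real \<kappa> * (\<i> * w))) \<le> exp \<kappa>"
    proof -
      have "\<bar>Im w\<bar> \<le> 1"
        using abs_Im_le_cmod[of "w - of_real (pi / 2 - \<delta>)"] w d32 by simp
      then have "- (\<kappa> * Im w) \<le> \<kappa> * 1"
        unfolding mult_minus_right[symmetric] by (intro mult_left_mono) (auto simp: \<kappa>_def)
      then show ?thesis by simp
    qed
    ultimately have "norm (f (p (\<i> * w))) * norm (exp (of_real \<kappa> * (\<i> * w))) \<le> (max D 1 * exp (- (c1 / 16 / \<delta>))) * exp \<kappa>"
      by (intro mult_mono) auto
    then show ?thesis by (simp add: h_def norm_mult mult_ac)
  qed
  have "c1 / 16 > 0" using c1 by simp
  with main \<delta>\<^sub>0(1) show ?thesis by blast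
qed

section \<open>The Dirichlet series and its continuation\<close>

sublocale strip_function h
  by unfold_locales (use h_holomorphic h_decay in auto)

text \<open>The Fourier series is integrated term by term against \<open>exp (s * u)\<close>, each
  term giving a Gamma integral. The bound \<open>n^(k + 1)\<close> for the coefficients makes the
  sum converge absolutely when \<open>Re s > k + 2\<close>.\<close>

lemma \<Lambda>_Dirichlet_series:
  assumes s: "Re s > real k + 2"
  shows "(\<lambda>n. a (Suc n) * of_nat (Suc n) powr (- s)) sums (of_real (pi / real m) powr s * rGamma s * \<Lambda> (s - of_real \<kappa>))"
proof -
  obtain C where C0: "C \<ge> 0" and C: "\<And>n. n \<ge> 1 \<Longrightarrow> norm (a n) \<le> C * real n ^ (k + 1)"
    using coeff_bound by blast
  define c where "c = (\<lambda>n. pi / real m * real (Suc n))"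
  have c: "c n > 0" for n using m by (simp add: c_def)
  define g where "g = (\<lambda>n u. a (Suc n) * (exp (- of_real (c n * exp u)) * exp (s * of_real u)) :: complex)"
  have s0: "Re s > 0" using s by linarith
  define \<gamma> where "\<gamma> = norm (Gamma (of_real (Re s) :: complex))"
  have gint: "integrable lborel (g n)" for n
    unfolding g_def by (intro integrable_mult_right integrable_exp_minus_exp c s0)
  have geq: "a (Suc n) * exp (2 * of_real pi * \<i> * of_nat (Suc n) * p (of_real u)) * exp (s * of_real u) = g n u" for n u
  proof -
    have "2 * of_real pi * \<i> * of_nat (Suc n) * p (of_real u) = - complex_of_real (c n * exp u)"
      using m by (simp add: p_def c_def exp_of_real[symmetric] field_simps)
    then show ?thesis by (simp only: g_def mult.assoc)
  qed
  have gsums: "(\<lambda>n. g n u) sums (h (of_real u) * exp (of_real u * (s - of_real \<kappa>)))" for u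
  proof -
    have "(\<lambda>n. a (Suc n) * exp (2 * of_real pi * \<i> * of_nat (Suc n) * p (of_real u)) * exp (s * of_real u)) sums (f (p (of_real u)) * exp (s * of_real u))"
      by (intro sums_mult2 fourier Im_p_pos) auto
    moreover have "f (p (of_real u)) * exp (s * of_real u) = h (of_real u) * exp (of_real u * (s - of_real \<kappa>))"
      by (simp add: h_def mult.assoc exp_add[symmetric] algebra_simps)
    ultimately show ?thesis by (simp only: geq)
  qed
  \<comment> \<open>Taking norms replaces \<open>s\<close> by \<open>Re s\<close>, so the dominating
    integral is again a Gamma integral and is known exactly.\<close>
  have ngint: "(LBINT u. norm (g n u)) = norm (a (Suc n)) * (\<gamma> * c n powr (- Re s))" for n
  proof -
    have "complex_of_real (LBINT u. norm (g n u)) = (LBINT u. complex_of_real (norm (g n u)))"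
      by (rule integral_complex_of_real[symmetric])
    also have "\<dots> = (LBINT u. of_real (norm (a (Suc n))) * (exp (- of_real (c n * exp u)) * exp (of_real (Re s) * of_real u)))"
      by (intro Bochner_Integration.integral_cong refl) (simp add: g_def norm_mult exp_of_real[symmetric])
    also have "\<dots> = of_real (norm (a (Suc n))) * (Gamma (of_real (Re s)) * of_real (c n) powr (- of_real (Re s)))"
      using Gamma_exp_integral[OF c[of n], of "of_real (Re s)"] s0 by simp
    finally have "norm (complex_of_real (LBINT u. norm (g n u))) = norm (a (Suc n)) * (\<gamma> * c n powr (- Re s))"
      using c[of n] by (simp add: \<gamma>_def norm_mult norm_powr_real_powr del: of_real_mult)
    then show ?thesis by (simp add: integral_nonneg_AE)
  qed
  have summ: "summable (\<lambda>n. LBINT u. norm (g n u))"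
  proof (rule summable_comparison_test)
    define K where "K = C * (\<gamma> * (pi / real m) powr (- Re s))"
    have "summable (\<lambda>n. real n powr (real k + 1 - Re s))"
      using s by (subst summable_real_powr_iff) linarith
    then have "summable (\<lambda>n. real (Suc n) powr (real k + 1 - Re s))"
      by (subst summable_Suc_iff)
    then show "summable (\<lambda>n. K * real (Suc n) powr (real k + 1 - Re s))" by (rule summable_mult)
    show "\<exists>N. \<forall>n\<ge>N. norm (LBINT u. norm (g n u)) \<le> K * real (Suc n) powr (real k + 1 - Re s)"
    proof (intro exI allI impI)
      fix n :: nat
      have "norm (LBINT u. norm (g n u)) = norm (a (Suc n)) * (\<gamma> * c n powr (- Re s))"
        by (simp add: ngint abs_mult \<gamma>_def)
      also have "\<dots> \<le> (C * real (Suc n) ^ (k + 1)) * (\<gamma> * c n powr (- Re s))"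
        using C[of "Suc n"] by (intro mult_right_mono) (auto simp: \<gamma>_def)
      also have "c n powr (- Re s) = (pi / real m) powr (- Re s) * real (Suc n) powr (- Re s)"
        unfolding c_def by (rule powr_mult)
      also have "real (Suc n) ^ (k + 1) = real (Suc n) powr (real k + 1)"
        by (subst powr_realpow[symmetric]) (auto simp: add_ac)
      also have "(C * real (Suc n) powr (real k + 1)) * (\<gamma> * ((pi / real m) powr (- Re s) * real (Suc n) powr (- Re s)))
         = K * real (Suc n) powr (real k + 1 - Re s)"
        by (simp add: K_def powr_diff powr_minus field_simps)
      finally show "norm (LBINT u. norm (g n u)) \<le> K * real (Suc n) powr (real k + 1 - Re s)" .
    qed
  qed
  have ae: "AE u in lborel. summable (\<lambda>n. norm (g n u))"
  proof (rule AE_I2)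
    fix u :: real
    define r where "r = exp (- (pi / real m * exp u))"
    have r: "0 < r" "r < 1" using m by (auto simp: r_def)
    show "summable (\<lambda>n. norm (g n u))"
    proof (rule summable_comparison_test)
      have "summable (\<lambda>n. real n ^ (k + 1) * r ^ n)"
      proof (rule summable_comparison_test_ev)
        define t where "t = pi / real m * exp u"
        have t: "t > 0" using m by (simp add: t_def)
        have "(\<lambda>n. real n powr (real k + 3) * exp (- t * real n)) \<longlonglongrightarrow> 0" using t by real_asymp
        then have "eventually (\<lambda>n. real n powr (real k + 3) * exp (- t * real n) < 1) sequentially"
          by (rule order_tendstoD(2)) simp
        then show "eventually (\<lambda>n. norm (real n ^ (k + 1) * r ^ n) \<le> real n powr (- 2)) sequentially"
          using eventually_gt_at_top[of 0]
        proof eventually_elim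
          case (elim n)
          have "real n ^ (k + 1) = real n powr (real (k + 1))" using elim by (subst powr_realpow) auto
          also have "\<dots> = real n powr (- 2) * real n powr (real k + 3)" by (simp flip: powr_add)
          finally have "real n ^ (k + 1) * r ^ n = real n powr (- 2) * (real n powr (real k + 3) * exp (- t * real n))"
            by (simp add: r_def t_def mult_ac flip: exp_of_nat_mult)
          also have "\<dots> \<le> real n powr (- 2) * 1" using elim by (intro mult_left_mono) auto
          finally show ?case using r by simp
        qed
        show "summable (\<lambda>n. real n powr (- 2))" by (subst summable_real_powr_iff) simp
      qed
      then have "summable (\<lambda>n. real (Suc n) ^ (k + 1) * r ^ Suc n)" by (subst summable_Suc_iff)
      then show "summable (\<lambda>n. (C * exp (Re s * u)) * (real (Suc n) ^ (k + 1) * r ^ Suc n))" by (rule summable_mult)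
      show "\<exists>N. \<forall>n\<ge>N. norm (norm (g n u)) \<le> (C * exp (Re s * u)) * (real (Suc n) ^ (k + 1) * r ^ Suc n)"
      proof (intro exI allI impI)
        fix n :: nat
        have "c n * exp u = real (Suc n) * (pi / real m * exp u)" by (simp add: c_def)
        then have "exp (- (c n * exp u)) = r ^ Suc n" by (simp add: r_def del: power_Suc flip: exp_of_nat_mult)
        moreover have "norm (g n u) = norm (a (Suc n)) * (exp (- (c n * exp u)) * exp (Re s * u))"
          by (simp add: g_def norm_mult)
        ultimately have "norm (g n u) = norm (a (Suc n)) * (r ^ Suc n * exp (Re s * u))" by simp
        also have "\<dots> \<le> (C * real (Suc n) ^ (k + 1)) * (r ^ Suc n * exp (Re s * u))"
          using C[of "Suc n"] r by (intro mult_right_mono) auto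
        finally show "norm (norm (g n u)) \<le> (C * exp (Re s * u)) * (real (Suc n) ^ (k + 1) * r ^ Suc n)"
          by (simp add: mult_ac)
      qed
    qed
  qed
  have "(\<lambda>n. integral\<^sup>L lborel (g n)) sums (LBINT u. (\<Sum>n. g n u))"
    by (rule sums_integral[OF gint ae summ])
  also have "(LBINT u. (\<Sum>n. g n u)) = \<Lambda> (s - of_real \<kappa>)"
    using gsums by (simp add: \<Lambda>_def sums_iff)
  finally have "(\<lambda>n. of_real (pi / real m) powr s * rGamma s * integral\<^sup>L lborel (g n)) sums (of_real (pi / real m) powr s * rGamma s * \<Lambda> (s - of_real \<kappa>))"
    by (rule sums_mult)
  moreover have "of_real (pi / real m) powr s * rGamma s * integral\<^sup>L lborel (g n) = a (Suc n) * of_nat (Suc n) powr (- s)" for n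
  proof -
    have "integral\<^sup>L lborel (g n) = a (Suc n) * (Gamma s * of_real (c n) powr (- s))"
      unfolding g_def using Gamma_exp_integral[OF c[of n] s0] by simp
    also have "of_real (c n) powr (- s) = of_real (pi / real m) powr (- s) * of_nat (Suc n) powr (- s)"
    proof -
      have "complex_of_real (c n) = of_real (pi / real m) * of_real (real (Suc n))"
        by (simp only: c_def of_real_mult)
      moreover have "(complex_of_real (pi / real m) * of_real (real (Suc n))) powr (- s) =
          of_real (pi / real m) powr (- s) * of_real (real (Suc n)) powr (- s)"
        by (rule powr_times_real) auto
      ultimately show ?thesis by (simp only: of_real_of_nat_eq)
    qed
    finally have "of_real (pi / real m) powr s * rGamma s * integral\<^sup>L lborel (g n) =
        (of_real (pi / real m) powr s * of_real (pi / real m) powr (- s)) * (rGamma s * Gamma s) * (a (Suc n) * of_nat (Suc n) powr (- s))"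
      by (simp only: mult_ac)
    moreover have "complex_of_real (pi / real m) powr s * of_real (pi / real m) powr (- s) = 1"
      using m by (simp add: powr_minus)
    moreover have "rGamma s * Gamma s = 1"
    proof -
      have "s \<notin> \<int>\<^sub>\<le>\<^sub>0" using s0 by (auto elim!: nonpos_Ints_cases)
      then show ?thesis by (simp add: Gamma_def rGamma_eq_zero_iff)
    qed
    ultimately show ?thesis by (simp only: mult_1_left)
  qed
  ultimately show ?thesis by simp
qed

text \<open>The reciprocal Gamma function and the transform are both entire, so the formula valid in
  a half-plane is already the continuation; uniqueness identifies it.\<close>

lemma entire_L_eq:
  "entire_L a = (\<lambda>s. of_real (pi / real m) powr s * rGamma s * \<Lambda> (s - of_real \<kappa>))"
proof (rule is_entire_L_imp_entire_L)
  have "(\<lambda>s. \<Lambda> (s - of_real \<kappa>)) holomorphic_on UNIV"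
    by (rule holomorphic_on_compose_gen[OF _ \<Lambda>_holomorphic, unfolded o_def]) (auto intro!: holomorphic_intros)
  then have "(\<lambda>s. of_real (pi / real m) powr s * rGamma s * \<Lambda> (s - of_real \<kappa>)) holomorphic_on UNIV"
    using m by (intro holomorphic_intros) auto
  then show "is_entire_L a (\<lambda>s. of_real (pi / real m) powr s * rGamma s * \<Lambda> (s - of_real \<kappa>))"
    unfolding is_entire_L_def using \<Lambda>_Dirichlet_series by blast
qed

end

section \<open>Transfer to the zeros of the L-function on the central line\<close>

theorem corollary1p1:
  fixes k N :: nat and f :: "complex \<Rightarrow> complex" and a :: "nat \<Rightarrow> complex"
  assumes "k \<ge> 1"
    and "N > 0" and "\<exists>m::nat. N = m ^ 2"
    and "f \<in> half_cusp_forms k (4 * N)"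
    and "\<exists>z\<in>upper_half_plane. f z \<noteq> 0"
    and "\<forall>z\<in>upper_half_plane.
           (\<lambda>n. a (Suc n) * exp (2 * of_real pi * \<i> * of_nat (Suc n) * z)) sums f z"
    and "(\<forall>z\<in>upper_half_plane. fricke k (4 * N) f z = f z) \<or>
         (\<forall>z\<in>upper_half_plane. fricke k (4 * N) f z = - f z)"
    and "(\<forall>n\<ge>1. Im (a n) = 0) \<or> (\<forall>n\<ge>1. Re (a n) = 0)"
  shows "\<exists>d::real. d > 0 \<and>
           Limsup at_top (\<lambda>T::real. ereal
             (real (odd_zero_count (entire_L a) (real k / 2 + 1 / 4) T) / T powr (1 / 2)))
           > ereal d"
proof -
  obtain m where N: "N = m\<^sup>2" using assms(3) by blast
  obtain \<sigma> :: real where \<sigma>: "\<sigma> = 1 \<or> \<sigma> = -1"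
    and fricke: "\<And>z. Im z > 0 \<Longrightarrow> fricke k (4 * m\<^sup>2) f z = of_real \<sigma> * f z"
    using assms(7)
  proof
    assume "\<forall>z\<in>upper_half_plane. fricke k (4 * N) f z = f z"
    then show ?thesis using that[of 1] by (simp add: N upper_half_plane_def)
  next
    assume "\<forall>z\<in>upper_half_plane. fricke k (4 * N) f z = - f z"
    then show ?thesis using that[of "-1"] by (simp add: N upper_half_plane_def)
  qed
  obtain \<omega> :: complex where \<omega>: "\<omega> \<noteq> 0" and real: "\<And>n. n \<ge> 1 \<Longrightarrow> Im (a n / \<omega>) = 0"
    using assms(8)
  proof
    assume "\<forall>n\<ge>1. Im (a n) = 0"
    then show ?thesis using that[of 1] by simp
  next
    assume "\<forall>n\<ge>1. Re (a n) = 0"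
    then show ?thesis using that[of \<i>] by simp
  qed
  interpret fricke_cusp_form k m f a \<sigma>
  proof unfold_locales
    show "m > 0" using assms(2) N by simp
    show "f \<in> half_cusp_forms k (4 * m\<^sup>2)" using assms(4) N by simp
    show "(\<lambda>n. a (Suc n) * exp (2 * of_real pi * \<i> * of_nat (Suc n) * z)) sums f z" if "Im z > 0" for z
      using assms(6) that unfolding upper_half_plane_def by blast
    show "\<exists>z. Im z > 0 \<and> f z \<noteq> 0" using assms(5) unfolding upper_half_plane_def by blast
  qed (fact \<sigma>, fact fricke)
  interpret parity_strip_function h \<sigma> \<omega>
    using \<sigma> \<omega> h_parity h_real_valued[OF real] h_nonzero by unfold_locales auto
  define L where "L = entire_L a"
  have L: "L = (\<lambda>s. of_real (pi / real m) powr s * rGamma s * \<Lambda> (s - of_real \<kappa>))"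
    unfolding L_def by (rule entire_L_eq)
  have \<kappa>: "\<kappa> > 0" by (simp add: \<kappa>_def)
  \<comment> \<open>The reciprocal Gamma function vanishes only at nonpositive integers, and
    \<open>\<kappa> > 0\<close> keeps the central line away from them. Zeros and their orders are
    therefore those of the transform.\<close>
  have factor: "of_real (pi / real m) powr s * rGamma s \<noteq> 0" if "Re s = \<kappa>" for s
  proof -
    have "s \<notin> \<int>\<^sub>\<le>\<^sub>0" using that \<kappa> by (auto elim!: nonpos_Ints_cases)
    then show ?thesis using m by (simp add: rGamma_eq_zero_iff)
  qed
  have zeros: "L (of_real \<kappa> + \<i> * of_real t) = 0 \<longleftrightarrow> H t = 0" for t
    using factor[of "of_real \<kappa> + \<i> * of_real t"] by (simp add: L)
  have order: "zorder L (of_real \<kappa> + \<i> * of_real t) = zorder \<Lambda> (\<i> * of_real t)" for t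
  proof -
    let ?s = "of_real \<kappa> + \<i> * of_real t"
    let ?E = "\<lambda>s. of_real (pi / real m) powr s * rGamma s :: complex"
    let ?M = "\<lambda>s. \<Lambda> (s - of_real \<kappa>)"
    have E: "?E holomorphic_on UNIV" by (intro holomorphic_intros)
    have M: "?M holomorphic_on UNIV"
      by (rule holomorphic_on_compose_gen[OF _ \<Lambda>_holomorphic, unfolded o_def]) (auto intro!: holomorphic_intros)
    have Ea: "?E analytic_on {?s}" and Ma: "?M analytic_on {?s}"
      using E M unfolding analytic_on_holomorphic by blast+
    have Enz: "?E ?s \<noteq> 0" by (rule factor) simp
    have "isCont ?E ?s"
      by (rule continuous_on_interior[OF holomorphic_on_imp_continuous_on[OF E]]) auto
    then have "eventually (\<lambda>s. ?E s \<noteq> 0) (at ?s)"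
      using Enz unfolding isCont_def by (rule tendsto_imp_eventually_ne)
    moreover have "eventually (\<lambda>s. ?M s \<noteq> 0) (at ?s)"
    proof -
      obtain t0 where "H t0 \<noteq> 0" using \<Lambda>_nonzero by blast
      then have "?M (\<i> * of_real t0 + of_real \<kappa>) \<noteq> 0" by simp
      from non_zero_neighbour_alt[OF M open_UNIV connected_UNIV UNIV_I UNIV_I this]
      show ?thesis by (rule eventually_mono) auto
    qed
    ultimately have "eventually (\<lambda>s. ?E s * ?M s \<noteq> 0) (at ?s)" by eventually_elim simp
    then have "zorder L ?s = zorder ?E ?s + zorder ?M ?s"
      unfolding L by (rule zorder_times_analytic[OF Ea Ma])
    also have "zorder ?E ?s = 0" by (rule zorder_eq_0I[OF Ea Enz])
    also have "zorder ?M ?s = zorder \<Lambda> (\<i> * of_real t)"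
      unfolding zorder_shift[of ?M ?s] zorder_shift[of \<Lambda> "\<i> * of_real t"] by (simp add: algebra_simps)
    finally show ?thesis by simp
  qed
  \<comment> \<open>Only an inequality, as \<open>Z A\<close> omits the end points, but in the
    direction required. Finiteness of the larger set matters, since \<open>card\<close> of an
    infinite set is 0.\<close>
  have count: "card (Z A) \<le> odd_zero_count L \<kappa> A" for A
  proof -
    let ?e = "\<lambda>t. of_real \<kappa> + \<i> * complex_of_real t"
    let ?S = "{s. Re s = \<kappa> \<and> 0 \<le> Im s \<and> Im s \<le> A \<and> L s = 0 \<and> odd (zorder L s)}"
    have "?S \<subseteq> ?e ` {t. 0 \<le> t \<and> t \<le> A \<and> R t = 0}"
    proof
      fix s assume s: "s \<in> ?S"
      have e: "s = ?e (Im s)" using s by (simp add: complex_eq_iff)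
      then have "\<Lambda> (\<i> * of_real (Im s)) = 0" using s zeros[of "Im s"] by simp
      then have "R (Im s) = 0" using \<eta>_nonzero by (simp add: \<Lambda>_eq_R)
      with s e show "s \<in> ?e ` {t. 0 \<le> t \<and> t \<le> A \<and> R t = 0}" by blast
    qed
    then have "finite ?S" by (rule finite_subset) (intro finite_imageI finite_zeros)
    moreover have "?e ` Z A \<subseteq> ?S" using zeros order by (auto simp: Z_def)
    ultimately have "card (?e ` Z A) \<le> card ?S" by (rule card_mono)
    moreover have "card (?e ` Z A) = card (Z A)" by (rule card_image) (auto simp: inj_on_def)
    ultimately show ?thesis by (simp add: odd_zero_count_def)
  qed
  obtain c \<delta>\<^sub>0 B where "c > 0" "\<delta>\<^sub>0 > 0" "\<And>\<delta> w. 0 < \<delta> \<Longrightarrow> \<delta> \<le> \<delta>\<^sub>0 \<Longrightarrow> norm (w - of_real (pi / 2 - \<delta>)) = \<delta> / 2 \<Longrightarrow>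
        norm (h (\<i> * w)) \<le> B * exp (- (c / \<delta>))"
    using h_cusp_decay by blast
  from odd_zeros_not_sparse[OF this] obtain \<epsilon> where \<epsilon>: "\<epsilon> > 0"
    and sparse: "\<not> (\<exists>T. \<forall>A\<ge>T. real (card (Z A)) \<le> \<epsilon> * sqrt A)" by blast
  let ?q = "\<lambda>T::real. ereal (real (odd_zero_count L \<kappa> T) / T powr (1 / 2))"
  \<comment> \<open>Halving \<open>\<epsilon>\<close> provides the strict gap: an upper limit of at
    most \<open>\<epsilon> / 2\<close> puts the quotient eventually below \<open>\<epsilon>\<close>,
    which is the excluded sparsity.\<close>
  have "Limsup at_top ?q > ereal (\<epsilon> / 2)"
  proof (rule ccontr)
    assume "\<not> ?thesis"
    then have "Limsup at_top ?q \<le> ereal (\<epsilon> / 2)" by (rule leI)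
    also have "\<dots> < ereal \<epsilon>" using \<epsilon> by simp
    finally have "eventually (\<lambda>T. ?q T < ereal \<epsilon>) at_top" by (rule Limsup_lessD)
    then have "eventually (\<lambda>T. real (card (Z T)) \<le> \<epsilon> * sqrt T) at_top"
      using eventually_gt_at_top[of 0]
    proof eventually_elim
      case (elim T)
      then have "real (odd_zero_count L \<kappa> T) < \<epsilon> * sqrt T"
        by (simp add: powr_half_sqrt pos_divide_less_eq)
      moreover have "real (card (Z T)) \<le> real (odd_zero_count L \<kappa> T)" using count by simp
      ultimately show ?case by linarith
    qed
    with sparse show False unfolding eventually_at_top_linorder by blast
  qed
  then have "Limsup at_top (\<lambda>T::real. ereal
             (real (odd_zero_count (entire_L a) (real k / 2 + 1 / 4) T) / T powr (1 / 2))) > ereal (\<epsilon> / 2)"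
    by (simp only: L_def \<kappa>_def)
  then show ?thesis using \<epsilon> by (intro exI[of _ "\<epsilon> / 2"]) auto
qed

end
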